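(* Let $N_1,N_2$ be positive integers. For any given $L\in\mathbb{R}$ and $\gamma\in\big(2(N_2+1),\,2(N_1+N_2+1)\big)$ there exists $\alpha_\gamma=\alpha_\gamma(L)\in\mathbb{R}$ such that the unique solution $(U,V)$ of the Cauchy problem (CP) (see context) with $$(U(0),V(0))=\left(\alpha_\gamma,\ \frac{(2N_2+1)\alpha_\gamma-L}{2N_1+1}\right)$$ satisfies $$\gamma=F_2(\infty)=\int_0^\infty r^{2N_1+1}e^{U(r)}\left(r^{2N_2}e^{V(r)}-1\right)dr.$$ Similarly, for any $L\in\mathbb{R}$ and $\gamma\in\big(2(N_1+N_2+1),\infty\big)$ there exists $\alpha_\gamma=\alpha_\gamma(L)\in\mathbb{R}$ such that the unique solution $(U,V)$ of (CP) with $(U(0),V(0))=\left(\alpha_\gamma,\frac{(2N_2+1)\alpha_\gamma-L}{2N_1+1}\right)$ satisfies $$\gamma=F_1(\infty)=\int_0^\infty r^{2N_2+1}e^{V(r)}\left(r^{2N_1}e^{U(r)}+1\right)dr.$$ Moreover, for any $L\in\mathbb{R}$ and $E>0$ there exists $\alpha_E=\alpha_E(L)\in\mathbb{R}$ such that the solution of (CP) with $(U(0),V(0))=\left(\alpha_E,\frac{(2N_2+1)\alpha_E-L}{2N_1+1}\right)$ satisfies $$N(N-1)\sigma^3k\int_0^\infty\left(t^{2N_1+1}e^{U(t)}+t^{2N_2+1}e^{V(t)}\right)dt=E.$$ Furthermore, for these solutions, setting $\beta_i=\frac12F_i(\infty)-N_i$ ($i=1,2$), one has $\beta_1>N_2+1$,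 $1<\beta_2<N_1+1$, and $$0<(\beta_1-1)(\beta_2-1)<(N_1+1)(N_2+1),$$ $$\beta_2(\beta_1-1)>N_2(N_1+1),$$ $$0<\beta_1(\beta_2-1)<N_1(N_2+1).$$
   Context: $N\ge 2$ is a fixed integer and $\sigma,k>0$ are fixed constants. The Cauchy problem (CP) for $(U(r),V(r))$, $r>0$, is $$-(rU')'=r^{2N_2+1}e^{V}\left(r^{2N_1}e^{U}+1\right),\qquad -(rV')'=r^{2N_1+1}e^{U}\left(r^{2N_2}e^{V}-1\right),$$ $$U(0)=\alpha_1,\quad V(0)=\alpha_2,\quad U'(0)=V'(0)=0,$$ with $(\alpha_1,\alpha_2)\in\mathbb{R}^2$; it has a unique global solution on $[0,\infty)$. For a solution set $$F_1(r)=\int_0^rt^{2N_2+1}e^{V(t)}\left(t^{2N_1}e^{U(t)}+1\right)dt,\qquad F_2(r)=\int_0^rt^{2N_1+1}e^{U(t)}\left(t^{2N_2}e^{V(t)}-1\right)dt,$$ and $F_i(\infty)=\lim_{r\to\infty}F_i(r)$. *)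

theory Defs
  imports "HOL-Analysis.Analysis"
begin

definition dens1 :: "nat \<Rightarrow> nat \<Rightarrow> (real \<Rightarrow> real) \<Rightarrow> (real \<Rightarrow> real) \<Rightarrow> real \<Rightarrow> real" where
  "dens1 N1 N2 U V t = t ^ (2 * N2 + 1) * exp (V t) * (t ^ (2 * N1) * exp (U t) + 1)"

definition dens2 :: "nat \<Rightarrow> nat \<Rightarrow> (real \<Rightarrow> real) \<Rightarrow> (real \<Rightarrow> real) \<Rightarrow> real \<Rightarrow> real" where
  "dens2 N1 N2 U V t = t ^ (2 * N1 + 1) * exp (U t) * (t ^ (2 * N2) * exp (V t) - 1)"

(* A classical solution on [0,\<infinity>). At 0 the derivatives are one-sided, so the values
   of U and V at negative arguments are irrelevant. *)
definition cp_solution ::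
  "nat \<Rightarrow> nat \<Rightarrow> real \<Rightarrow> real \<Rightarrow> (real \<Rightarrow> real) \<Rightarrow> (real \<Rightarrow> real) \<Rightarrow> bool" where
  "cp_solution N1 N2 \<alpha>1 \<alpha>2 U V \<longleftrightarrow>
     U 0 = \<alpha>1 \<and> V 0 = \<alpha>2 \<and>
     (\<exists>U' V'.
        (\<forall>r\<ge>0. (U has_real_derivative U' r) (at r within {0..})) \<and>
        (\<forall>r\<ge>0. (V has_real_derivative V' r) (at r within {0..})) \<and>
        U' 0 = 0 \<and> V' 0 = 0 \<and>
        (\<forall>r>0. ((\<lambda>t. t * U' t) has_real_derivative - dens1 N1 N2 U V r) (at r)) \<and>
        (\<forall>r>0. ((\<lambda>t. t * V' t) has_real_derivative - dens2 N1 N2 U V r) (at r)))"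

(* Uniqueness is as a pair of functions on [0,\<infinity>). *)
definition unique_cp_solution ::
  "nat \<Rightarrow> nat \<Rightarrow> real \<Rightarrow> real \<Rightarrow> (real \<Rightarrow> real) \<Rightarrow> (real \<Rightarrow> real) \<Rightarrow> bool" where
  "unique_cp_solution N1 N2 \<alpha>1 \<alpha>2 U V \<longleftrightarrow>
     cp_solution N1 N2 \<alpha>1 \<alpha>2 U V \<and>
     (\<forall>P Q. cp_solution N1 N2 \<alpha>1 \<alpha>2 P Q \<longrightarrow> (\<forall>r\<ge>0. P r = U r \<and> Q r = V r))"

definition F1 :: "nat \<Rightarrow> nat \<Rightarrow> (real \<Rightarrow> real) \<Rightarrow> (real \<Rightarrow> real) \<Rightarrow> real \<Rightarrow> real" where
  "F1 N1 N2 U V r = integral {0..r} (dens1 N1 N2 U V)"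

definition F2 :: "nat \<Rightarrow> nat \<Rightarrow> (real \<Rightarrow> real) \<Rightarrow> (real \<Rightarrow> real) \<Rightarrow> real \<Rightarrow> real" where
  "F2 N1 N2 U V r = integral {0..r} (dens2 N1 N2 U V)"

(* F1 and F2 need not converge for every solution, so their values at infinity are
   expressed relationally; in particular finiteness is part of the assertion. *)
definition F1_at_infinity ::
  "nat \<Rightarrow> nat \<Rightarrow> (real \<Rightarrow> real) \<Rightarrow> (real \<Rightarrow> real) \<Rightarrow> real \<Rightarrow> bool" where
  "F1_at_infinity N1 N2 U V l \<longleftrightarrow>
     (F1 N1 N2 U V \<longlongrightarrow> l) at_top \<and> (dens1 N1 N2 U V has_integral l) {0..}"

definition F2_at_infinity ::
  "nat \<Rightarrow> nat \<Rightarrow> (real \<Rightarrow> real) \<Rightarrow> (real \<Rightarrow> real) \<Rightarrow> real \<Rightarrow> bool" where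
  "F2_at_infinity N1 N2 U V l \<longleftrightarrow>
     (F2 N1 N2 U V \<longlongrightarrow> l) at_top \<and> (dens2 N1 N2 U V has_integral l) {0..}"

definition energy_eq ::
  "nat \<Rightarrow> real \<Rightarrow> real \<Rightarrow> nat \<Rightarrow> nat \<Rightarrow> (real \<Rightarrow> real) \<Rightarrow> (real \<Rightarrow> real) \<Rightarrow> real \<Rightarrow> bool" where
  "energy_eq N \<sigma> k N1 N2 U V E \<longleftrightarrow>
     (\<lambda>t. t ^ (2 * N1 + 1) * exp (U t) + t ^ (2 * N2 + 1) * exp (V t)) integrable_on {0..} \<and>
     real N * (real N - 1) * \<sigma> ^ 3 * k *
       integral {0..} (\<lambda>t. t ^ (2 * N1 + 1) * exp (U t) + t ^ (2 * N2 + 1) * exp (V t)) = E"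

definition V_init :: "nat \<Rightarrow> nat \<Rightarrow> real \<Rightarrow> real \<Rightarrow> real" where
  "V_init N1 N2 L \<alpha> = ((2 * real N2 + 1) * \<alpha> - L) / (2 * real N1 + 1)"

end

theory Submission
  imports Defs
begin

text \<open>
  Write \<open>x, y, w\<close> for the integrals over \<open>[0,r]\<close> of \<open>t^(2N1+1) e^U\<close>, \<open>t^(2N2+1) e^V\<close> and
  \<open>t^(2(N1+N2)+1) e^(U+V)\<close>, so that \<open>F1 = w + y = - r U'\<close> and \<open>F2 = w - x = - r V'\<close>, and let
  \<open>p = r x'\<close>, \<open>q = r y'\<close>. Then \<open>r p' = p (2N1+2 - F1)\<close> and \<open>r q' = q (2N2+2 - F2)\<close>, and the Pohozaev
  identity expresses \<open>x, y, w\<close> at infinity as polynomials in \<open>F1, F2\<close> at infinity. If \<open>F1\<close> is bounded,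
  then everything converges, \<open>F1 > 2N1+2\<close> and \<open>F2 > 2N2+2\<close> at infinity, and the inequalities for
  \<open>\<beta>1, \<beta>2\<close> are elementary consequences of that identity.

  Call \<open>\<alpha>\<close> good if the solution started on the given line at \<open>\<alpha>\<close> has bounded \<open>F1\<close>. Goodness is detected by
  strict inequalities at a single radius which also control the tails, so the good set is open and
  the limits depend continuously on \<open>\<alpha>\<close>. For \<open>\<alpha>\<close> near \<open>+\<infinity>\<close> a rescaling leads to the Liouville equation,
  whence \<open>\<alpha>\<close> is good and \<open>x + y\<close> tends to 0. Moving to the left from there, the limit of \<open>F1\<close> must become
  unbounded before goodness is lost: a bound would persist at a finite end point of the interval,
  and it contradicts \<open>w > 2N2+2\<close> as \<open>\<alpha>\<close> tends to \<open>-\<infinity>\<close>. The intermediate value theorem gives all three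
  existence statements.
\<close>

section \<open>The radial initial value problem \<open>(r z')' = - r g(r, z)\<close>\<close>

text \<open>Write \<open>a\<close>, \<open>b\<close> for \<open>N1\<close>, \<open>N2\<close>.
  Goodness is not known for every \<open>\<alpha>\<close>, and mass may escape to infinity as
  \<open>\<alpha>\<close> varies, so continuous dependence on bounded intervals does not by itself
  carry over to the limits. The intermediate value argument therefore runs on an interval of good
  parameters, and a single unbounded quantity serves all three statements: as
  \<open>x_inf > 0\<close>, the Pohozaev identity gives
  \<open>(f1 - 2a) (f2 - 2b - 2) < 4a (b + 1)\<close>, so a large \<open>f1\<close> presses
  \<open>f2\<close> down to \<open>2b + 2\<close>; as \<open>f2 > 2b + 2\<close>, it also makes
  \<open>y_inf\<close> large, and with it the energy. At the right end a small
  \<open>x_inf + y_inf\<close> puts both fluxes near \<open>2 (a + b + 1)\<close>, the common end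
  point of the two ranges of \<gamma>. The slope of the line of initial values is what balances the
  right end. When the rescaling gives the coupling term coefficient 1, the coefficients of the other
  two terms are constant multiples of \<open>exp (- \<alpha> / (2a + 1))\<close>, and only this
  slope makes both decay at the same rate.\<close>

lemma integral_halfline:
  fixes f :: "real \<Rightarrow> 'a::banach"
  assumes "continuous_on {0..} f"
  shows continuous_integral_halfline: "continuous_on {0..} (\<lambda>r. integral {0..r} f)"
    and has_vector_derivative_integral_halfline:
      "r > 0 \<Longrightarrow> ((\<lambda>r. integral {0..r} f) has_vector_derivative f r) (at r)"
proof -
  have d: "((\<lambda>r. integral {0..r} f) has_vector_derivative f r) (at r within {0..r+1})"
    if "r \<ge> 0" for r
    by (rule integral_has_vector_derivative)
       (use that in \<open>auto intro: continuous_on_subset[OF assms]\<close>)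
  show "continuous_on {0..} (\<lambda>r. integral {0..r} f)"
    unfolding continuous_on_eq_continuous_within
  proof
    fix r :: real assume "r \<in> {0..}"
    then have "r \<ge> 0" by simp
    have "continuous (at r within {0..r+1}) (\<lambda>r. integral {0..r} f)"
      using d[OF \<open>r \<ge> 0\<close>] has_vector_derivative_continuous by blast
    moreover have "at r within {0..} = at r within {0..r+1}"
      by (rule at_within_nhd[of _ "{r-1<..<r+1}"]) auto
    ultimately show "continuous (at r within {0..}) (\<lambda>r. integral {0..r} f)"
      by simp
  qed
  show "((\<lambda>r. integral {0..r} f) has_vector_derivative f r) (at r)" if "r > 0"
    using d[of r] that at_within_Icc_at[of 0 r "r+1"] by simp
qed

section \<open>Flux and potential of a radial source\<close>

definition radial_flux :: "(real \<Rightarrow> 'a::banach) \<Rightarrow> real \<Rightarrow> 'a" where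
  "radial_flux h r = integral {0..r} (\<lambda>t. t *\<^sub>R h t)"

text \<open>The radial solution of \<open>(r z')' = - r h\<close> with zero data at the origin; the
  flux is \<open>- r z'\<close>.\<close>

definition radial_potential :: "(real \<Rightarrow> 'a::banach) \<Rightarrow> real \<Rightarrow> 'a" where
  "radial_potential h r = - integral {0..r} (\<lambda>t. radial_flux h t /\<^sub>R t)"

lemma
  fixes h :: "real \<Rightarrow> 'a::banach"
  assumes h: "continuous_on {0..} h"
  shows continuous_radial_flux: "continuous_on {0..} (radial_flux h)"
    and radial_flux_deriv: "r > 0 \<Longrightarrow> (radial_flux h has_vector_derivative r *\<^sub>R h r) (at r)"
    and continuous_radial_flux_div: "continuous_on {0..} (\<lambda>t. radial_flux h t /\<^sub>R t)"
    and continuous_radial_potential: "continuous_on {0..} (radial_potential h)"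
    and radial_potential_deriv:
      "r > 0 \<Longrightarrow> (radial_potential h has_vector_derivative - (radial_flux h r /\<^sub>R r)) (at r)"
proof -
  have c: "continuous_on {0..} (\<lambda>t. t *\<^sub>R h t)"
    by (intro continuous_intros h)
  show cf: "continuous_on {0..} (radial_flux h)"
    using continuous_integral_halfline[OF c] unfolding radial_flux_def[abs_def] .
  show "r > 0 \<Longrightarrow> (radial_flux h has_vector_derivative r *\<^sub>R h r) (at r)"
    using has_vector_derivative_integral_halfline[OF c] unfolding radial_flux_def[abs_def] .
  have "compact (h ` {0..1})"
    by (intro compact_continuous_image continuous_on_subset[OF h]) auto
  then obtain M where M: "\<And>t. t \<in> {0..1} \<Longrightarrow> norm (h t) \<le> M"
    by (meson bounded_iff compact_imp_bounded imageI)
  have M0: "M \<ge> 0" using order_trans[OF norm_ge_zero M[of 0]] by simp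
  have b: "norm (radial_flux h t /\<^sub>R t) \<le> M * t" if t: "t \<in> {0..1}" for t
  proof (cases "t = 0")
    case False
    have "norm (integral {0..t} (\<lambda>t. t *\<^sub>R h t)) \<le> (t * M) * (t - 0)"
    proof (rule integral_bound)
      show "continuous_on {0..t} (\<lambda>t. t *\<^sub>R h t)"
        using c by (rule continuous_on_subset) auto
      show "norm (s *\<^sub>R h s) \<le> t * M" if "s \<in> {0..t}" for s
        using that t M[of s] by (auto intro!: mult_mono)
    qed (use t in auto)
    then show ?thesis using False t by (simp add: radial_flux_def field_simps)
  qed simp
  show cd: "continuous_on {0..} (\<lambda>t. radial_flux h t /\<^sub>R t)"
    unfolding continuous_on_eq_continuous_within
  proof
    fix r :: real assume "r \<in> {0..}"
    show "continuous (at r within {0..}) (\<lambda>t. radial_flux h t /\<^sub>R t)"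
    proof (cases "r = 0")
      \<comment> \<open>At the origin the quotient has the value 0, since
        \<open>inverse 0 = 0\<close>, and this is also its limit, because the flux is at most
        \<open>M * t^2\<close> on the unit interval.\<close>
      case True
      have "((\<lambda>t. radial_flux h t /\<^sub>R t) \<longlongrightarrow> 0) (at 0 within {0..})"
      proof (rule Lim_null_comparison)
        show "\<forall>\<^sub>F t in at 0 within {0..}. norm (radial_flux h t /\<^sub>R t) \<le> M * t"
          unfolding eventually_at by (rule exI[of _ 1]) (auto simp del: norm_scaleR intro!: b)
        show "((\<lambda>t. M * t) \<longlongrightarrow> 0) (at 0 within {0..})"
          by (auto intro!: tendsto_eq_intros)
      qed
      then show ?thesis using True by (simp add: continuous_within)
    next
      case False
      then show ?thesis
        using cf \<open>r \<in> {0..}\<close> 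
        by (auto intro!: continuous_intros simp: continuous_on_eq_continuous_within)
    qed
  qed
  show "continuous_on {0..} (radial_potential h)"
    unfolding radial_potential_def[abs_def]
    by (intro continuous_intros continuous_integral_halfline cd)
  show "r > 0 \<Longrightarrow> (radial_potential h has_vector_derivative - (radial_flux h r /\<^sub>R r)) (at r)"
    unfolding radial_potential_def[abs_def]
    by (intro has_vector_derivative_minus has_vector_derivative_integral_halfline cd)
qed

lemma radial_zero [simp]: "radial_flux h 0 = 0" "radial_potential h 0 = 0"
  by (simp_all add: radial_flux_def radial_potential_def)

text \<open>A weight \<open>\<omega>\<close> with \<open>\<omega>' \<ge> 2 t \<kappa> \<omega>\<close> absorbs a source of size \<open>\<kappa> \<omega>\<close>, losing a factor \<open>1/2\<close>.\<close>

lemma radial_bound: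
  fixes z \<Phi> h :: "real \<Rightarrow> 'a::real_normed_vector"
  assumes r: "0 \<le> r" "r \<le> R"
    and cz: "continuous_on {0..R} z" and cf: "continuous_on {0..R} \<Phi>"
    and z0: "z 0 = 0" and f0: "\<Phi> 0 = 0"
    and df: "\<And>t. 0 < t \<Longrightarrow> t < R \<Longrightarrow> (\<Phi> has_vector_derivative t *\<^sub>R h t) (at t)"
    and dz: "\<And>t. 0 < t \<Longrightarrow> t < R \<Longrightarrow> (z has_vector_derivative - (\<Phi> t /\<^sub>R t)) (at t)"
    and hb: "\<And>t. 0 < t \<Longrightarrow> t < R \<Longrightarrow> norm (h t) \<le> \<mu> t"
    and mono: "\<And>s t. 0 \<le> s \<Longrightarrow> s \<le> t \<Longrightarrow> t \<le> R \<Longrightarrow> \<mu> s \<le> \<mu> t"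
    and c\<Omega>: "continuous_on {0..R} \<Omega>"
    and d\<Omega>: "\<And>t. 0 < t \<Longrightarrow> t < R \<Longrightarrow> (\<Omega> has_real_derivative \<Omega>' t) (at t)"
    and \<Omega>': "\<And>t. 0 < t \<Longrightarrow> t < R \<Longrightarrow> t * \<mu> t \<le> \<Omega>' t"
  shows radial_flux_bound: "norm (\<Phi> r) \<le> r\<^sup>2 * \<mu> r"
    and radial_potential_bound: "norm (z r) \<le> \<Omega> r - \<Omega> 0"
proof -
  have fb: "norm (\<Phi> r) \<le> r\<^sup>2 * \<mu> r" if r: "0 \<le> r" "r \<le> R" for r
  proof (cases "r = 0")
    case False
    then have "0 < r" using r by simp
    have "norm (\<Phi> r - \<Phi> 0) \<le> (r * \<mu> r) * r - (r * \<mu> r) * 0"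
    proof (rule differentiable_bound_general[OF \<open>0 < r\<close>])
      show "continuous_on {0..r} \<Phi>" using cf r by (auto intro: continuous_on_subset)
      show "continuous_on {0..r} (\<lambda>x. r * \<mu> r * x)" by (intro continuous_intros)
      fix t assume t: "0 < t" "t < r"
      show "(\<Phi> has_vector_derivative t *\<^sub>R h t) (at t)" using df t r by simp
      show "((\<lambda>x. r * \<mu> r * x) has_vector_derivative r * \<mu> r) (at t)"
        by (auto intro!: derivative_eq_intros simp: has_real_derivative_iff_has_vector_derivative[symmetric])
      have "norm (h t) \<le> \<mu> r" using hb[of t] mono[of t r] t r by simp
      then show "norm (t *\<^sub>R h t) \<le> r * \<mu> r" using t by (auto intro!: mult_mono)
    qed
    then show ?thesis by (simp add: f0 power2_eq_square mult.assoc mult.left_commute mult.commute)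
  qed (use f0 in auto)
  show "norm (\<Phi> r) \<le> r\<^sup>2 * \<mu> r" using fb r by blast
  show "norm (z r) \<le> \<Omega> r - \<Omega> 0"
  proof (cases "r = 0")
    case False
    then have "0 < r" using r by simp
    have "norm (z r - z 0) \<le> \<Omega> r - \<Omega> 0"
    proof (rule differentiable_bound_general[OF \<open>0 < r\<close>])
      show "continuous_on {0..r} z" using cz r by (auto intro: continuous_on_subset)
      show "continuous_on {0..r} \<Omega>" using c\<Omega> r by (auto intro: continuous_on_subset)
      fix t assume t: "0 < t" "t < r"
      show "(z has_vector_derivative - (\<Phi> t /\<^sub>R t)) (at t)" using dz t r by simp
      show "(\<Omega> has_vector_derivative \<Omega>' t) (at t)" using d\<Omega>[of t] t r
        by (simp add: has_real_derivative_iff_has_vector_derivative)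
      have "norm (\<Phi> t) / t \<le> t * \<mu> t" using fb[of t] t r by (simp add: field_simps power2_eq_square)
      then show "norm (- (\<Phi> t /\<^sub>R t)) \<le> \<Omega>' t" using \<Omega>'[of t] t r by (simp add: divide_inverse mult.commute)
    qed
    then show ?thesis using z0 by simp
  qed (use z0 in auto)
qed

lemma nondecreasing_by_deriv:
  fixes f :: "real \<Rightarrow> real"
  assumes "a \<le> b" "continuous_on {a..b} f"
    and "\<And>t. a < t \<Longrightarrow> t < b \<Longrightarrow> (f has_real_derivative f' t) (at t)"
    and "\<And>t. a < t \<Longrightarrow> t < b \<Longrightarrow> 0 \<le> f' t"
  shows "f a \<le> f b"
proof (rule DERIV_nonneg_imp_increasing_open[OF assms(1)])
  show "\<exists>y. (f has_real_derivative y) (at x) \<and> 0 \<le> y" if "a < x" "x < b" for x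
    using assms(3,4) that by blast
qed (use assms in auto)

text \<open>Picard iteration for \<open>z / \<omega>\<close> in the space of bounded continuous
  functions. The weight grows fast enough with \<open>\<kappa>\<close> for the map to contract by
  1/2 on the whole half-line at once, so no local solutions have to be continued.\<close>

lemma radial_existence:
  fixes g :: "real \<Rightarrow> 'a::banach \<Rightarrow> 'a"
  assumes cg: "\<And>z. continuous_on {0..} z \<Longrightarrow> continuous_on {0..} (\<lambda>t. g t (z t))"
    and ck: "continuous_on {0..} \<kappa>"
    and mono: "\<And>s t. 0 \<le> s \<Longrightarrow> s \<le> t \<Longrightarrow> \<kappa> s \<le> \<kappa> t"
    and k0: "\<And>t. 0 \<le> t \<Longrightarrow> 0 \<le> \<kappa> t"
    and lip: "\<And>t z w. 0 \<le> t \<Longrightarrow> norm (g t z - g t w) \<le> \<kappa> t * norm (z - w)"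
    and bd: "\<And>t. 0 \<le> t \<Longrightarrow> norm (g t 0) \<le> \<kappa> t"
  obtains z \<Phi> where "continuous_on {0..} z" "continuous_on {0..} \<Phi>" "z 0 = 0" "\<Phi> 0 = 0"
    "\<And>t. 0 < t \<Longrightarrow> (\<Phi> has_vector_derivative t *\<^sub>R g t (z t)) (at t)"
    "\<And>t. 0 < t \<Longrightarrow> (z has_vector_derivative - (\<Phi> t /\<^sub>R t)) (at t)"
proof -
  \<comment> \<open>The solution of \<open>\<omega>' = 2 t \<kappa> \<omega>\<close> with value 1 at
    the origin: then \<open>t * (\<kappa> t * \<omega> t * D)\<close> is the derivative of
    \<open>\<omega> t * D / 2\<close>, the source of the factor 1/2.\<close>
  define \<omega> where "\<omega> r = exp (integral {0..r} (\<lambda>t. 2 * t * \<kappa> t))" for r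
  have c2: "continuous_on {0..} (\<lambda>t. 2 * t * \<kappa> t)"
    by (intro continuous_intros ck)
  have c\<omega>: "continuous_on {0..} \<omega>"
    unfolding \<omega>_def[abs_def] by (intro continuous_intros continuous_integral_halfline c2)
  have d\<omega>: "(\<omega> has_real_derivative 2 * r * \<kappa> r * \<omega> r) (at r)" if "r > 0" for r
    using has_vector_derivative_integral_halfline[OF c2 that] unfolding \<omega>_def[abs_def]
    by (auto intro!: derivative_eq_intros simp: has_real_derivative_iff_has_vector_derivative[symmetric])
  have \<omega>pos: "0 < \<omega> t" for t by (simp add: \<omega>_def)
  have \<omega>_mono: "\<omega> s \<le> \<omega> t" if "0 \<le> s" "s \<le> t" for s t
    by (rule nondecreasing_by_deriv[OF that(2), where f' = "\<lambda>r. 2 * r * \<kappa> r * \<omega> r"])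
       (use that in \<open>auto intro!: d\<omega> continuous_on_subset[OF c\<omega>] mult_nonneg_nonneg k0 less_imp_le[OF \<omega>pos]\<close>)
  have \<omega>0: "\<omega> 0 = 1" by (simp add: \<omega>_def)
  have \<omega>1: "1 \<le> \<omega> t" if "0 \<le> t" for t using \<omega>_mono[of 0 t] that \<omega>0 by simp
  define h where "h \<phi> t = g t (\<omega> t *\<^sub>R apply_bcontfun \<phi> t)" for \<phi> :: "real \<Rightarrow>\<^sub>C 'a" and t
  have ch: "continuous_on {0..} (h \<phi>)" for \<phi>
    unfolding h_def[abs_def] by (intro cg continuous_intros c\<omega>) auto
  have weighted: "norm (z r) \<le> \<omega> r * D / 2"
    if r: "0 \<le> r" and "D \<ge> 0"
      and z: "continuous_on {0..} z" "continuous_on {0..} \<Phi>" "z 0 = 0" "\<Phi> 0 = 0"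
      "\<And>t. 0 < t \<Longrightarrow> (\<Phi> has_vector_derivative t *\<^sub>R e t) (at t)"
      "\<And>t. 0 < t \<Longrightarrow> (z has_vector_derivative - (\<Phi> t /\<^sub>R t)) (at t)"
      and b: "\<And>t. 0 < t \<Longrightarrow> norm (e t) \<le> \<kappa> t * \<omega> t * D"
    for r D and z \<Phi> e :: "real \<Rightarrow> 'a"
  proof -
    have "norm (z r) \<le> \<omega> r * D / 2 - \<omega> 0 * D / 2"
    proof (rule radial_potential_bound[where R = r and \<mu> = "\<lambda>t. \<kappa> t * \<omega> t * D"
          and \<Omega>' = "\<lambda>t. t * (\<kappa> t * \<omega> t * D)" and h = e and \<Phi> = \<Phi>])
      show "continuous_on {0..r} (\<lambda>r. \<omega> r * D / 2)"
        by (intro continuous_intros continuous_on_subset[OF c\<omega>]) auto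
      show "((\<lambda>r. \<omega> r * D / 2) has_real_derivative t * (\<kappa> t * \<omega> t * D)) (at t)" if "0 < t" for t
        using d\<omega>[OF that] by (auto intro!: derivative_eq_intros)
      show "\<kappa> s * \<omega> s * D \<le> \<kappa> t * \<omega> t * D" if "0 \<le> s" "s \<le> t" for s t
        using that \<open>D \<ge> 0\<close> \<omega>_mono[OF that] mono[OF that] k0[of t] \<omega>pos[of s]
        by (intro mult_mono mult_nonneg_nonneg) auto
    qed (use r z b in \<open>auto intro: continuous_on_subset\<close>)
    also have "\<dots> \<le> \<omega> r * D / 2" using \<open>D \<ge> 0\<close> \<omega>0 by simp
    finally show ?thesis .
  qed
  \<comment> \<open>Bounded continuous functions live on the whole real line here, so
    \<open>max 0 r\<close> extends the image to negative arguments by its value at the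
    origin.\<close>
  define T where "T \<phi> r = radial_potential (h \<phi>) (max 0 r) /\<^sub>R \<omega> (max 0 r)" for \<phi> r
  have Tb: "T \<phi> \<in> bcontfun" for \<phi>
  proof -
    obtain B where B: "\<And>t. norm (apply_bcontfun \<phi> t) \<le> B"
      using bounded_apply_bcontfun[of \<phi>] by (auto simp: bounded_iff)
    have B0: "B \<ge> 0" using order_trans[OF norm_ge_zero B[of 0]] .
    have pot: "norm (radial_potential (h \<phi>) r) \<le> \<omega> r * (B + 1) / 2" if "r \<ge> 0" for r
    proof (rule weighted[OF that, where \<Phi> = "radial_flux (h \<phi>)" and e = "h \<phi>"])
      fix t :: real assume "t > 0"
      have "norm (h \<phi> t) \<le> norm (h \<phi> t - g t 0) + norm (g t 0)"
        using norm_triangle_sub by (simp add: add.commute)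
      also have "\<dots> \<le> \<kappa> t * norm (\<omega> t *\<^sub>R apply_bcontfun \<phi> t) + \<kappa> t"
        using lip[of t "\<omega> t *\<^sub>R apply_bcontfun \<phi> t" 0] bd[of t] \<open>t > 0\<close> by (simp add: h_def)
      also have "\<dots> \<le> \<kappa> t * (\<omega> t * B) + \<kappa> t * \<omega> t"
      proof (intro add_mono mult_left_mono)
        show "norm (\<omega> t *\<^sub>R apply_bcontfun \<phi> t) \<le> \<omega> t * B"
          using B[of t] \<omega>pos[of t] by simp
        show "\<kappa> t \<le> \<kappa> t * \<omega> t"
          using k0[of t] \<omega>1[of t] \<open>t > 0\<close> by (simp add: mult_le_cancel_left1)
      qed (use k0 \<open>t > 0\<close> in auto)
      finally show "norm (h \<phi> t) \<le> \<kappa> t * \<omega> t * (B + 1)" by (simp add: algebra_simps)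
    qed (use B0 in \<open>auto intro!: continuous_radial_potential continuous_radial_flux ch
           radial_flux_deriv radial_potential_deriv\<close>)
    have "norm (T \<phi> r) \<le> (B + 1) / 2" for r
      using pot[of "max 0 r"] \<omega>pos[of "max 0 r"] by (simp add: T_def field_simps)
    then have "bounded (range (T \<phi>))" by (intro boundedI[where B = "(B + 1) / 2"]) auto
    moreover have "continuous_on UNIV (T \<phi>)"
    proof -
      have "continuous_on {0..} (\<lambda>r. radial_potential (h \<phi>) r /\<^sub>R \<omega> r)"
        using \<omega>pos by (intro continuous_intros continuous_radial_potential ch c\<omega>) (simp add: less_imp_neq[symmetric])
      moreover have "continuous_on UNIV (\<lambda>r::real. max 0 r)" by (intro continuous_intros)
      ultimately show ?thesis
        unfolding T_def[abs_def] by (rule continuous_on_compose2) auto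
    qed
    ultimately show ?thesis by (simp add: bcontfun_def)
  qed
  define TT where "TT \<phi> = Bcontfun (T \<phi>)" for \<phi>
  have TT: "apply_bcontfun (TT \<phi>) = T \<phi>" for \<phi>
    by (simp add: TT_def Bcontfun_inverse Tb)
  have "\<exists>!\<phi>. TT \<phi> = \<phi>"
  proof (rule banach_fix_type[of "1/2"], simp, simp, intro allI)
    fix \<phi> \<psi> :: "real \<Rightarrow>\<^sub>C 'a"
    define D where "D = dist \<phi> \<psi>"
    have pot: "norm (radial_potential (h \<phi>) r - radial_potential (h \<psi>) r) \<le> \<omega> r * D / 2"
      if "r \<ge> 0" for r
    proof (rule weighted[OF that, where \<Phi> = "\<lambda>r. radial_flux (h \<phi>) r - radial_flux (h \<psi>) r"
          and e = "\<lambda>r. h \<phi> r - h \<psi> r" and z = "\<lambda>r. radial_potential (h \<phi>) r - radial_potential (h \<psi>) r"])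
      fix t :: real assume t: "t > 0"
      have "norm (h \<phi> t - h \<psi> t) \<le> \<kappa> t * norm (\<omega> t *\<^sub>R (apply_bcontfun \<phi> t - apply_bcontfun \<psi> t))"
        using lip[of t] t by (simp add: h_def scaleR_diff_right)
      also have "\<dots> \<le> \<kappa> t * (\<omega> t * D)"
        using dist_bounded[of \<phi> t \<psi>] \<omega>pos[of t] k0[of t] t
        by (intro mult_left_mono) (auto simp: D_def dist_norm)
      finally show "norm (h \<phi> t - h \<psi> t) \<le> \<kappa> t * \<omega> t * D" by (simp add: mult.assoc)
      show "((\<lambda>r. radial_flux (h \<phi>) r - radial_flux (h \<psi>) r) has_vector_derivative
             t *\<^sub>R (h \<phi> t - h \<psi> t)) (at t)"
        using has_vector_derivative_diff[OF radial_flux_deriv[OF ch t] radial_flux_deriv[OF ch t]]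
        by (simp add: scaleR_diff_right)
      show "((\<lambda>r. radial_potential (h \<phi>) r - radial_potential (h \<psi>) r) has_vector_derivative
             - ((radial_flux (h \<phi>) t - radial_flux (h \<psi>) t) /\<^sub>R t)) (at t)"
        using has_vector_derivative_diff[OF radial_potential_deriv[OF ch t] radial_potential_deriv[OF ch t]]
        by (simp add: scaleR_diff_right)
    qed (auto simp: D_def intro!: continuous_intros continuous_radial_potential continuous_radial_flux ch)
    show "dist (TT \<phi>) (TT \<psi>) \<le> 1 / 2 * dist \<phi> \<psi>"
    proof (rule dist_bound)
      fix r
      show "dist (apply_bcontfun (TT \<phi>) r) (apply_bcontfun (TT \<psi>) r) \<le> 1 / 2 * dist \<phi> \<psi>"
      proof -
        let ?r = "max 0 r"
        have "norm (T \<phi> r - T \<psi> r) =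
          norm (radial_potential (h \<phi>) ?r - radial_potential (h \<psi>) ?r) / \<omega> ?r"
          unfolding T_def scaleR_diff_right[symmetric]
          using \<omega>pos[of ?r] by (simp add: divide_inverse mult.commute)
        also have "\<dots> \<le> (\<omega> ?r * D / 2) / \<omega> ?r"
          using pot[of ?r] \<omega>pos[of ?r] by (intro divide_right_mono) (auto intro: less_imp_le)
        also have "\<dots> = D / 2" using \<omega>pos[of ?r] by simp
        finally show ?thesis by (simp add: TT dist_norm D_def)
      qed
    qed
  qed
  then obtain \<phi> where "TT \<phi> = \<phi>" by blast
  then have fixpoint: "T \<phi> r = apply_bcontfun \<phi> r" for r using TT[of \<phi>] by simp
  have h: "h \<phi> t = g t (radial_potential (h \<phi>) t)" if "t \<ge> 0" for t
    using that \<omega>pos[of t] by (simp add: h_def[of \<phi> t] fixpoint[symmetric] T_def)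
  show thesis
    by (rule that[of "radial_potential (h \<phi>)" "radial_flux (h \<phi>)"])
       (auto simp flip: h intro!: continuous_radial_potential continuous_radial_flux ch
         radial_flux_deriv radial_potential_deriv)
qed

text \<open>Gronwall without iterated integrals: weight \<open>norm (z t)\<close> by
  \<open>exp (- l * t)\<close> and apply the potential bound at the point where the weighted norm
  attains its maximum \<open>M\<close>. The rate \<open>l\<close> is large enough to give
  \<open>2 * (L + 1) * M \<le> L * M + \<delta>\<close>, hence
  \<open>M \<le> \<delta>\<close>.\<close>

lemma radial_gronwall:
  fixes z \<Phi> h :: "real \<Rightarrow> 'a::real_normed_vector"
  assumes r: "0 \<le> r" "r \<le> R" and "0 \<le> L" "0 \<le> \<delta>"
    and cz: "continuous_on {0..R} z" and cf: "continuous_on {0..R} \<Phi>"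
    and z0: "z 0 = 0" and f0: "\<Phi> 0 = 0"
    and df: "\<And>t. 0 < t \<Longrightarrow> t < R \<Longrightarrow> (\<Phi> has_vector_derivative t *\<^sub>R h t) (at t)"
    and dz: "\<And>t. 0 < t \<Longrightarrow> t < R \<Longrightarrow> (z has_vector_derivative - (\<Phi> t /\<^sub>R t)) (at t)"
    and hb: "\<And>t. 0 < t \<Longrightarrow> t < R \<Longrightarrow> norm (h t) \<le> L * norm (z t) + \<delta>"
  shows "norm (z r) \<le> \<delta> * exp (2 * R\<^sup>2 * (L + 1))"
    and "norm (\<Phi> r) \<le> \<delta> * (R\<^sup>2 * (L + 1) * exp (2 * R\<^sup>2 * (L + 1)))"
proof -
  have "norm (z r) \<le> \<delta> * exp (2 * R\<^sup>2 * (L + 1)) \<and>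
    norm (\<Phi> r) \<le> \<delta> * (R\<^sup>2 * (L + 1) * exp (2 * R\<^sup>2 * (L + 1)))"
  proof (cases "R = 0")
    case True
    then show ?thesis using r z0 f0 \<open>0 \<le> \<delta>\<close> by simp
  next
    case False
    then have R: "R > 0" using r by simp
    define l where "l = 2 * R * (L + 1)"
    have l: "l > 0" using R \<open>0 \<le> L\<close> by (simp add: l_def)
    have "\<exists>t0\<in>{0..R}. \<forall>t\<in>{0..R}. norm (z t) * exp (- l * t) \<le> norm (z t0) * exp (- l * t0)"
      using R by (intro continuous_attains_sup continuous_intros cz) auto
    then obtain t0 where t0: "t0 \<in> {0..R}"
      and max: "\<And>t. t \<in> {0..R} \<Longrightarrow> norm (z t) * exp (- l * t) \<le> norm (z t0) * exp (- l * t0)"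
      by blast
    define M where "M = norm (z t0) * exp (- l * t0)"
    have M0: "M \<ge> 0" by (simp add: M_def)
    have zM: "norm (z t) \<le> M * exp (l * t)" if "t \<in> {0..R}" for t
      using max[OF that] by (simp add: M_def exp_minus field_simps)
    define c where "c = L * M + \<delta>"
    have c0: "c \<ge> 0" using \<open>0 \<le> L\<close> \<open>0 \<le> \<delta>\<close> M0 by (simp add: c_def)
    have hc: "norm (h t) \<le> c * exp (l * t)" if "0 < t" "t < R" for t
    proof -
      have "norm (h t) \<le> L * (M * exp (l * t)) + \<delta> * exp (l * t)"
        using hb[OF that] zM[of t] that \<open>0 \<le> L\<close> \<open>0 \<le> \<delta>\<close> l
          mult_left_mono[of "norm (z t)" "M * exp (l * t)" L] mult_left_mono[of 1 "exp (l * t)" \<delta>]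
        by simp
      then show ?thesis by (simp add: c_def algebra_simps)
    qed
    have mono: "c * exp (l * s) \<le> c * exp (l * t)" if "s \<le> t" for s t
      using that c0 l by (intro mult_left_mono) auto
    have d\<Omega>: "((\<lambda>t. R * c / l * exp (l * t)) has_real_derivative R * c * exp (l * t)) (at t)" for t
      using l by (auto intro!: derivative_eq_intros)
    have \<Omega>': "t * (c * exp (l * t)) \<le> R * c * exp (l * t)" if "0 < t" "t < R" for t
      using that c0 by (simp add: mult_right_mono mult.assoc)
    note b = radial_potential_bound[OF _ _ cz cf z0 f0 df dz hc mono _ d\<Omega> \<Omega>']
       radial_flux_bound[OF _ _ cz cf z0 f0 df dz hc mono _ d\<Omega> \<Omega>']
    have "norm (z t0) \<le> R * c / l * exp (l * t0) - R * c / l * exp (l * 0)"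
      using t0 l by (intro b) (auto intro!: continuous_intros)
    also have "\<dots> \<le> R * c / l * exp (l * t0)" using R c0 l by simp
    finally have "M \<le> R * c / l" by (simp add: M_def exp_minus field_simps)
    also have "\<dots> = c / (2 * (L + 1))" using R by (simp add: l_def)
    finally have "M * (2 * (L + 1)) \<le> L * M + \<delta>"
      using \<open>0 \<le> L\<close> by (simp add: c_def field_simps)
    then have "M * (L + 1) + M \<le> \<delta>" by (simp add: algebra_simps)
    then have M\<delta>: "M \<le> \<delta>" using M0 \<open>0 \<le> L\<close>
      by (smt (verit) mult_nonneg_nonneg)
    have c\<delta>: "c \<le> (L + 1) * \<delta>" using M\<delta> \<open>0 \<le> L\<close> mult_left_mono[of M \<delta> L]
      by (simp add: c_def algebra_simps)
    have e: "exp (l * r) \<le> exp (2 * R\<^sup>2 * (L + 1))"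
      using mult_left_mono[OF r(2), of l] l by (simp add: l_def power2_eq_square algebra_simps)
    have "norm (z r) \<le> M * exp (l * r)" using zM r by simp
    also have "\<dots> \<le> \<delta> * exp (2 * R\<^sup>2 * (L + 1))"
      using M\<delta> e M0 by (intro mult_mono) auto
    finally have 1: "norm (z r) \<le> \<delta> * exp (2 * R\<^sup>2 * (L + 1))" .
    have "norm (\<Phi> r) \<le> r\<^sup>2 * (c * exp (l * r))"
      using r l by (intro b) (auto intro!: continuous_intros)
    also have "\<dots> \<le> R\<^sup>2 * (((L + 1) * \<delta>) * exp (2 * R\<^sup>2 * (L + 1)))"
      using r c0 c\<delta> e by (intro mult_mono) auto
    finally show ?thesis using 1 by (simp add: algebra_simps)
  qed
  then show "norm (z r) \<le> \<delta> * exp (2 * R\<^sup>2 * (L + 1))"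
    and "norm (\<Phi> r) \<le> \<delta> * (R\<^sup>2 * (L + 1) * exp (2 * R\<^sup>2 * (L + 1)))" by auto
qed

section \<open>The rescaled system\<close>

definition rescaled_solution :: "nat \<Rightarrow> nat \<Rightarrow> real \<Rightarrow> real \<Rightarrow> real \<Rightarrow>
    (real \<Rightarrow> real) \<Rightarrow> (real \<Rightarrow> real) \<Rightarrow> (real \<Rightarrow> real) \<Rightarrow> (real \<Rightarrow> real) \<Rightarrow> bool" where
  "rescaled_solution a b A B C U V P Q \<longleftrightarrow>
     U 0 = 0 \<and> V 0 = 0 \<and> P 0 = 0 \<and> Q 0 = 0 \<and>
     continuous_on {0..} U \<and> continuous_on {0..} V \<and> continuous_on {0..} P \<and> continuous_on {0..} Q \<and>
     (\<forall>r>0. (U has_real_derivative - (P r / r)) (at r)) \<and>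
     (\<forall>r>0. (V has_real_derivative - (Q r / r)) (at r)) \<and>
     (\<forall>r>0. (P has_real_derivative r * (A * r ^ (2 * (a + b)) * exp (U r) * exp (V r) + B * r ^ (2 * b) * exp (V r))) (at r)) \<and>
     (\<forall>r>0. (Q has_real_derivative r * (A * r ^ (2 * (a + b)) * exp (U r) * exp (V r) - C * r ^ (2 * a) * exp (U r))) (at r))"

lemma rescaled_solutionD:
  assumes "rescaled_solution a b A B C U V P Q"
  shows "U 0 = 0" "V 0 = 0" "P 0 = 0" "Q 0 = 0"
    "continuous_on {0..} U" "continuous_on {0..} V" "continuous_on {0..} P" "continuous_on {0..} Q"
    "\<And>r. 0 < r \<Longrightarrow> (U has_real_derivative - (P r / r)) (at r)"
    "\<And>r. 0 < r \<Longrightarrow> (V has_real_derivative - (Q r / r)) (at r)"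
    "\<And>r. 0 < r \<Longrightarrow> (P has_real_derivative r * (A * r ^ (2 * (a + b)) * exp (U r) * exp (V r) + B * r ^ (2 * b) * exp (V r))) (at r)"
    "\<And>r. 0 < r \<Longrightarrow> (Q has_real_derivative r * (A * r ^ (2 * (a + b)) * exp (U r) * exp (V r) - C * r ^ (2 * a) * exp (U r))) (at r)"
  using assms unfolding rescaled_solution_def by blast+

section \<open>A priori bounds and capping\<close>

lemma potential_nonpos:
  fixes U P :: "real \<Rightarrow> real"
  assumes zero: "U 0 = 0" "P 0 = 0" and cont: "continuous_on {0..} U" "continuous_on {0..} P"
    and dU: "\<And>r. 0 < r \<Longrightarrow> (U has_real_derivative - (P r / r)) (at r)"
    and dP: "\<And>r. 0 < r \<Longrightarrow> (P has_real_derivative r * g r) (at r)"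
    and g: "\<And>r. 0 < r \<Longrightarrow> 0 \<le> g r" and r: "0 \<le> r"
  shows "U r \<le> 0"
proof -
  have P: "0 \<le> P s" if "0 \<le> s" for s
  proof -
    have "P 0 \<le> P s"
      by (rule nondecreasing_by_deriv[OF that continuous_on_subset[OF cont(2)] dP]) (auto intro!: mult_nonneg_nonneg g)
    then show ?thesis using zero by simp
  qed
  have "- U 0 \<le> - U r"
    using r
  proof (rule nondecreasing_by_deriv)
    show "continuous_on {0..r} (\<lambda>r. - U r)"
      by (intro continuous_intros continuous_on_subset[OF cont(1)]) auto
    show "((\<lambda>r. - U r) has_real_derivative - (- (P t / t))) (at t)" if "0 < t" for t
      by (intro DERIV_minus dU that)
    show "0 \<le> - (- (P t / t))" if "0 < t" for t
      using P[of t] that by simp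
  qed
  then show ?thesis using zero by simp
qed

text \<open>The sources \<open>g1\<close>, \<open>g2\<close> are left abstract because the bounds
  serve twice: for the capped system, where they show that the caps are inactive, and for the
  original one. Integrating \<open>g2 \<ge> - C r^(2a)\<close> twice bounds \<open>V\<close>; the
  favourable factors from the integrations are dropped.\<close>

lemma a_priori_bounds:
  fixes U V P Q :: "real \<Rightarrow> real"
  assumes "0 \<le> C" and zero: "U 0 = 0" "V 0 = 0" "P 0 = 0" "Q 0 = 0"
    and cont: "continuous_on {0..} U" "continuous_on {0..} V" "continuous_on {0..} P" "continuous_on {0..} Q"
    and dU: "\<And>r. 0 < r \<Longrightarrow> (U has_real_derivative - (P r / r)) (at r)"
    and dV: "\<And>r. 0 < r \<Longrightarrow> (V has_real_derivative - (Q r / r)) (at r)"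
    and dP: "\<And>r. 0 < r \<Longrightarrow> (P has_real_derivative r * g1 r) (at r)"
    and dQ: "\<And>r. 0 < r \<Longrightarrow> (Q has_real_derivative r * g2 r) (at r)"
    and g1: "\<And>r. 0 < r \<Longrightarrow> 0 \<le> g1 r" and g2: "\<And>r. 0 < r \<Longrightarrow> - (C * r ^ (2 * a)) \<le> g2 r"
    and r: "0 \<le> r"
  shows "U r \<le> 0" and "V r \<le> C * r ^ (2 * a + 2)"
proof -
  have Q: "- (C * s ^ (2 * a + 2)) \<le> Q s" if "0 \<le> s" for s
  proof -
    have "Q 0 + C * 0 ^ (2 * a + 2) \<le> Q s + C * s ^ (2 * a + 2)"
    proof (rule nondecreasing_by_deriv[OF that,
          where f' = "\<lambda>t. t * g2 t + C * (real (2 * a + 2) * t ^ (2 * a + 1))"])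
      show "continuous_on {0..s} (\<lambda>t. Q t + C * t ^ (2 * a + 2))"
        by (intro continuous_intros continuous_on_subset[OF cont(4)]) auto
      fix t :: real assume t: "0 < t"
      show "((\<lambda>t. Q t + C * t ^ (2 * a + 2)) has_real_derivative t * g2 t + C * (real (2 * a + 2) * t ^ (2 * a + 1))) (at t)"
        by (rule derivative_eq_intros dQ t refl)+ simp
      have "t * - (C * t ^ (2 * a)) \<le> t * g2 t"
        using g2[OF t] t by (intro mult_left_mono) auto
      moreover have "C * t ^ (2 * a + 1) * 1 \<le> C * t ^ (2 * a + 1) * real (2 * a + 2)"
        using t \<open>0 \<le> C\<close> by (intro mult_left_mono) auto
      ultimately show "0 \<le> t * g2 t + C * (real (2 * a + 2) * t ^ (2 * a + 1))"
        by (simp add: algebra_simps)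
    qed
    then show ?thesis using zero by simp
  qed
  show "U r \<le> 0" by (rule potential_nonpos[OF zero(1,3) cont(1,3) dU dP g1 r])
  have "C * 0 ^ (2 * a + 2) - V 0 \<le> C * r ^ (2 * a + 2) - V r"
  proof (rule nondecreasing_by_deriv[OF r,
        where f' = "\<lambda>t. C * (real (2 * a + 2) * t ^ (2 * a + 1)) + Q t / t"])
    show "continuous_on {0..r} (\<lambda>t. C * t ^ (2 * a + 2) - V t)"
      by (intro continuous_intros continuous_on_subset[OF cont(2)]) auto
    fix t :: real assume t: "0 < t"
    show "((\<lambda>t. C * t ^ (2 * a + 2) - V t) has_real_derivative C * (real (2 * a + 2) * t ^ (2 * a + 1)) + Q t / t) (at t)"
      by (rule derivative_eq_intros dV t refl)+ simp
    have "- (C * t ^ (2 * a + 2)) / t \<le> Q t / t"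
      using Q[of t] t by (intro divide_right_mono) auto
    moreover have "- (C * t ^ (2 * a + 2)) / t = - (C * t ^ (2 * a + 1))" using t by simp
    moreover have "C * t ^ (2 * a + 1) * 1 \<le> C * t ^ (2 * a + 1) * real (2 * a + 2)"
      using t \<open>0 \<le> C\<close> by (intro mult_left_mono) auto
    ultimately show "0 \<le> C * (real (2 * a + 2) * t ^ (2 * a + 1)) + Q t / t"
      by (simp add: algebra_simps)
  qed
  then show "V r \<le> C * r ^ (2 * a + 2)" using zero by simp
qed

text \<open>Capping \<open>U\<close> and \<open>V\<close> at their a priori bounds makes the right-hand side globally Lipschitz
  without changing the solutions.\<close>

definition capped_rhs :: "nat \<Rightarrow> nat \<Rightarrow> real \<Rightarrow> real \<Rightarrow> real \<Rightarrow> real \<Rightarrow> real \<Rightarrow> real \<times> real \<Rightarrow> real \<times> real" where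
  "capped_rhs a b A B C K r z =
     (A * r ^ (2 * (a + b)) * exp (min (fst z) 0) * exp (min (snd z) (K * r ^ (2 * a + 2))) +
        B * r ^ (2 * b) * exp (min (snd z) (K * r ^ (2 * a + 2))),
      A * r ^ (2 * (a + b)) * exp (min (fst z) 0) * exp (min (snd z) (K * r ^ (2 * a + 2))) -
        C * r ^ (2 * a) * exp (min (fst z) 0))"

text \<open>Convexity: the graph of \<open>exp\<close> lies above its tangent at
  \<open>min x k\<close>, whose slope is at most \<open>exp k\<close>.\<close>

lemma exp_min_lipschitz:
  fixes x y k :: real
  shows "\<bar>exp (min x k) - exp (min y k)\<bar> \<le> exp k * \<bar>x - y\<bar>"
proof -
  have *: "exp (min x k) - exp (min y k) \<le> exp k * \<bar>x - y\<bar>" for x y :: real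
  proof -
    have "exp (min y k) = exp (min x k) * exp (min y k - min x k)" by (simp flip: exp_add)
    moreover have "1 + (min y k - min x k) \<le> exp (min y k - min x k)" by (rule exp_ge_add_one_self)
    ultimately have "exp (min x k) * (1 + (min y k - min x k)) \<le> exp (min y k)"
      by (metis exp_ge_zero mult_left_mono)
    then have "exp (min x k) - exp (min y k) \<le> exp (min x k) * (min x k - min y k)"
      by (simp add: algebra_simps)
    also have "\<dots> \<le> exp k * \<bar>x - y\<bar>"
      by (rule order_trans[OF mult_left_mono mult_right_mono]) auto
    finally show ?thesis .
  qed
  show ?thesis using *[of x y] *[of y x] by (simp add: abs_minus_commute abs_le_iff)
qed

lemma abs_fst_le_norm: "\<bar>fst z\<bar> \<le> norm z" and abs_snd_le_norm: "\<bar>snd z\<bar> \<le> norm z"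
  for z :: "real \<times> real"
  using norm_fst_le[of "fst z" "snd z"] norm_snd_le[of "snd z" "fst z"] by simp_all

lemma norm_prod_le_sum: "norm z \<le> \<bar>fst z\<bar> + \<bar>snd z\<bar>" for z :: "real \<times> real"
  using norm_Pair_le[of "fst z" "snd z"] by simp

lemma capped_rhs_lipschitz:
  assumes "0 \<le> A" "0 \<le> B" "0 \<le> C" "0 \<le> K" "0 \<le> r"
  shows "norm (capped_rhs a b A B C K r z - capped_rhs a b A B C K r z')
    \<le> (4 * A * r ^ (2 * (a + b)) + B * r ^ (2 * b) + C * r ^ (2 * a)) * exp (K * r ^ (2 * a + 2)) * norm (z - z')"
proof -
  define E where "E = exp (K * r ^ (2 * a + 2))"
  define d where "d = norm (z - z')"
  define e1 e2 f1 f2 where "e1 = exp (min (fst z) 0)" and "e2 = exp (min (fst z') 0)"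
    and "f1 = exp (min (snd z) (K * r ^ (2 * a + 2)))" and "f2 = exp (min (snd z') (K * r ^ (2 * a + 2)))"
  have E: "1 \<le> E" using assms by (simp add: E_def)
  have d0: "0 \<le> d" by (simp add: d_def)
  have "\<bar>fst z - fst z'\<bar> \<le> d" "\<bar>snd z - snd z'\<bar> \<le> d"
    using abs_fst_le_norm[of "z - z'"] abs_snd_le_norm[of "z - z'"] by (auto simp: d_def)
  then have e: "\<bar>e1 - e2\<bar> \<le> d" and f: "\<bar>f1 - f2\<bar> \<le> E * d"
    unfolding e1_def e2_def f1_def f2_def E_def
    by - (rule order_trans[OF exp_min_lipschitz], simp,
        rule order_trans[OF exp_min_lipschitz mult_left_mono], auto)
  have dE: "d \<le> E * d" using E d0 by (simp add: mult_le_cancel_right1)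
  have e2: "0 \<le> e2" "e2 \<le> 1" by (auto simp: e2_def)
  have f1: "0 \<le> f1" "f1 \<le> E" by (auto simp: f1_def E_def)
  have "\<bar>e1 * f1 - e2 * f2\<bar> = \<bar>(e1 - e2) * f1 + e2 * (f1 - f2)\<bar>" by (simp add: algebra_simps)
  also have "\<dots> \<le> \<bar>e1 - e2\<bar> * f1 + e2 * \<bar>f1 - f2\<bar>"
    using e2 f1 by (intro order_trans[OF abs_triangle_ineq]) (simp add: abs_mult)
  also have "\<dots> \<le> d * E + 1 * (E * d)"
    using e f e2 f1 d0 E by (intro add_mono mult_mono) auto
  finally have ef: "\<bar>e1 * f1 - e2 * f2\<bar> \<le> 2 * (E * d)" by simp
  define \<alpha> \<beta> \<gamma> where "\<alpha> = A * r ^ (2 * (a + b))" and "\<beta> = B * r ^ (2 * b)" and "\<gamma> = C * r ^ (2 * a)"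
  have nn: "0 \<le> \<alpha>" "0 \<le> \<beta>" "0 \<le> \<gamma>" using assms by (auto simp: \<alpha>_def \<beta>_def \<gamma>_def)
  have 1: "\<alpha> * \<bar>e1 * f1 - e2 * f2\<bar> \<le> \<alpha> * (2 * (E * d))" "\<beta> * \<bar>f1 - f2\<bar> \<le> \<beta> * (E * d)"
    "\<gamma> * \<bar>e1 - e2\<bar> \<le> \<gamma> * (E * d)"
    using nn ef f e dE by (auto intro!: mult_left_mono)
  have "norm (capped_rhs a b A B C K r z - capped_rhs a b A B C K r z') \<le>
    \<bar>\<alpha> * (e1 * f1 - e2 * f2) + \<beta> * (f1 - f2)\<bar> + \<bar>\<alpha> * (e1 * f1 - e2 * f2) - \<gamma> * (e1 - e2)\<bar>"
    by (rule order_trans[OF norm_prod_le_sum])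
       (simp add: capped_rhs_def e1_def e2_def f1_def f2_def \<alpha>_def \<beta>_def \<gamma>_def algebra_simps)
  also have "\<dots> \<le> (\<alpha> * \<bar>e1 * f1 - e2 * f2\<bar> + \<beta> * \<bar>f1 - f2\<bar>) + (\<alpha> * \<bar>e1 * f1 - e2 * f2\<bar> + \<gamma> * \<bar>e1 - e2\<bar>)"
    using nn by (intro add_mono order_trans[OF abs_triangle_ineq] order_trans[OF abs_triangle_ineq4])
      (simp_all add: abs_mult)
  also have "\<dots> \<le> (\<alpha> * (2 * (E * d)) + \<beta> * (E * d)) + (\<alpha> * (2 * (E * d)) + \<gamma> * (E * d))"
    by (intro add_mono 1)
  finally show ?thesis by (simp add: E_def d_def \<alpha>_def \<beta>_def \<gamma>_def algebra_simps)
qed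

lemma capped_rhs_parameters:
  assumes "0 \<le> r"
  shows "norm (capped_rhs a b A B C K r z - capped_rhs a b A' B' C' K r z)
    \<le> (\<bar>A - A'\<bar> + \<bar>B - B'\<bar> + \<bar>C - C'\<bar>) *
      ((2 * r ^ (2 * (a + b)) + r ^ (2 * b) + r ^ (2 * a)) * exp (\<bar>K\<bar> * r ^ (2 * a + 2)))"
proof -
  define E where "E = exp (\<bar>K\<bar> * r ^ (2 * a + 2))"
  define e f where "e = exp (min (fst z) 0)" and "f = exp (min (snd z) (K * r ^ (2 * a + 2)))"
  have E: "1 \<le> E" using assms by (simp add: E_def)
  have e: "0 \<le> e" "e \<le> 1" by (auto simp: e_def)
  have "K * r ^ (2 * a + 2) \<le> \<bar>K\<bar> * r ^ (2 * a + 2)" using assms by (intro mult_right_mono) auto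
  then have f: "0 \<le> f" "f \<le> E" by (auto simp: f_def E_def)
  have ef: "0 \<le> e * f" "e * f \<le> E" using e f mult_mono[of e 1 f E] by auto
  define \<alpha> \<beta> \<gamma> where "\<alpha> = r ^ (2 * (a + b))" and "\<beta> = r ^ (2 * b)" and "\<gamma> = r ^ (2 * a)"
  have nn: "0 \<le> \<alpha>" "0 \<le> \<beta>" "0 \<le> \<gamma>" using assms by (auto simp: \<alpha>_def \<beta>_def \<gamma>_def)
  define \<Delta> where "\<Delta> = \<bar>A - A'\<bar> + \<bar>B - B'\<bar> + \<bar>C - C'\<bar>"
  have \<Delta>: "\<bar>A - A'\<bar> \<le> \<Delta>" "\<bar>B - B'\<bar> \<le> \<Delta>" "\<bar>C - C'\<bar> \<le> \<Delta>" "0 \<le> \<Delta>" by (auto simp: \<Delta>_def)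
  have 1: "\<bar>A - A'\<bar> * (\<alpha> * (e * f)) \<le> \<Delta> * (\<alpha> * E)" "\<bar>B - B'\<bar> * (\<beta> * f) \<le> \<Delta> * (\<beta> * E)"
    "\<bar>C - C'\<bar> * (\<gamma> * e) \<le> \<Delta> * (\<gamma> * E)"
    using nn ef f e E \<Delta> by (auto intro!: mult_mono)
  have "norm (capped_rhs a b A B C K r z - capped_rhs a b A' B' C' K r z) \<le>
    \<bar>(A - A') * (\<alpha> * (e * f)) + (B - B') * (\<beta> * f)\<bar> + \<bar>(A - A') * (\<alpha> * (e * f)) - (C - C') * (\<gamma> * e)\<bar>"
    by (rule order_trans[OF norm_prod_le_sum])
       (simp add: capped_rhs_def e_def f_def \<alpha>_def \<beta>_def \<gamma>_def algebra_simps)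
  also have "\<dots> \<le> (\<bar>A - A'\<bar> * (\<alpha> * (e * f)) + \<bar>B - B'\<bar> * (\<beta> * f)) + (\<bar>A - A'\<bar> * (\<alpha> * (e * f)) + \<bar>C - C'\<bar> * (\<gamma> * e))"
    using nn e f by (intro add_mono order_trans[OF abs_triangle_ineq] order_trans[OF abs_triangle_ineq4])
      (simp_all add: abs_mult)
  also have "\<dots> \<le> (\<Delta> * (\<alpha> * E) + \<Delta> * (\<beta> * E)) + (\<Delta> * (\<alpha> * E) + \<Delta> * (\<gamma> * E))"
    by (intro add_mono 1)
  finally show ?thesis by (simp add: E_def \<Delta>_def \<alpha>_def \<beta>_def \<gamma>_def algebra_simps)
qed

lemma rescaled_solution_bounds:
  assumes "0 \<le> A" "0 \<le> B" "0 \<le> C" and sol: "rescaled_solution a b A B C U V P Q" and "0 \<le> r"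
  shows "U r \<le> 0" "V r \<le> C * r ^ (2 * a + 2)"
proof -
  note D = rescaled_solutionD[OF sol]
  have U: "U s \<le> 0" if "0 \<le> s" for s
    by (rule potential_nonpos[OF D(1,3,5,7,9,11) _ that]) (use assms in auto)
  have g2: "- (C * t ^ (2 * a)) \<le> A * t ^ (2 * (a + b)) * exp (U t) * exp (V t) - C * t ^ (2 * a) * exp (U t)"
    if "0 < t" for t
  proof -
    have "C * t ^ (2 * a) * exp (U t) \<le> C * t ^ (2 * a) * 1"
      using that U[of t] assms by (intro mult_left_mono) auto
    moreover have "0 \<le> A * t ^ (2 * (a + b)) * exp (U t) * exp (V t)" using assms that by simp
    ultimately show ?thesis by simp
  qed
  show "U r \<le> 0" using U assms by simp
  show "V r \<le> C * r ^ (2 * a + 2)"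
    by (rule a_priori_bounds(2)[OF \<open>0 \<le> C\<close> D(1-12) _ g2 \<open>0 \<le> r\<close>]) (use assms in auto)
qed

text \<open>The cap may be any \<open>K \<ge> C\<close>, so that two systems with different
  coefficients can be compared under one common cap.\<close>

lemma rescaled_solution_capped:
  assumes "0 \<le> A" "0 \<le> B" "0 \<le> C" "C \<le> K" and sol: "rescaled_solution a b A B C U V P Q" and "0 < r"
  shows "((\<lambda>r. (P r, Q r)) has_vector_derivative r *\<^sub>R capped_rhs a b A B C K r (U r, V r)) (at r)"
    and "((\<lambda>r. (U r, V r)) has_vector_derivative - ((P r, Q r) /\<^sub>R r)) (at r)"
proof -
  have "V r \<le> K * r ^ (2 * a + 2)"
    by (rule order_trans[OF rescaled_solution_bounds(2)[OF assms(1-3) sol] mult_right_mono[OF \<open>C \<le> K\<close>]])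
       (use \<open>0 < r\<close> in auto)
  moreover have "U r \<le> 0" using rescaled_solution_bounds(1)[OF assms(1-3) sol, of r] \<open>0 < r\<close> by simp
  ultimately have rhs: "capped_rhs a b A B C K r (U r, V r) =
    (A * r ^ (2 * (a + b)) * exp (U r) * exp (V r) + B * r ^ (2 * b) * exp (V r),
     A * r ^ (2 * (a + b)) * exp (U r) * exp (V r) - C * r ^ (2 * a) * exp (U r))"
    by (simp add: capped_rhs_def min_def)
  show "((\<lambda>r. (P r, Q r)) has_vector_derivative r *\<^sub>R capped_rhs a b A B C K r (U r, V r)) (at r)"
    unfolding rhs scaleR_Pair using sol \<open>0 < r\<close>
    by (intro has_vector_derivative_Pair)
       (auto simp: rescaled_solution_def has_real_derivative_iff_has_vector_derivative[symmetric])
  have "((\<lambda>r. (U r, V r)) has_vector_derivative (- (P r / r), - (Q r / r))) (at r)"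
    using sol \<open>0 < r\<close>
    by (intro has_vector_derivative_Pair)
       (auto simp: rescaled_solution_def has_real_derivative_iff_has_vector_derivative[symmetric])
  moreover have "(- (P r / r), - (Q r / r)) = - ((P r, Q r) /\<^sub>R r)"
    by (simp add: divide_inverse mult.commute)
  ultimately show "((\<lambda>r. (U r, V r)) has_vector_derivative - ((P r, Q r) /\<^sub>R r)) (at r)" by simp
qed

text \<open>The constant is uniform over all coefficients up to \<open>K\<close> and all radii up to
  \<open>R\<close>. Equal coefficients give uniqueness as a special case.\<close>

definition lipschitz_in_data :: "nat \<Rightarrow> nat \<Rightarrow> real \<Rightarrow> real \<Rightarrow> real \<Rightarrow> bool" where
  "lipschitz_in_data a b K R c \<longleftrightarrow>
    (\<forall>A B C A' B' C' U V P Q U' V' P' Q' r.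
      A \<in> {0..K} \<longrightarrow> B \<in> {0..K} \<longrightarrow> C \<in> {0..K} \<longrightarrow> A' \<in> {0..K} \<longrightarrow> B' \<in> {0..K} \<longrightarrow> C' \<in> {0..K} \<longrightarrow>
      rescaled_solution a b A B C U V P Q \<longrightarrow> rescaled_solution a b A' B' C' U' V' P' Q' \<longrightarrow>
      r \<in> {0..R} \<longrightarrow>
      max (max \<bar>U r - U' r\<bar> \<bar>V r - V' r\<bar>) (max \<bar>P r - P' r\<bar> \<bar>Q r - Q' r\<bar>)
        \<le> c * (\<bar>A - A'\<bar> + \<bar>B - B'\<bar> + \<bar>C - C'\<bar>))"

lemma lipschitz_in_dataD:
  assumes "lipschitz_in_data a b K R c"
    and "A \<in> {0..K}" "B \<in> {0..K}" "C \<in> {0..K}" "A' \<in> {0..K}" "B' \<in> {0..K}" "C' \<in> {0..K}"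
    and "rescaled_solution a b A B C U V P Q" "rescaled_solution a b A' B' C' U' V' P' Q'" "r \<in> {0..R}"
  shows "\<bar>U r - U' r\<bar> \<le> c * (\<bar>A - A'\<bar> + \<bar>B - B'\<bar> + \<bar>C - C'\<bar>)"
    "\<bar>V r - V' r\<bar> \<le> c * (\<bar>A - A'\<bar> + \<bar>B - B'\<bar> + \<bar>C - C'\<bar>)"
    "\<bar>P r - P' r\<bar> \<le> c * (\<bar>A - A'\<bar> + \<bar>B - B'\<bar> + \<bar>C - C'\<bar>)"
    "\<bar>Q r - Q' r\<bar> \<le> c * (\<bar>A - A'\<bar> + \<bar>B - B'\<bar> + \<bar>C - C'\<bar>)"
  using assms(1)[unfolded lipschitz_in_data_def, rule_format, OF assms(2-10)] by simp_all

text \<open>Under the common cap \<open>K\<close> the source of the difference of two solutions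
  obeys a linear inequality: \<open>L\<close> multiplies the difference itself, and
  \<open>m * \<Delta>\<close> is the error from changing the coefficients. The Gronwall estimate
  then bounds potentials and fluxes together.\<close>

lemma lipschitz_dependence:
  fixes a b :: nat
  assumes "0 \<le> K" "0 \<le> R"
  obtains c where "0 \<le> c" "lipschitz_in_data a b K R c"
proof -
  define E where "E = exp (K * R ^ (2 * a + 2))"
  define L where "L = (4 * K * R ^ (2 * (a + b)) + K * R ^ (2 * b) + K * R ^ (2 * a)) * E"
  define m where "m = (2 * R ^ (2 * (a + b)) + R ^ (2 * b) + R ^ (2 * a)) * E"
  have L0: "0 \<le> L" and m0: "0 \<le> m" using assms by (auto simp: L_def m_def E_def)
  define e where "e = exp (2 * R\<^sup>2 * (L + 1))"
  define c where "c = m * max e (R\<^sup>2 * (L + 1) * e)"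
  have c0: "0 \<le> c" using m0 by (auto simp: c_def e_def intro!: mult_nonneg_nonneg max.coboundedI1)
  show thesis
  proof (rule that[OF c0], unfold lipschitz_in_data_def, intro allI impI)
    fix A B C A' B' C' r :: real and U V P Q U' V' P' Q' :: "real \<Rightarrow> real"
    assume par: "A \<in> {0..K}" "B \<in> {0..K}" "C \<in> {0..K}" "A' \<in> {0..K}" "B' \<in> {0..K}" "C' \<in> {0..K}"
      and sol: "rescaled_solution a b A B C U V P Q" "rescaled_solution a b A' B' C' U' V' P' Q'"
      and "r \<in> {0..R}"
    then have r: "0 \<le> r" "r \<le> R" by auto
    define \<Delta> where "\<Delta> = \<bar>A - A'\<bar> + \<bar>B - B'\<bar> + \<bar>C - C'\<bar>"
    have \<Delta>0: "0 \<le> \<Delta>" by (simp add: \<Delta>_def)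
    define z where "z t = (U t, V t) - (U' t, V' t)" for t
    define \<Phi> where "\<Phi> t = (P t, Q t) - (P' t, Q' t)" for t
    define h where "h t = capped_rhs a b A B C K t (U t, V t) - capped_rhs a b A' B' C' K t (U' t, V' t)" for t
    have hb: "norm (h t) \<le> L * norm (z t) + m * \<Delta>" if t: "0 < t" "t < R" for t
    proof -
      have pw: "t ^ n \<le> R ^ n" for n using t by (intro power_mono) auto
      have Et: "exp (K * t ^ (2 * a + 2)) \<le> E"
        unfolding E_def exp_le_cancel_iff by (intro mult_left_mono pw assms)
      have "norm (h t) \<le> norm (capped_rhs a b A B C K t (U t, V t) - capped_rhs a b A B C K t (U' t, V' t)) +
        norm (capped_rhs a b A B C K t (U' t, V' t) - capped_rhs a b A' B' C' K t (U' t, V' t))"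
        unfolding h_def by (rule order_trans[OF _ norm_triangle_ineq]) simp
      also have "\<dots> \<le> (4 * A * t ^ (2 * (a + b)) + B * t ^ (2 * b) + C * t ^ (2 * a)) * exp (K * t ^ (2 * a + 2)) * norm (z t)
        + \<Delta> * ((2 * t ^ (2 * (a + b)) + t ^ (2 * b) + t ^ (2 * a)) * exp (\<bar>K\<bar> * t ^ (2 * a + 2)))"
        unfolding z_def \<Delta>_def using par assms t
        by (intro add_mono capped_rhs_lipschitz capped_rhs_parameters) auto
      also have "\<dots> \<le> L * norm (z t) + \<Delta> * m"
      proof (intro add_mono mult_right_mono mult_left_mono \<Delta>0)
        show "(4 * A * t ^ (2 * (a + b)) + B * t ^ (2 * b) + C * t ^ (2 * a)) * exp (K * t ^ (2 * a + 2)) \<le> L"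
          unfolding L_def using par t assms
          by (intro mult_mono add_mono pw Et) auto
        show "(2 * t ^ (2 * (a + b)) + t ^ (2 * b) + t ^ (2 * a)) * exp (\<bar>K\<bar> * t ^ (2 * a + 2)) \<le> m"
          unfolding m_def using t assms Et
          by (intro mult_mono add_mono pw) auto
      qed simp
      finally show ?thesis by (simp add: mult.commute)
    qed
    have cont: "continuous_on {0..R} z" "continuous_on {0..R} \<Phi>"
      unfolding z_def[abs_def] \<Phi>_def[abs_def] using sol
      by (auto simp: rescaled_solution_def intro!: continuous_intros intro: continuous_on_subset)
    have zero: "z 0 = 0" "\<Phi> 0 = 0" using sol by (auto simp: z_def \<Phi>_def rescaled_solution_def)
    have dz: "(z has_vector_derivative - (\<Phi> t /\<^sub>R t)) (at t)" if "0 < t" for t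
      unfolding z_def[abs_def] \<Phi>_def
      using has_vector_derivative_diff[OF rescaled_solution_capped(2)[where K = K, OF _ _ _ _ sol(1) that]
          rescaled_solution_capped(2)[where K = K, OF _ _ _ _ sol(2) that]] par
      by (simp add: scaleR_diff_right algebra_simps)
    have d\<Phi>: "(\<Phi> has_vector_derivative t *\<^sub>R h t) (at t)" if "0 < t" for t
      unfolding h_def \<Phi>_def[abs_def] scaleR_diff_right using par
      by (intro has_vector_derivative_diff rescaled_solution_capped(1)[OF _ _ _ _ sol(1) that]
          rescaled_solution_capped(1)[OF _ _ _ _ sol(2) that]) auto
    have "norm (z r) \<le> m * \<Delta> * exp (2 * R\<^sup>2 * (L + 1))"
      "norm (\<Phi> r) \<le> m * \<Delta> * (R\<^sup>2 * (L + 1) * exp (2 * R\<^sup>2 * (L + 1)))"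
      using radial_gronwall[OF r L0 mult_nonneg_nonneg[OF m0 \<Delta>0] cont zero d\<Phi> dz hb] by blast+
    moreover have "m * \<Delta> * e \<le> c * \<Delta>" "m * \<Delta> * (R\<^sup>2 * (L + 1) * e) \<le> c * \<Delta>"
      using mult_left_mono[OF max.cobounded1[of e "R\<^sup>2 * (L + 1) * e"], of "m * \<Delta>"]
        mult_left_mono[OF max.cobounded2[of "R\<^sup>2 * (L + 1) * e" e], of "m * \<Delta>"] m0 \<Delta>0
      by (simp_all add: c_def algebra_simps)
    ultimately have "norm (z r) \<le> c * \<Delta>" "norm (\<Phi> r) \<le> c * \<Delta>" unfolding e_def by linarith+
    then show "max (max \<bar>U r - U' r\<bar> \<bar>V r - V' r\<bar>) (max \<bar>P r - P' r\<bar> \<bar>Q r - Q' r\<bar>)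
        \<le> c * (\<bar>A - A'\<bar> + \<bar>B - B'\<bar> + \<bar>C - C'\<bar>)"
      using abs_fst_le_norm[of "z r"] abs_snd_le_norm[of "z r"] abs_fst_le_norm[of "\<Phi> r"] abs_snd_le_norm[of "\<Phi> r"]
      unfolding \<Delta>_def[symmetric] by (auto simp: z_def \<Phi>_def)
  qed
qed

text \<open>The capped problem has a global solution by the fixed point argument. The a priori
  bounds hold for it as well, so the caps never act and the original equations are solved.\<close>

lemma rescaled_solution_exists:
  assumes nn: "0 \<le> A" "0 \<le> B" "0 \<le> C"
  obtains U V P Q where "rescaled_solution a b A B C U V P Q"
proof -
  \<comment> \<open>The Lipschitz constant of the capped right-hand side at radius \<open>r\<close>;
    it also bounds that side at the zero state.\<close>
  define \<kappa> where "\<kappa> r = (4 * A * r ^ (2 * (a + b)) + B * r ^ (2 * b) + C * r ^ (2 * a)) * exp (C * r ^ (2 * a + 2))" for r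
  let ?sol = "\<lambda>z \<Phi>. continuous_on {0..} z \<and> continuous_on {0..} \<Phi> \<and> z 0 = 0 \<and> \<Phi> 0 = 0 \<and>
    (\<forall>t>0. (\<Phi> has_vector_derivative t *\<^sub>R capped_rhs a b A B C C t (z t)) (at t)) \<and>
    (\<forall>t>0. (z has_vector_derivative - (\<Phi> t /\<^sub>R t)) (at t))"
  have "\<exists>z \<Phi>. ?sol z \<Phi>"
  proof (rule radial_existence[of "capped_rhs a b A B C C" \<kappa>])
    show "continuous_on {0..} (\<lambda>t. capped_rhs a b A B C C t (z t))" if "continuous_on {0..} z" for z
      unfolding capped_rhs_def by (intro continuous_intros that)
    show "continuous_on {0..} \<kappa>" unfolding \<kappa>_def[abs_def] by (intro continuous_intros)
    show "\<kappa> s \<le> \<kappa> t" if "0 \<le> s" "s \<le> t" for s t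
      unfolding \<kappa>_def using that nn
      by (intro mult_mono add_mono exp_le_cancel_iff[THEN iffD2] power_mono) auto
    show "0 \<le> \<kappa> t" if "0 \<le> t" for t using that nn by (simp add: \<kappa>_def)
    show "norm (capped_rhs a b A B C C t z - capped_rhs a b A B C C t w) \<le> \<kappa> t * norm (z - w)" if "0 \<le> t" for t z w
      unfolding \<kappa>_def using nn that by (intro capped_rhs_lipschitz) auto
    show "norm (capped_rhs a b A B C C t 0) \<le> \<kappa> t" if t: "0 \<le> t" for t
    proof -
      have "norm (capped_rhs a b A B C C t 0) \<le> 4 * A * t ^ (2 * (a + b)) + B * t ^ (2 * b) + C * t ^ (2 * a)"
        by (rule order_trans[OF norm_prod_le_sum])
           (use nn t in \<open>auto simp: capped_rhs_def min_def abs_if\<close>)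
      also have "\<dots> = (4 * A * t ^ (2 * (a + b)) + B * t ^ (2 * b) + C * t ^ (2 * a)) * 1" by simp
      also have "\<dots> \<le> \<kappa> t"
        unfolding \<kappa>_def by (rule mult_left_mono) (use nn t in auto)
      finally show ?thesis .
    qed
    show "\<exists>z \<Phi>. ?sol z \<Phi>" if "continuous_on {0..} z" "continuous_on {0..} \<Phi>" "z 0 = 0" "\<Phi> 0 = 0"
      "\<And>t. 0 < t \<Longrightarrow> (\<Phi> has_vector_derivative t *\<^sub>R capped_rhs a b A B C C t (z t)) (at t)"
      "\<And>t. 0 < t \<Longrightarrow> (z has_vector_derivative - (\<Phi> t /\<^sub>R t)) (at t)" for z \<Phi>
      by (intro exI[of _ z] exI[of _ \<Phi>]) (use that in simp)
  qed
  then obtain z \<Phi> where sol: "?sol z \<Phi>" by (elim exE)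
  have z: "continuous_on {0..} z" "continuous_on {0..} \<Phi>" "z 0 = 0" "\<Phi> 0 = 0"
    using sol by simp_all
  have d\<Phi>: "(\<Phi> has_vector_derivative t *\<^sub>R capped_rhs a b A B C C t (z t)) (at t)"
    and dz: "(z has_vector_derivative - (\<Phi> t /\<^sub>R t)) (at t)" if "0 < t" for t
    using sol that by simp_all
  define U V P Q where "U t = fst (z t)" and "V t = snd (z t)" and "P t = fst (\<Phi> t)" and "Q t = snd (\<Phi> t)" for t
  have cont: "continuous_on {0..} U" "continuous_on {0..} V" "continuous_on {0..} P" "continuous_on {0..} Q"
    unfolding U_def[abs_def] V_def[abs_def] P_def[abs_def] Q_def[abs_def] by (intro continuous_intros z)+
  have zero: "U 0 = 0" "V 0 = 0" "P 0 = 0" "Q 0 = 0" using z by (auto simp: U_def V_def P_def Q_def)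
  have dd: "((\<lambda>t. fst (f t)) has_real_derivative fst f') (at t)" "((\<lambda>t. snd (f t)) has_real_derivative snd f') (at t)"
    if "(f has_vector_derivative f') (at t)" for f :: "real \<Rightarrow> real \<times> real" and f' t
    using bounded_linear.has_vector_derivative[OF bounded_linear_fst that]
      bounded_linear.has_vector_derivative[OF bounded_linear_snd that]
    by (auto simp: has_real_derivative_iff_has_vector_derivative)
  have dU: "(U has_real_derivative - (P r / r)) (at r)" and dV: "(V has_real_derivative - (Q r / r)) (at r)" if "0 < r" for r
    using dd[OF dz[OF that]] unfolding U_def[abs_def] V_def[abs_def] P_def Q_def
    by (auto simp: divide_inverse mult.commute)
  define g1 where "g1 t = fst (capped_rhs a b A B C C t (z t))" for t
  define g2 where "g2 t = snd (capped_rhs a b A B C C t (z t))" for t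
  have dP: "(P has_real_derivative r * g1 r) (at r)" and dQ: "(Q has_real_derivative r * g2 r) (at r)" if "0 < r" for r
    using dd[OF d\<Phi>[OF that]] unfolding P_def[abs_def] Q_def[abs_def] g1_def g2_def by auto
  have g1: "0 \<le> g1 t" if "0 < t" for t
    using that nn by (auto simp: g1_def capped_rhs_def)
  have g2: "- (C * t ^ (2 * a)) \<le> g2 t" if "0 < t" for t
  proof -
    have "C * t ^ (2 * a) * exp (min (fst (z t)) 0) \<le> C * t ^ (2 * a) * 1"
      using that nn by (intro mult_left_mono) auto
    moreover have "0 \<le> A * t ^ (2 * (a + b)) * exp (min (fst (z t)) 0) * exp (min (snd (z t)) (C * t ^ (2 * a + 2)))"
      using that nn by simp
    ultimately show ?thesis by (simp add: g2_def capped_rhs_def)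
  qed
  have UV: "U r \<le> 0" "V r \<le> C * r ^ (2 * a + 2)" if "0 < r" for r
    using a_priori_bounds[OF nn(3) zero cont dU dV dP dQ g1 g2, of r] that by auto
  have gUV: "g1 r = A * r ^ (2 * (a + b)) * exp (U r) * exp (V r) + B * r ^ (2 * b) * exp (V r)"
    "g2 r = A * r ^ (2 * (a + b)) * exp (U r) * exp (V r) - C * r ^ (2 * a) * exp (U r)" if "0 < r" for r
    using UV[OF that] by (simp_all add: g1_def g2_def capped_rhs_def U_def V_def min_def)
  have "rescaled_solution a b A B C U V P Q"
    unfolding rescaled_solution_def using zero cont dU dV dP dQ gUV by simp
  then show thesis by (rule that)
qed

lemma rescaled_solution_unique:
  assumes "0 \<le> A" "0 \<le> B" "0 \<le> C" "0 \<le> r"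
    and sol: "rescaled_solution a b A B C U V P Q" "rescaled_solution a b A B C U' V' P' Q'"
  shows "U r = U' r" "V r = V' r"
proof -
  have "0 \<le> A + B + C" using assms by simp
  then obtain c where "lipschitz_in_data a b (A + B + C) r c"
    using lipschitz_dependence \<open>0 \<le> r\<close> by blast
  from lipschitz_in_dataD(1,2)[OF this _ _ _ _ _ _ sol] show "U r = U' r" "V r = V' r"
    using assms by auto
qed

section \<open>Fluxes and masses along a trajectory\<close>

lemma nondecreasing_on_positives:
  fixes f :: "real \<Rightarrow> real"
  assumes "0 < r" "r \<le> s"
    and "\<And>t. 0 < t \<Longrightarrow> (f has_real_derivative f' t) (at t)"
    and "\<And>t. r \<le> t \<Longrightarrow> 0 \<le> f' t"
  shows "f r \<le> f s"
proof (rule DERIV_nonneg_imp_nondecreasing[OF assms(2)])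
  show "\<exists>y. (f has_real_derivative y) (at t) \<and> 0 \<le> y" if "r \<le> t" "t \<le> s" for t
    using assms(1) assms(3)[of t] assms(4)[of t] that by (intro exI[of _ "f' t"]) auto
qed

lemma increasing_on_positives:
  fixes f :: "real \<Rightarrow> real"
  assumes "0 < r" "r < s"
    and "\<And>t. 0 < t \<Longrightarrow> (f has_real_derivative f' t) (at t)"
    and "\<And>t. 0 < t \<Longrightarrow> 0 < f' t"
  shows "f r < f s"
proof (rule DERIV_pos_imp_increasing[OF assms(2)])
  show "\<exists>y. (f has_real_derivative y) (at t) \<and> 0 < y" if "r \<le> t" "t \<le> s" for t
    using assms(1) assms(3)[of t] assms(4)[of t] that by (intro exI[of _ "f' t"]) auto
qed

section \<open>Monotone limits and logarithmic growth\<close>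

lemma monotone_limit_at_top:
  fixes f :: "real \<Rightarrow> real"
  assumes mono: "\<And>r s. r0 \<le> r \<Longrightarrow> r \<le> s \<Longrightarrow> f r \<le> f s"
    and bdd: "\<And>r. r0 \<le> r \<Longrightarrow> f r \<le> M"
  obtains l where "(f \<longlongrightarrow> l) at_top" "\<And>r. r0 \<le> r \<Longrightarrow> f r \<le> l"
proof -
  define l where "l = Sup (f ` {r0..})"
  have bd: "bdd_above (f ` {r0..})" using bdd by (auto intro!: bdd_aboveI[of _ M])
  have le: "f r \<le> l" if "r0 \<le> r" for r
    unfolding l_def using that by (intro cSup_upper bd) auto
  have "(f \<longlongrightarrow> l) at_top"
  proof (rule increasing_tendsto)
    show "\<forall>\<^sub>F r in at_top. f r \<le> l"
      using le eventually_at_top_linorder by blast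
    fix c assume "c < l"
    then obtain s where "s \<ge> r0" "c < f s"
      unfolding l_def using less_cSup_iff[OF _ bd] by auto
    then have "c < f r" if "s \<le> r" for r using mono[of s r] that by simp
    then show "\<forall>\<^sub>F r in at_top. c < f r"
      using eventually_at_top_linorder by blast
  qed
  then show thesis using that le by blast
qed

text \<open>A rate that stays above \<open>c\<close> makes \<open>y\<close> grow at least like
  \<open>c * ln r\<close>.\<close>

lemma log_integral_unbounded:
  fixes y q :: "real \<Rightarrow> real"
  assumes dy: "\<And>r. 0 < r \<Longrightarrow> (y has_real_derivative q r / r) (at r)"
    and "0 < r0" "0 < c" and q: "\<And>r. r0 \<le> r \<Longrightarrow> c \<le> q r"
    and y: "\<And>r. r0 \<le> r \<Longrightarrow> y r \<le> M"
  shows False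
proof -
  \<comment> \<open>Chosen so that \<open>c * ln (s / r0)\<close> is the distance from
    \<open>y r0\<close> to \<open>M\<close> plus \<open>c\<close>, which carries \<open>y\<close>
    past \<open>M\<close>.\<close>
  define s where "s = r0 * exp (\<bar>M - y r0\<bar> / c + 1)"
  have s: "r0 \<le> s" using assms(2,3) by (simp add: s_def mult_le_cancel_left1)
  have "y r0 - c * ln r0 \<le> y s - c * ln s"
    using \<open>0 < r0\<close> s
  proof (rule nondecreasing_on_positives)
    show "((\<lambda>r. y r - c * ln r) has_real_derivative q t / t - c * (1 / t)) (at t)" if "0 < t" for t
      using that by (auto intro!: derivative_eq_intros dy)
    show "0 \<le> q t / t - c * (1 / t)" if "r0 \<le> t" for t
      using q[OF that] that \<open>0 < r0\<close> by (simp add: divide_right_mono)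
  qed
  moreover have "ln s = ln r0 + (\<bar>M - y r0\<bar> / c + 1)"
    using \<open>0 < r0\<close> by (simp add: s_def ln_mult)
  ultimately have "y r0 + \<bar>M - y r0\<bar> + c \<le> y s"
    using \<open>0 < c\<close> by (simp add: algebra_simps)
  then show False using y[OF s] \<open>0 < c\<close> by linarith
qed

text \<open>A monotone bounded rate has a limit, and a positive limit would make \<open>y\<close>
  diverge. This is how \<open>p\<close> and \<open>q\<close> are shown to vanish at
  infinity.\<close>

lemma log_integrable_decreasing_tendsto_0:
  fixes y q :: "real \<Rightarrow> real"
  assumes dy: "\<And>r. 0 < r \<Longrightarrow> (y has_real_derivative q r / r) (at r)"
    and "0 < r0" and q: "\<And>r. r0 \<le> r \<Longrightarrow> 0 \<le> q r"
    and mono: "\<And>r s. r0 \<le> r \<Longrightarrow> r \<le> s \<Longrightarrow> q s \<le> q r"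
    and y: "\<And>r. r0 \<le> r \<Longrightarrow> y r \<le> M"
  shows "(q \<longlongrightarrow> 0) at_top"
proof -
  obtain l where l: "((\<lambda>r. - q r) \<longlongrightarrow> l) at_top" and le: "\<And>r. r0 \<le> r \<Longrightarrow> - q r \<le> l"
    using monotone_limit_at_top[of r0 "\<lambda>r. - q r" 0] mono q by auto
  have "l \<le> 0"
    by (rule tendsto_upperbound[OF l])
       (use q in \<open>auto simp: eventually_at_top_linorder intro!: exI[of _ r0]\<close>)
  moreover have "\<not> l < 0"
  proof
    assume "l < 0"
    then show False
      using le y by (intro log_integral_unbounded[OF dy \<open>0 < r0\<close>, of "- l" M]) (auto simp: minus_le_iff)
  qed
  ultimately show ?thesis using tendsto_minus[OF l] by simp
qed

text \<open>In the logarithmic time \<open>ln r\<close> the rates of \<open>x\<close> and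
  \<open>y\<close> are \<open>p\<close> and \<open>q\<close>, and \<open>w' = p q / r^3\<close>
  because \<open>e^(U+V)\<close> is the product of the two exponentials. The limits at 0 encode the
  start at the origin; the last one makes a boundary term of the Pohozaev identity vanish.\<close>

locale trajectory =
  fixes a b :: real and p q x y w :: "real \<Rightarrow> real"
  assumes a_pos: "0 < a" and b_pos: "0 < b"
    and p_pos: "0 < r \<Longrightarrow> 0 < p r" and q_pos: "0 < r \<Longrightarrow> 0 < q r"
    and dx: "0 < r \<Longrightarrow> (x has_real_derivative p r / r) (at r)"
    and dy: "0 < r \<Longrightarrow> (y has_real_derivative q r / r) (at r)"
    and dw: "0 < r \<Longrightarrow> (w has_real_derivative p r * q r / r ^ 3) (at r)"
    and dp: "0 < r \<Longrightarrow> (p has_real_derivative p r * (2 * a + 2 - (w r + y r)) / r) (at r)"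
    and dq: "0 < r \<Longrightarrow> (q has_real_derivative q r * (2 * b + 2 - (w r - x r)) / r) (at r)"
    and lim0: "(x \<longlongrightarrow> 0) (at_right 0)" "(y \<longlongrightarrow> 0) (at_right 0)" "(w \<longlongrightarrow> 0) (at_right 0)"
      "(p \<longlongrightarrow> 0) (at_right 0)" "(q \<longlongrightarrow> 0) (at_right 0)"
      "((\<lambda>r. p r * q r / r\<^sup>2) \<longlongrightarrow> 0) (at_right 0)"
begin

lemma mass_rate_pos:
  assumes "0 < t"
  shows "0 < p t / t" "0 < q t / t" "0 < p t * q t / t ^ 3"
  using assms p_pos[OF assms] q_pos[OF assms] by auto

lemma x_mono: "0 < r \<Longrightarrow> r \<le> s \<Longrightarrow> x r \<le> x s"
  by (rule nondecreasing_on_positives[OF _ _ dx]) (auto intro!: less_imp_le mass_rate_pos)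

lemma y_mono: "0 < r \<Longrightarrow> r \<le> s \<Longrightarrow> y r \<le> y s"
  by (rule nondecreasing_on_positives[OF _ _ dy]) (auto intro!: less_imp_le mass_rate_pos)

lemma w_mono: "0 < r \<Longrightarrow> r \<le> s \<Longrightarrow> w r \<le> w s"
  by (rule nondecreasing_on_positives[OF _ _ dw]) (auto intro!: less_imp_le mass_rate_pos)

lemma positive_by_deriv:
  assumes f: "\<And>t. 0 < t \<Longrightarrow> (f has_real_derivative f' t) (at t)"
    and pos: "\<And>t. 0 < t \<Longrightarrow> 0 < f' t" and lim: "(f \<longlongrightarrow> 0) (at_right 0)" and r: "0 < r"
  shows "0 < f r"
proof -
  have inc: "f s < f t" if "0 < s" "s < t" for s t
    using that f pos by (rule increasing_on_positives)
  have "0 \<le> f (r / 2)"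
  proof (rule tendsto_upperbound[OF lim])
    show "\<forall>\<^sub>F t in at_right 0. f t \<le> f (r / 2)"
      unfolding eventually_at_right_field
      using r inc by (auto intro!: exI[of _ "r / 2"] less_imp_le)
  qed simp
  then show ?thesis using inc[of "r / 2" r] r by simp
qed

lemma positive:
  assumes "0 < r"
  shows x_pos: "0 < x r" and y_pos: "0 < y r" and w_pos: "0 < w r"
  using positive_by_deriv[OF dx mass_rate_pos(1) lim0(1) assms]
    positive_by_deriv[OF dy mass_rate_pos(2) lim0(2) assms]
    positive_by_deriv[OF dw mass_rate_pos(3) lim0(3) assms] by blast+

lemma p_nonincreasing:
  assumes "0 < r" "r \<le> s" "\<And>t. r \<le> t \<Longrightarrow> 2 * a + 2 \<le> w t + y t"
  shows "p s \<le> p r"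
proof -
  have "- p r \<le> - p s"
    by (rule nondecreasing_on_positives[OF assms(1,2) DERIV_minus[OF dp]])
       (use assms p_pos in \<open>auto intro!: divide_nonpos_pos mult_nonneg_nonpos less_imp_le[of 0 "p _"]\<close>)
  then show ?thesis by simp
qed

lemma q_nonincreasing:
  assumes "0 < r" "r \<le> s" "\<And>t. r \<le> t \<Longrightarrow> 2 * b + 2 \<le> w t - x t"
  shows "q s \<le> q r"
proof -
  have "- q r \<le> - q s"
    by (rule nondecreasing_on_positives[OF assms(1,2) DERIV_minus[OF dq]])
       (use assms q_pos in \<open>auto intro!: divide_nonpos_pos mult_nonneg_nonpos less_imp_le[of 0 "q _"]\<close>)
  then show ?thesis by simp
qed

text \<open>As \<open>r p' = (2a + 2) r x' - p (w + y)\<close>, the difference of the two sides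
  starts at 0 and increases.\<close>

lemma p_le_x:
  assumes "0 < r"
  shows "p r \<le> (2 * a + 2) * x r"
proof -
  have D: "((\<lambda>r. (2 * a + 2) * x r - p r) has_real_derivative p t * (w t + y t) / t) (at t)" if "0 < t" for t
    using that by (auto intro!: derivative_eq_intros dx dp simp: field_simps)
  have "0 < (2 * a + 2) * x r - p r"
    by (rule positive_by_deriv[OF D _ _ assms])
       (auto intro!: divide_pos_pos mult_pos_pos add_pos_pos p_pos positive tendsto_eq_intros lim0)
  then show ?thesis by simp
qed

text \<open>The argument for \<open>p\<close> and \<open>x\<close>, except that the flux
  \<open>w - x\<close> may be negative; the bound \<open>K\<close> on \<open>x\<close> compensates
  for this.\<close>

lemma q_le_y:
  assumes "0 < r" and K: "\<And>t. 0 < t \<Longrightarrow> x t \<le> K"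
  shows "q r \<le> (2 * b + 2 + K) * y r"
proof -
  have D: "((\<lambda>r. (2 * b + 2 + K) * y r - q r) has_real_derivative q t * (K + w t - x t) / t) (at t)" if "0 < t" for t
    using that by (auto intro!: derivative_eq_intros dy dq simp: field_simps)
  have "0 < K + w t - x t" if "0 < t" for t using w_pos[OF that] K[OF that] by simp
  then have "0 < (2 * b + 2 + K) * y r - q r"
    by (intro positive_by_deriv[OF D _ _ assms(1)])
       (auto intro!: divide_pos_pos mult_pos_pos q_pos tendsto_eq_intros lim0)
  then show ?thesis by simp
qed

text \<open>While the flux exceeds its critical value by \<open>\<eta>\<close>,
  \<open>p / \<eta>\<close> falls at least as fast as \<open>x\<close> rises, so
  \<open>x + p / \<eta>\<close> is nonincreasing: \<open>p r / \<eta>\<close> bounds the mass still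
  to come.\<close>

lemma x_tail:
  assumes "0 < r" "r \<le> s" "0 < \<eta>" "\<And>t. r \<le> t \<Longrightarrow> 2 * a + 2 + \<eta> \<le> w t + y t"
  shows "x s \<le> x r + p r / \<eta>"
proof -
  have D: "((\<lambda>r. - (x r + p r / \<eta>)) has_real_derivative p t / t * ((w t + y t - (2 * a + 2)) / \<eta> - 1)) (at t)"
    if "0 < t" for t
    using that \<open>0 < \<eta>\<close> by (auto intro!: derivative_eq_intros dx dp simp: field_simps)
  have "- (x r + p r / \<eta>) \<le> - (x s + p s / \<eta>)"
  proof (rule nondecreasing_on_positives[OF assms(1,2) D])
    fix t assume "r \<le> t"
    then have "1 \<le> (w t + y t - (2 * a + 2)) / \<eta>" using assms(4)[of t] \<open>0 < \<eta>\<close> by (simp add: field_simps)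
    then show "0 \<le> p t / t * ((w t + y t - (2 * a + 2)) / \<eta> - 1)"
      using p_pos[of t] \<open>r \<le> t\<close> \<open>0 < r\<close> by (auto intro!: mult_nonneg_nonneg)
  qed auto
  moreover have "0 < p s / \<eta>" using p_pos[of s] assms by simp
  ultimately show ?thesis by linarith
qed

lemma y_tail:
  assumes "0 < r" "r \<le> s" "0 < \<theta>" "\<And>t. r \<le> t \<Longrightarrow> 2 * b + 2 + \<theta> \<le> w t - x t"
  shows "y s \<le> y r + q r / \<theta>"
proof -
  have D: "((\<lambda>r. - (y r + q r / \<theta>)) has_real_derivative q t / t * ((w t - x t - (2 * b + 2)) / \<theta> - 1)) (at t)"
    if "0 < t" for t
    using that \<open>0 < \<theta>\<close> by (auto intro!: derivative_eq_intros dy dq simp: field_simps)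
  have "- (y r + q r / \<theta>) \<le> - (y s + q s / \<theta>)"
  proof (rule nondecreasing_on_positives[OF assms(1,2) D])
    fix t assume "r \<le> t"
    then have "1 \<le> (w t - x t - (2 * b + 2)) / \<theta>" using assms(4)[of t] \<open>0 < \<theta>\<close> by (simp add: field_simps)
    then show "0 \<le> q t / t * ((w t - x t - (2 * b + 2)) / \<theta> - 1)"
      using q_pos[of t] \<open>r \<le> t\<close> \<open>0 < r\<close> by (auto intro!: mult_nonneg_nonneg)
  qed auto
  moreover have "0 < q s / \<theta>" using q_pos[of s] assms by simp
  ultimately show ?thesis by linarith
qed

lemma w_tail:
  assumes "0 < r" "r \<le> s" and C: "\<And>t. r \<le> t \<Longrightarrow> p t * q t \<le> C"
  shows "w s \<le> w r + C / (2 * r\<^sup>2)"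
proof -
  have "0 < C" using C[of r] p_pos[OF \<open>0 < r\<close>] q_pos[OF \<open>0 < r\<close>] by (smt (verit) mult_pos_pos)
  have D: "((\<lambda>r. - (w r + C / (2 * r\<^sup>2))) has_real_derivative (C - p t * q t) / t ^ 3) (at t)"
    if "0 < t" for t
    using that by (auto intro!: derivative_eq_intros dw simp: field_simps power2_eq_square power3_eq_cube)
  have "- (w r + C / (2 * r\<^sup>2)) \<le> - (w s + C / (2 * s\<^sup>2))"
    by (rule nondecreasing_on_positives[OF assms(1,2) D]) (use C \<open>0 < r\<close> in auto)
  moreover have "0 < C / (2 * s\<^sup>2)" using \<open>0 < C\<close> assms by simp
  ultimately show ?thesis by linarith
qed

text \<open>Differentiate \<open>F1 * F2\<close>, where \<open>F1 = w + y\<close> and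
  \<open>F2 = w - x\<close>, and replace \<open>p * F1\<close>, \<open>q * F2\<close> and
  \<open>p * q * (F1 + F2)\<close> by means of the equations for \<open>p\<close>, \<open>q\<close>
  and \<open>p * q / r^2\<close>. Everything becomes an exact derivative, and both sides tend to 0
  at the origin.\<close>

lemma pohozaev:
  assumes "0 < r"
  shows "(w r + y r) * (w r - x r) + p r * q r / r\<^sup>2 + q r - p r =
    (2 * a + 2 * b + 2) * w r + (2 * b + 2) * y r - (2 * a + 2) * x r"
proof -
  define H where "H r = (w r + y r) * (w r - x r) + p r * q r / r\<^sup>2 + q r - p r -
    ((2 * a + 2 * b + 2) * w r + (2 * b + 2) * y r - (2 * a + 2) * x r)" for r
  have D: "(H has_real_derivative 0) (at t)" if "0 < t" for t
  proof -
    define P Q R where "P = p t / t" and "Q = q t / t" and "R = p t * q t / t ^ 3"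
    have dxyw: "(x has_real_derivative P) (at t)" "(y has_real_derivative Q) (at t)"
      "(w has_real_derivative R) (at t)"
      unfolding P_def Q_def R_def using that by (auto intro: dx dy dw)
    have dpq: "(p has_real_derivative P * (2 * a + 2 - (w t + y t))) (at t)"
      "(q has_real_derivative Q * (2 * b + 2 - (w t - x t))) (at t)"
      unfolding P_def Q_def using dp[OF that] dq[OF that] by auto
    have "((\<lambda>r. p r * q r / r\<^sup>2) has_real_derivative
      ((P * (2 * a + 2 - (w t + y t)) * q t + Q * (2 * b + 2 - (w t - x t)) * p t) * t\<^sup>2 - p t * q t * (2 * t)) / (t\<^sup>2 * t\<^sup>2)) (at t)"
      using that by (auto intro!: derivative_eq_intros dpq)
    moreover have "((P * (2 * a + 2 - (w t + y t)) * q t + Q * (2 * b + 2 - (w t - x t)) * p t) * t\<^sup>2 - p t * q t * (2 * t)) / (t\<^sup>2 * t\<^sup>2) =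
      R * (2 * a + 2 * b + 2 - (w t + y t) - (w t - x t))"
      using that by (simp add: P_def Q_def R_def divide_simps) (simp add: algebra_simps power2_eq_square power3_eq_cube power4_eq_xxxx)
    ultimately have dpq2: "((\<lambda>r. p r * q r / r\<^sup>2) has_real_derivative
      R * (2 * a + 2 * b + 2 - (w t + y t) - (w t - x t))) (at t)" by simp
    show ?thesis
      unfolding H_def[abs_def]
      by (rule derivative_eq_intros dxyw dpq dpq2 refl)+ (simp add: algebra_simps)
  qed
  have const: "H s = H r" if "0 < s" for s
  proof -
    have "H s' = H t" if "0 < s'" "s' \<le> t" for s' t
    proof -
      have "H s' \<le> H t" by (rule nondecreasing_on_positives[OF that D]) auto
      moreover have "- H s' \<le> - H t" by (rule nondecreasing_on_positives[OF that DERIV_minus[OF D]]) auto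
      ultimately show ?thesis by simp
    qed
    then show ?thesis using that assms by (metis linear)
  qed
  have "(H \<longlongrightarrow> (0 + 0) * (0 - 0) + 0 + 0 - 0 -
    ((2 * a + 2 * b + 2) * 0 + (2 * b + 2) * 0 - (2 * a + 2) * 0)) (at_right 0)"
    unfolding H_def[abs_def] by (intro tendsto_intros lim0)
  then have "(H \<longlongrightarrow> 0) (at_right 0)" by simp
  moreover have "\<forall>\<^sub>F s in at_right 0. H s = H r"
    unfolding eventually_at_right_field using const by (auto intro!: exI[of _ 1])
  ultimately have "((\<lambda>_. H r) \<longlongrightarrow> 0) (at_right (0::real))"
    using tendsto_cong by fast
  then have "H r = 0" by (simp add: tendsto_const_iff)
  then show ?thesis by (simp add: H_def)
qed

text \<open>One principle drives the argument: a flux that stays at or below its critical value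
  keeps \<open>p\<close> or \<open>q\<close> from decreasing, and then \<open>x\<close> or
  \<open>y\<close> grows logarithmically. Strictness comes at once for \<open>w + y\<close>, which
  is increasing, but needs a separate argument for \<open>w - x\<close>, which need not be
  monotone.\<close>

lemma limits:
  assumes F1: "\<And>r. 0 < r \<Longrightarrow> w r + y r \<le> M"
  obtains X Y W where "(x \<longlongrightarrow> X) at_top" "(y \<longlongrightarrow> Y) at_top" "(w \<longlongrightarrow> W) at_top"
    "(p \<longlongrightarrow> 0) at_top" "(q \<longlongrightarrow> 0) at_top"
    "\<And>r. 0 < r \<Longrightarrow> x r < X" "\<And>r. 0 < r \<Longrightarrow> y r < Y" "\<And>r. 0 < r \<Longrightarrow> w r < W"
    "2 * a + 2 < W + Y" "2 * b + 2 < W - X"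
    "(W + Y) * (W - X) = (2 * a + 2 * b + 2) * W + (2 * b + 2) * Y - (2 * a + 2) * X"
    "0 < X" "0 < Y" "0 < W"
proof -
  have yM: "y r \<le> M" and wM: "w r \<le> M" if "0 < r" for r
    using F1[OF that] y_pos[OF that] w_pos[OF that] by auto
  have no_growth: False if "0 < r0" "\<And>r. r0 \<le> r \<Longrightarrow> w r - x r \<le> 2 * b + 2" for r0
  proof (rule log_integral_unbounded[where M = M, OF dy \<open>0 < r0\<close> q_pos[OF \<open>0 < r0\<close>]])
    show "q r0 \<le> q r" if "r0 \<le> r" for r
      using \<open>0 < r0\<close> that dq
      by (rule nondecreasing_on_positives)
         (use \<open>0 < r0\<close> \<open>\<And>r. r0 \<le> r \<Longrightarrow> w r - x r \<le> 2 * b + 2\<close> in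
            \<open>auto intro!: divide_nonneg_pos mult_nonneg_nonneg less_imp_le[OF q_pos]\<close>)
  qed (use yM \<open>0 < r0\<close> in auto)
  \<comment> \<open>Since \<open>w \<le> M\<close>, once \<open>x\<close> has passed
    \<open>M\<close> the flux \<open>w - x\<close> is negative for good, hence below its critical
    value.\<close>
  have "\<exists>K. \<forall>r>0. x r \<le> K"
  proof (rule ccontr)
    assume "\<not> (\<exists>K. \<forall>r>0. x r \<le> K)"
    then obtain r1 where r1: "0 < r1" "M < x r1" by (auto simp: not_le)
    show False
    proof (rule no_growth[OF r1(1)])
      fix r assume "r1 \<le> r"
      then show "w r - x r \<le> 2 * b + 2"
        using x_mono[of r1 r] r1 wM[of r] b_pos by simp
    qed
  qed
  then obtain K where K: "\<And>r. 0 < r \<Longrightarrow> x r \<le> K" by blast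
  have limit: "\<exists>l. (f \<longlongrightarrow> l) at_top \<and> (\<forall>r>0. f r < l)"
    if f: "\<And>r s. 0 < r \<Longrightarrow> r \<le> s \<Longrightarrow> f r \<le> f s" "\<And>r. 0 < r \<Longrightarrow> f r \<le> B"
      "\<And>t. 0 < t \<Longrightarrow> (f has_real_derivative f' t) (at t)" "\<And>t. 0 < t \<Longrightarrow> 0 < f' t" for f f' B
  proof -
    obtain l where l: "(f \<longlongrightarrow> l) at_top" and le: "\<And>r. 1 \<le> r \<Longrightarrow> f r \<le> l"
      using monotone_limit_at_top[of 1 f B] f(1,2) by auto
    have "f r < l" if "0 < r" for r
    proof -
      have "f r < f (r + 1)" using that f(3,4)
        by (intro increasing_on_positives[of r "r + 1" f f']) auto
      then show ?thesis using le[of "r + 1"] that by simp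
    qed
    then show ?thesis using l by blast
  qed
  obtain X where X: "(x \<longlongrightarrow> X) at_top" "\<And>r. 0 < r \<Longrightarrow> x r < X"
    using limit[OF x_mono K dx] p_pos by auto
  obtain Y where Y: "(y \<longlongrightarrow> Y) at_top" "\<And>r. 0 < r \<Longrightarrow> y r < Y"
    using limit[OF y_mono yM dy] q_pos by auto
  obtain W where W: "(w \<longlongrightarrow> W) at_top" "\<And>r. 0 < r \<Longrightarrow> w r < W"
    using limit[OF w_mono wM dw] p_pos q_pos by auto
  have pos: "0 < X" "0 < Y" "0 < W"
    using positive[of 1] X(2)[of 1] Y(2)[of 1] W(2)[of 1] by auto
  have "\<exists>r1>0. 2 * a + 2 < w r1 + y r1"
  proof (rule ccontr)
    assume "\<not> ?thesis"
    then have neg: "w t + y t \<le> 2 * a + 2" if "0 < t" for t using that by (meson not_less)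
    show False
    proof (rule log_integral_unbounded[where M = K, OF dx zero_less_one p_pos])
      show "p 1 \<le> p r" if "1 \<le> r" for r
        using zero_less_one that dp
        by (rule nondecreasing_on_positives)
           (use neg in \<open>auto intro!: divide_nonneg_pos mult_nonneg_nonneg less_imp_le[OF p_pos]\<close>)
    qed (use K in auto)
  qed
  then obtain r1 where r1: "0 < r1" "2 * a + 2 < w r1 + y r1" by blast
  define \<eta> where "\<eta> = w r1 + y r1 - (2 * a + 2)"
  have \<eta>: "0 < \<eta>" using r1 by (simp add: \<eta>_def)
  have F1\<eta>: "2 * a + 2 + \<eta> \<le> w r + y r" if "r1 \<le> r" for r
    using w_mono[OF r1(1) that] y_mono[OF r1(1) that] by (simp add: \<eta>_def)
  have f1: "2 * a + 2 < W + Y" using W(2)[OF r1(1)] Y(2)[OF r1(1)] r1 by simp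
  have F2_lim: "((\<lambda>r. w r - x r) \<longlongrightarrow> W - X) at_top" by (intro tendsto_intros W X)
  have f2_ge: "2 * b + 2 \<le> W - X"
  proof (rule ccontr)
    assume "\<not> ?thesis"
    then have "\<forall>\<^sub>F r in at_top. w r - x r < 2 * b + 2"
      using order_tendstoD(2)[OF F2_lim] by simp
    then obtain r0 where "\<And>r. r0 \<le> r \<Longrightarrow> w r - x r < 2 * b + 2"
      by (auto simp: eventually_at_top_linorder)
    then have "w r - x r \<le> 2 * b + 2" if "max r0 1 \<le> r" for r using that by (simp add: less_imp_le)
    then show False by (intro no_growth[of "max r0 1"]) (simp_all add: less_max_iff_disj)
  qed
  have X_tail: "X \<le> x r + p r / \<eta>" if "r1 \<le> r" for r
  proof (rule tendsto_upperbound[OF X(1)])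
    show "\<forall>\<^sub>F s in at_top. x s \<le> x r + p r / \<eta>"
      using x_tail[of r _ \<eta>] that r1 \<eta> F1\<eta>
      by (auto simp: eventually_at_top_linorder intro!: exI[of _ r])
  qed simp
  \<comment> \<open>If the limit were critical, \<open>w - x\<close> would exceed it by at most \<open>p / \<eta>\<close>, which decays so fast that \<open>q\<close>
    would stay away from 0.\<close>
  have f2_ne: "W - X \<noteq> 2 * b + 2"
  proof
    assume eq: "W - X = 2 * b + 2"
    \<comment> \<open>The derivative of \<open>ln q\<close> is at least
      \<open>- p / (\<eta> * t)\<close>. The second term offsets this loss, since the derivative of
      \<open>- p / \<eta>^2\<close> is at least \<open>p / (\<eta> * t)\<close>; so \<open>G\<close>
      is nondecreasing.\<close>
    define G where "G r = ln (q r) - p r / \<eta>\<^sup>2" for r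
    have D: "(G has_real_derivative (2 * b + 2 - (w t - x t)) / t + p t / t * ((w t + y t - (2 * a + 2)) / \<eta>\<^sup>2)) (at t)"
      if "0 < t" for t
      unfolding G_def[abs_def] using that q_pos[OF that] \<eta>
      by (auto intro!: derivative_eq_intros dp dq simp: field_simps)
    have G: "G r1 \<le> G r" if "r1 \<le> r" for r
    proof (rule nondecreasing_on_positives[OF r1(1) that D])
      fix t assume "r1 \<le> t"
      then have t: "0 < t" using r1 by simp
      have "w t - x t \<le> 2 * b + 2 + p t / \<eta>"
        using W(2)[OF t] X_tail[OF \<open>r1 \<le> t\<close>] eq by simp
      then have "- (p t / \<eta>) / t \<le> (2 * b + 2 - (w t - x t)) / t"
        using t by (intro divide_right_mono) auto
      moreover have "p t / t * (\<eta> / \<eta>\<^sup>2) \<le> p t / t * ((w t + y t - (2 * a + 2)) / \<eta>\<^sup>2)"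
        using t F1\<eta>[OF \<open>r1 \<le> t\<close>] p_pos[OF t] by (intro mult_left_mono divide_right_mono) auto
      moreover have "p t / t * (\<eta> / \<eta>\<^sup>2) = (p t / \<eta>) / t" using \<eta> by (simp add: power2_eq_square)
      ultimately show "0 \<le> (2 * b + 2 - (w t - x t)) / t + p t / t * ((w t + y t - (2 * a + 2)) / \<eta>\<^sup>2)"
        by simp
    qed
    show False
    proof (rule log_integral_unbounded[OF dy r1(1), of "exp (G r1)" M])
      fix r assume "r1 \<le> r"
      then have r: "0 < r" using r1 by simp
      have "G r1 \<le> ln (q r)"
        using G[OF \<open>r1 \<le> r\<close>] p_pos[OF r] \<eta> by (simp add: G_def) (smt (verit) divide_pos_pos zero_less_power)
      then show "exp (G r1) \<le> q r" using q_pos[OF r] ln_ge_iff by blast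
    qed (use yM r1 in auto)
  qed
  then have f2: "2 * b + 2 < W - X" using f2_ge by simp
  have "\<forall>\<^sub>F r in at_top. 2 * b + 2 < w r - x r" using order_tendstoD(1)[OF F2_lim f2] .
  then obtain r2 where r2: "\<And>r. r2 \<le> r \<Longrightarrow> 2 * b + 2 < w r - x r"
    by (auto simp: eventually_at_top_linorder)
  have p_lim: "(p \<longlongrightarrow> 0) at_top"
  proof (rule log_integrable_decreasing_tendsto_0[where M = K, OF dx r1(1)])
    fix r s assume rs: "r1 \<le> r" "r \<le> s"
    have "2 * a + 2 \<le> w t + y t" if "r \<le> t" for t using F1\<eta>[of t] that rs \<eta> by simp
    then show "p s \<le> p r" using rs r1 by (intro p_nonincreasing) auto
  qed (use K r1 in \<open>auto intro!: less_imp_le[OF p_pos]\<close>)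
  have q_lim: "(q \<longlongrightarrow> 0) at_top"
  proof (rule log_integrable_decreasing_tendsto_0[OF dy, of "max r2 1" M])
    fix r s assume rs: "max r2 1 \<le> r" "r \<le> s"
    have "2 * b + 2 \<le> w t - x t" if "r \<le> t" for t using r2[of t] that rs by simp
    then show "q s \<le> q r" using rs by (intro q_nonincreasing) auto
  qed (use yM in \<open>auto intro!: less_imp_le[OF q_pos]\<close>)
  have left: "((\<lambda>r. (w r + y r) * (w r - x r) + p r * q r / r\<^sup>2 + q r - p r) \<longlongrightarrow>
    (W + Y) * (W - X) + 0 + 0 - 0) at_top"
  proof (intro tendsto_intros X Y W p_lim q_lim)
    show "((\<lambda>r. p r * q r / r\<^sup>2) \<longlongrightarrow> 0) at_top"
      by (rule real_tendsto_divide_at_top[of _ "0 * 0"])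
         (intro tendsto_intros p_lim q_lim, rule filterlim_pow_at_top[OF _ filterlim_ident], simp)
  qed
  have right: "((\<lambda>r. (2 * a + 2 * b + 2) * w r + (2 * b + 2) * y r - (2 * a + 2) * x r) \<longlongrightarrow>
    (2 * a + 2 * b + 2) * W + (2 * b + 2) * Y - (2 * a + 2) * X) at_top"
    by (intro tendsto_intros X Y W)
  have eq: "\<forall>\<^sub>F r in at_top. (w r + y r) * (w r - x r) + p r * q r / r\<^sup>2 + q r - p r =
    (2 * a + 2 * b + 2) * w r + (2 * b + 2) * y r - (2 * a + 2) * x r"
    using eventually_gt_at_top[of 0] by eventually_elim (rule pohozaev)
  have "(W + Y) * (W - X) + 0 + 0 - 0 = (2 * a + 2 * b + 2) * W + (2 * b + 2) * Y - (2 * a + 2) * X"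
    by (rule tendsto_unique[OF trivial_limit_at_top_linorder left tendsto_cong[THEN iffD2, OF eq right]])
  then show thesis using that X Y W pos f1 f2 p_lim q_lim by simp
qed

lemma w_bounded_of_pq_bounded:
  assumes "0 < r0" "\<And>t. r0 \<le> t \<Longrightarrow> p t * q t \<le> C" "0 < r"
  shows "w r \<le> w r0 + C / (2 * r0\<^sup>2)"
proof -
  have "w r \<le> w (max r r0)" using assms by (intro w_mono) auto
  also have "\<dots> \<le> w r0 + C / (2 * r0\<^sup>2)" using assms by (intro w_tail) auto
  finally show ?thesis .
qed

text \<open>The tail estimate bounds \<open>y\<close>. For \<open>w\<close> there is a dichotomy:
  either the first flux stays below \<open>2a + 2\<close>, or from some radius on both
  \<open>p\<close> and \<open>q\<close> are nonincreasing, and then \<open>w' = p q / r^3\<close> is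
  integrable.\<close>

lemma bounded_if_F2_limit:
  assumes lim: "((\<lambda>r. w r - x r) \<longlongrightarrow> g) at_top" and g: "2 * b + 2 < g"
  obtains M where "\<And>r. 0 < r \<Longrightarrow> w r + y r \<le> M"
proof -
  define \<theta> where "\<theta> = (g - (2 * b + 2)) / 2"
  have \<theta>: "0 < \<theta>" "2 * b + 2 + \<theta> < g" using g by (auto simp: \<theta>_def field_simps)
  obtain r0 where r0: "\<And>r. r0 \<le> r \<Longrightarrow> 2 * b + 2 + \<theta> < w r - x r"
    using order_tendstoD(1)[OF lim \<theta>(2)] by (auto simp: eventually_at_top_linorder)
  define r1 where "r1 = max r0 1"
  have r1: "0 < r1" "\<And>r. r1 \<le> r \<Longrightarrow> 2 * b + 2 + \<theta> \<le> w r - x r"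
    using r0 by (auto simp: r1_def intro: less_imp_le)
  have y: "y r \<le> y r1 + q r1 / \<theta>" if "0 < r" for r
  proof -
    have "y r \<le> y (max r r1)" using that by (intro y_mono) auto
    also have "\<dots> \<le> y r1 + q r1 / \<theta>" using y_tail[OF r1(1) _ \<theta>(1)] r1 by simp
    finally show ?thesis .
  qed
  show thesis
  proof (cases "\<exists>s>0. 2 * a + 2 \<le> w s + y s")
    case True
    then obtain s where s: "0 < s" "2 * a + 2 \<le> w s + y s" by blast
    define r2 where "r2 = max s r1"
    have r2: "0 < r2" using s by (simp add: r2_def)
    have "p t * q t \<le> p r2 * q r2" if "r2 \<le> t" for t
    proof (rule mult_mono)
      show "p t \<le> p r2"
      proof (rule p_nonincreasing[OF r2 that])
        fix u assume "r2 \<le> u"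
        then show "2 * a + 2 \<le> w u + y u"
          using s w_mono[of s u] y_mono[of s u] by (simp add: r2_def)
      qed
      show "q t \<le> q r2"
      proof (rule q_nonincreasing[OF r2 that])
        fix u assume "r2 \<le> u"
        then show "2 * b + 2 \<le> w u - x u"
          using r1(2)[of u] \<theta> by (simp add: r2_def)
      qed
    qed (use r2 that in \<open>auto intro!: less_imp_le[OF p_pos] less_imp_le[OF q_pos]\<close>)
    then show ?thesis
      using that[of "w r2 + p r2 * q r2 / (2 * r2\<^sup>2) + (y r1 + q r1 / \<theta>)"] y
        w_bounded_of_pq_bounded[OF r2] by (meson add_mono)
  next
    case False
    then show ?thesis using that[of "2 * a + 2"] by (meson less_imp_le not_le)
  qed
qed

text \<open>A dichotomy as for the second flux, but with the product \<open>p * q\<close>, whose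
  logarithmic derivative is \<open>(2a + 2b + 4 - F1 - F2) / r\<close> with
  \<open>F1 = w + y\<close> and \<open>F2 = w - x \<ge> - K\<close>. The level \<open>c\<close> of
  \<open>F1\<close> is the one from which this is nonpositive.\<close>

lemma bounded_if_energy_bounded:
  assumes K: "\<And>r. 0 < r \<Longrightarrow> x r + y r \<le> K"
  obtains M where "\<And>r. 0 < r \<Longrightarrow> w r + y r \<le> M"
proof -
  have xK: "x r \<le> K" and yK: "y r \<le> K" if "0 < r" for r
    using K[OF that] x_pos[OF that] y_pos[OF that] by auto
  define c where "c = 2 * a + 2 * b + 4 + K"
  show thesis
  proof (cases "\<exists>s>0. c \<le> w s + y s")
    case True
    then obtain s where s: "0 < s" "c \<le> w s + y s" by blast
    have D: "((\<lambda>t. - (p t * q t)) has_real_derivative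
      p t * q t * (w t + y t + w t - x t - (2 * a + 2 * b + 4)) / t) (at t)" if "0 < t" for t
      using that by (auto intro!: derivative_eq_intros dp dq simp: field_simps)
    have "p t * q t \<le> p s * q s" if "s \<le> t" for t
    proof -
      have "- (p s * q s) \<le> - (p t * q t)"
      proof (rule nondecreasing_on_positives[OF s(1) that D])
        fix u assume "s \<le> u"
        then have "0 \<le> w u + y u + w u - x u - (2 * a + 2 * b + 4)" "0 < u"
          using s w_mono[OF s(1), of u] y_mono[OF s(1), of u] xK[of u] w_pos[of u] by (auto simp: c_def)
        then show "0 \<le> p u * q u * (w u + y u + w u - x u - (2 * a + 2 * b + 4)) / u"
          by (intro divide_nonneg_pos mult_nonneg_nonneg less_imp_le[OF p_pos] less_imp_le[OF q_pos])
      qed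
      then show ?thesis by simp
    qed
    then show ?thesis
      using that[of "w s + p s * q s / (2 * s\<^sup>2) + K"] yK w_bounded_of_pq_bounded[OF s(1)]
      by (meson add_mono)
  next
    case False
    then show ?thesis using that[of c] by (meson less_imp_le not_le)
  qed
qed

text \<open>Once the two fluxes exceed the critical values by a margin that the remaining mass \<open>p r0 / \<eta>\<close>
  of \<open>x\<close> cannot consume, they do so forever. All quantities in the hypotheses and the tail
  bounds live at the single radius \<open>r0\<close>, so they depend continuously on the initial data.\<close>

lemma trap:
  assumes r0: "0 < r0" and \<eta>: "0 < \<eta>" "2 * a + 2 + \<eta> \<le> w r0 + y r0"
    and \<theta>: "0 < \<theta>" "2 * b + 2 + \<theta> \<le> w r0 - x r0 - p r0 / \<eta>"
    and r: "r0 \<le> r"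
  shows trap_x: "x r \<le> x r0 + p r0 / \<eta>" and trap_y: "y r \<le> y r0 + q r0 / \<theta>"
    and trap_w: "w r \<le> w r0 + p r0 * q r0 / (2 * r0\<^sup>2)"
proof -
  have F1: "2 * a + 2 + \<eta> \<le> w t + y t" if "r0 \<le> t" for t
    using \<eta> w_mono[OF r0 that] y_mono[OF r0 that] by simp
  have x: "x t \<le> x r0 + p r0 / \<eta>" if "r0 \<le> t" for t
    using r0 that \<eta>(1) F1 by (rule x_tail)
  have F2: "2 * b + 2 + \<theta> \<le> w t - x t" if "r0 \<le> t" for t
    using \<theta> w_mono[OF r0 that] x[OF that] by simp
  show "x r \<le> x r0 + p r0 / \<eta>" using x r .
  show "y r \<le> y r0 + q r0 / \<theta>" using r0 r \<theta>(1) F2 by (rule y_tail)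
  show "w r \<le> w r0 + p r0 * q r0 / (2 * r0\<^sup>2)"
  proof (rule w_tail[OF r0 r], rule mult_mono)
    fix t assume t: "r0 \<le> t"
    have "2 * a + 2 \<le> w u + y u" "2 * b + 2 \<le> w u - x u" if "r0 \<le> u" for u
      using F1[OF that] F2[OF that] \<eta> \<theta> by auto
    then show "p t \<le> p r0" "q t \<le> q r0"
      using r0 t by (auto intro: p_nonincreasing q_nonincreasing)
  qed (use r0 in \<open>auto intro!: less_imp_le[OF p_pos] less_imp_le[OF q_pos]\<close>)
qed

end

section \<open>Solutions of the Cauchy problem\<close>

definition mass :: "nat \<Rightarrow> (real \<Rightarrow> real) \<Rightarrow> real \<Rightarrow> real" where
  "mass n f r = integral {0..r} (\<lambda>t. t ^ (2 * n + 1) * exp (f t))"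

lemma
  assumes "continuous_on {0..} f"
  shows continuous_mass: "continuous_on {0..} (mass n f)"
    and mass_deriv: "0 < r \<Longrightarrow> (mass n f has_real_derivative r ^ (2 * n + 1) * exp (f r)) (at r)"
    and mass_integrable: "(\<lambda>t. t ^ (2 * n + 1) * exp (f t)) integrable_on {0..r}"
proof -
  have c: "continuous_on {0..} (\<lambda>t. t ^ (2 * n + 1) * exp (f t))"
    by (intro continuous_intros assms)
  show "continuous_on {0..} (mass n f)"
    unfolding mass_def[abs_def] by (rule continuous_integral_halfline[OF c])
  show "0 < r \<Longrightarrow> (mass n f has_real_derivative r ^ (2 * n + 1) * exp (f r)) (at r)"
    unfolding mass_def[abs_def] has_real_derivative_iff_has_vector_derivative
    by (rule has_vector_derivative_integral_halfline[OF c])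
  show "(\<lambda>t. t ^ (2 * n + 1) * exp (f t)) integrable_on {0..r}"
    by (rule integrable_continuous_interval, rule continuous_on_subset[OF c]) auto
qed

lemma mass_0 [simp]: "mass n f 0 = 0"
  by (simp add: mass_def)

lemma dens1_eq: "dens1 a b U V t = t ^ (2 * (a + b) + 1) * exp (U t + V t) + t ^ (2 * b + 1) * exp (V t)"
  by (simp add: dens1_def exp_add power_add algebra_simps)

lemma dens2_eq: "dens2 a b U V t = t ^ (2 * (a + b) + 1) * exp (U t + V t) - t ^ (2 * a + 1) * exp (U t)"
  by (simp add: dens2_def exp_add power_add algebra_simps)

lemma flux_eq_mass:
  assumes "continuous_on {0..} U" "continuous_on {0..} V"
  shows "F1 a b U V r = mass (a + b) (\<lambda>t. U t + V t) r + mass b V r"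
    and "F2 a b U V r = mass (a + b) (\<lambda>t. U t + V t) r - mass a U r"
proof -
  have "continuous_on {0..} (\<lambda>t. U t + V t)" by (intro continuous_intros assms)
  note int = mass_integrable[OF this] mass_integrable[OF assms(1)] mass_integrable[OF assms(2)]
  have dens: "dens1 a b U V = (\<lambda>t. t ^ (2 * (a + b) + 1) * exp (U t + V t) + t ^ (2 * b + 1) * exp (V t))"
    "dens2 a b U V = (\<lambda>t. t ^ (2 * (a + b) + 1) * exp (U t + V t) - t ^ (2 * a + 1) * exp (U t))"
    by (rule ext, rule dens1_eq) (rule ext, rule dens2_eq)
  show "F1 a b U V r = mass (a + b) (\<lambda>t. U t + V t) r + mass b V r"
    unfolding F1_def mass_def dens by (intro Henstock_Kurzweil_Integration.integral_add int)
  show "F2 a b U V r = mass (a + b) (\<lambda>t. U t + V t) r - mass a U r"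
    unfolding F2_def mass_def dens by (intro Henstock_Kurzweil_Integration.integral_diff int)
qed

section \<open>Excluding a logarithmic singularity at the origin\<close>

lemma flux_le_0:
  fixes f F :: "real \<Rightarrow> real"
  assumes f: "(f \<longlongrightarrow> l) (at_right 0)" and F: "(F \<longlongrightarrow> 0) (at_right 0)"
    and d: "\<And>r. 0 < r \<Longrightarrow> (f has_real_derivative - ((F r + c) / r)) (at r)"
  shows "c \<le> 0"
proof (rule ccontr)
  assume "\<not> c \<le> 0"
  then have c: "0 < c" by simp
  have "\<forall>\<^sub>F r in at_right 0. - (c / 2) < F r" using order_tendstoD(1)[OF F] c by simp
  then obtain r1 where r1: "0 < r1" "\<And>r. 0 < r \<Longrightarrow> r < r1 \<Longrightarrow> - (c / 2) < F r"
    by (auto simp: eventually_at_right_field)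
  define r0 where "r0 = r1 / 2"
  have r0: "0 < r0" "r0 < r1" using r1 by (auto simp: r0_def)
  \<comment> \<open>Near 0 the derivative of \<open>f\<close> is at most
    \<open>- (c / 2) / r\<close>, so \<open>f\<close> would blow up like
    \<open>- (c / 2) * ln s\<close>.\<close>
  have grow: "f r0 + c / 2 * ln r0 - c / 2 * ln s \<le> f s" if s: "0 < s" "s \<le> r0" for s
  proof -
    have D: "((\<lambda>r. - (f r + c / 2 * ln r)) has_real_derivative (F t + c / 2) / t) (at t)" if "0 < t" for t
      using that by (auto intro!: derivative_eq_intros d simp: field_simps)
    have "- (f s + c / 2 * ln s) \<le> - (f r0 + c / 2 * ln r0)"
    proof (rule nondecreasing_by_deriv[OF s(2) _ D])
      show "continuous_on {s..r0} (\<lambda>r. - (f r + c / 2 * ln r))"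
        using s by (intro DERIV_continuous_on[OF has_field_derivative_at_within[OF D]]) auto
      show "0 \<le> (F t + c / 2) / t" if "s < t" "t < r0" for t
        using r1(2)[of t] that s r0 by simp
    qed (use s in auto)
    then show ?thesis by simp
  qed
  have 1: "\<forall>\<^sub>F s in at_right 0. f s < l + 1" using order_tendstoD(2)[OF f] by simp
  have 2: "\<forall>\<^sub>F s in at_right 0. ln s \<le> (f r0 + c / 2 * ln r0 - (l + 1)) / (c / 2)"
    using ln_at_0 by (simp add: filterlim_at_bot)
  have 3: "\<forall>\<^sub>F s in at_right 0. 0 < s \<and> s \<le> r0"
    unfolding eventually_at_right_field using r0 by (intro exI[of _ r0]) auto
  have "\<forall>\<^sub>F s in at_right (0::real). False"
    using 1 2 3
  proof eventually_elim
    case (elim s)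
    then have "c / 2 * ln s \<le> f r0 + c / 2 * ln r0 - (l + 1)" using c by (simp add: field_simps)
    then show False using grow[of s] elim by linarith
  qed
  then show False by (simp add: eventually_False)
qed

lemma flux_eq_0:
  fixes f F :: "real \<Rightarrow> real"
  assumes f: "(f \<longlongrightarrow> l) (at_right 0)" and F: "(F \<longlongrightarrow> 0) (at_right 0)"
    and d: "\<And>r. 0 < r \<Longrightarrow> (f has_real_derivative - ((F r + c) / r)) (at r)"
  shows "c = 0"
proof -
  have "((\<lambda>r. - f r) has_real_derivative - ((- F r + - c) / r)) (at r)" if "0 < r" for r
  proof -
    have "- ((- F r + - c) / r) = - (- ((F r + c) / r))" by (simp add: minus_divide_left)
    then show ?thesis using DERIV_minus[OF d[OF that]] by (simp only:)
  qed
  then have "- c \<le> 0"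
    by (rule flux_le_0[rotated 2]) (use tendsto_minus[OF f] tendsto_minus[OF F] in auto)
  moreover have "c \<le> 0" using f F d by (rule flux_le_0)
  ultimately show ?thesis by simp
qed

lemma continuous_halfline_tendsto_right:
  fixes f :: "real \<Rightarrow> 'a::topological_space"
  assumes "continuous_on {0..} f"
  shows "(f \<longlongrightarrow> f 0) (at_right 0)"
  using assms by (auto simp: continuous_on_def intro: tendsto_within_subset[of f _ 0 "{0..}"])

text \<open>Integration gives \<open>r f'\<close> as minus the integral of \<open>g\<close> only up
  to a constant, and \<open>f'\<close> is not assumed continuous at 0. A nonzero constant would put
  a logarithm into \<open>f\<close>, which is continuous there.\<close>

lemma radial_derivative_eq_flux:
  fixes f f' g :: "real \<Rightarrow> real"
  assumes f: "\<And>r. 0 \<le> r \<Longrightarrow> (f has_real_derivative f' r) (at r within {0..})"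
    and g: "continuous_on {0..} g"
    and d: "\<And>r. 0 < r \<Longrightarrow> ((\<lambda>t. t * f' t) has_real_derivative - g r) (at r)"
    and r: "0 < r"
  shows "(f has_real_derivative - (integral {0..r} g / r)) (at r)"
proof -
  define G where "G r = integral {0..r} g" for r
  have dG: "(G has_real_derivative g r) (at r)" if "0 < r" for r
    using has_vector_derivative_integral_halfline[OF g that]
    by (simp add: G_def[abs_def] has_real_derivative_iff_has_vector_derivative)
  have df: "(f has_real_derivative f' r) (at r)" if "0 < r" for r
    using f[of r] that by (simp add: at_within_interior[of r "{0..}"])
  have cont: "continuous_on {0..} f"
    by (rule DERIV_continuous_on[where D = f']) (use f in auto)
  define D where "D r = - (r * f' r) - G r" for r
  have dD: "(D has_real_derivative 0) (at r)" if "0 < r" for r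
    unfolding D_def[abs_def] by (rule derivative_eq_intros d dG that refl)+ simp
  have "D s \<le> D t" "- D s \<le> - D t" if "0 < s" "s \<le> t" for s t
    using nondecreasing_on_positives[OF that dD] nondecreasing_on_positives[OF that DERIV_minus[OF dD]] by auto
  then have D1: "D s = D 1" if "0 < s" for s
    using that by (cases "s \<le> 1") (auto intro: antisym)
  have f'_eq: "f' s = - ((G s + D 1) / s)" if "0 < s" for s
  proof -
    have "s * f' s = - (G s + D 1)" unfolding D1[OF that, symmetric] by (simp add: D_def)
    then have "f' s = - (G s + D 1) / s" using that by (simp add: nonzero_eq_divide_eq mult.commute)
    then show ?thesis by (simp only: minus_divide_left)
  qed
  have "D 1 = 0"
  proof (rule flux_eq_0)
    show "(f \<longlongrightarrow> f 0) (at_right 0)" by (rule continuous_halfline_tendsto_right[OF cont])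
    show "(G \<longlongrightarrow> 0) (at_right 0)"
      using continuous_halfline_tendsto_right[OF continuous_integral_halfline[OF g]]
      by (simp add: G_def[abs_def])
    show "(f has_real_derivative - ((G r + D 1) / r)) (at r)" if "0 < r" for r
      using df[OF that] f'_eq[OF that] by simp
  qed
  then show ?thesis using df[OF r] f'_eq[OF r] by (simp add: G_def)
qed

lemma dens_shift:
  "dens1 a b U V r = r * (exp (\<alpha>1 + \<alpha>2) * r ^ (2 * (a + b)) * exp (U r - \<alpha>1) * exp (V r - \<alpha>2) +
     exp \<alpha>2 * r ^ (2 * b) * exp (V r - \<alpha>2))"
  "dens2 a b U V r = r * (exp (\<alpha>1 + \<alpha>2) * r ^ (2 * (a + b)) * exp (U r - \<alpha>1) * exp (V r - \<alpha>2) -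
     exp \<alpha>1 * r ^ (2 * a) * exp (U r - \<alpha>1))"
  by (simp_all add: dens1_eq dens2_eq exp_add exp_diff algebra_simps)

lemma cp_solution_continuous:
  assumes "cp_solution a b \<alpha>1 \<alpha>2 U V"
  shows "continuous_on {0..} U" "continuous_on {0..} V"
proof -
  obtain U' V' where "\<forall>r\<ge>0. (U has_real_derivative U' r) (at r within {0..})"
    "\<forall>r\<ge>0. (V has_real_derivative V' r) (at r within {0..})"
    using assms unfolding cp_solution_def by blast
  then show "continuous_on {0..} U" "continuous_on {0..} V"
    by (auto intro!: DERIV_continuous_on)
qed

lemma cp_solution_imp_rescaled:
  assumes "cp_solution a b \<alpha>1 \<alpha>2 U V"
  shows "rescaled_solution a b (exp (\<alpha>1 + \<alpha>2)) (exp \<alpha>2) (exp \<alpha>1)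
    (\<lambda>r. U r - \<alpha>1) (\<lambda>r. V r - \<alpha>2) (F1 a b U V) (F2 a b U V)"
proof -
  obtain U' V' where U: "U 0 = \<alpha>1" "\<And>r. 0 \<le> r \<Longrightarrow> (U has_real_derivative U' r) (at r within {0..})"
      "\<And>r. 0 < r \<Longrightarrow> ((\<lambda>t. t * U' t) has_real_derivative - dens1 a b U V r) (at r)"
    and V: "V 0 = \<alpha>2" "\<And>r. 0 \<le> r \<Longrightarrow> (V has_real_derivative V' r) (at r within {0..})"
      "\<And>r. 0 < r \<Longrightarrow> ((\<lambda>t. t * V' t) has_real_derivative - dens2 a b U V r) (at r)"
    using assms unfolding cp_solution_def by blast
  note c = cp_solution_continuous[OF assms]
  have cd: "continuous_on {0..} (dens1 a b U V)" "continuous_on {0..} (dens2 a b U V)"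
    unfolding dens1_def[abs_def] dens2_def[abs_def] by (intro continuous_intros c)+
  have dF: "(F1 a b U V has_real_derivative dens1 a b U V r) (at r)"
    "(F2 a b U V has_real_derivative dens2 a b U V r) (at r)" if "0 < r" for r
    using has_vector_derivative_integral_halfline[OF cd(1) that] has_vector_derivative_integral_halfline[OF cd(2) that]
    unfolding F1_def[abs_def] F2_def[abs_def] has_real_derivative_iff_has_vector_derivative by auto
  have cF: "continuous_on {0..} (F1 a b U V)" "continuous_on {0..} (F2 a b U V)"
    unfolding F1_def[abs_def] F2_def[abs_def] by (intro continuous_integral_halfline cd)+
  have dUV: "((\<lambda>r. U r - \<alpha>1) has_real_derivative - (F1 a b U V r / r)) (at r)"
    "((\<lambda>r. V r - \<alpha>2) has_real_derivative - (F2 a b U V r / r)) (at r)" if "0 < r" for r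
    using radial_derivative_eq_flux[OF U(2) cd(1) U(3) that] radial_derivative_eq_flux[OF V(2) cd(2) V(3) that]
    unfolding F1_def F2_def by (auto intro!: derivative_eq_intros)
  show ?thesis
    unfolding rescaled_solution_def dens_shift(1)[symmetric] dens_shift(2)[symmetric]
    using U(1) V(1) c cF dF dUV by (auto simp: F1_def F2_def intro!: continuous_intros)
qed

text \<open>A source that is bounded near 0 makes \<open>z\<close> of order \<open>r^2\<close>, so
  the one-sided derivative vanishes.\<close>

lemma radial_flux_derivative_at_0:
  fixes z P g :: "real \<Rightarrow> real"
  assumes cont: "continuous_on {0..} z" "continuous_on {0..} P" "continuous_on {0..} g"
    and zero: "z 0 = 0" "P 0 = 0"
    and dz: "\<And>r. 0 < r \<Longrightarrow> (z has_real_derivative - (P r / r)) (at r)"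
    and dP: "\<And>r. 0 < r \<Longrightarrow> (P has_real_derivative r * g r) (at r)"
  shows "(z has_real_derivative 0) (at 0 within {0..})"
proof -
  have "compact (g ` {0..1})"
    by (intro compact_continuous_image continuous_on_subset[OF cont(3)]) auto
  then obtain M where M: "\<And>t. t \<in> {0..1} \<Longrightarrow> norm (g t) \<le> M"
    by (meson bounded_iff compact_imp_bounded imageI)
  have b: "norm (z r) \<le> M * r\<^sup>2 / 2" if r: "0 \<le> r" "r \<le> 1" for r
  proof -
    have "norm (z r) \<le> M * r\<^sup>2 / 2 - M * 0\<^sup>2 / 2"
    proof (rule radial_potential_bound[OF r, where \<mu> = "\<lambda>_. M" and h = g and \<Phi> = P and \<Omega>' = "\<lambda>t. t * M"])
      show "(P has_vector_derivative t *\<^sub>R g t) (at t)" if "0 < t" for t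
        using dP[OF that] by (simp add: has_real_derivative_iff_has_vector_derivative)
      show "(z has_vector_derivative - (P t /\<^sub>R t)) (at t)" if "0 < t" for t
        using dz[OF that] by (simp add: has_real_derivative_iff_has_vector_derivative divide_inverse mult.commute)
      show "((\<lambda>r. M * r\<^sup>2 / 2) has_real_derivative t * M) (at t)" for t
        by (auto intro!: derivative_eq_intros)
    qed (use zero M in \<open>auto intro!: continuous_intros continuous_on_subset[OF cont(1)] continuous_on_subset[OF cont(2)]\<close>)
    then show ?thesis by simp
  qed
  have "((\<lambda>y. (z y - z 0) / (y - 0)) \<longlongrightarrow> 0) (at 0 within {0..})"
  proof (rule Lim_null_comparison)
    have "norm ((z y - z 0) / (y - 0)) \<le> M * y / 2" if "y \<in> {0..}" "y \<noteq> 0" "dist y 0 < 1" for y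
      using b[of y] that zero by (simp add: field_simps power2_eq_square)
    then show "\<forall>\<^sub>F y in at 0 within {0..}. norm ((z y - z 0) / (y - 0)) \<le> M * y / 2"
      unfolding eventually_at by (intro exI[of _ 1]) auto
    show "((\<lambda>y. M * y / 2) \<longlongrightarrow> 0) (at 0 within {0..})"
      by (auto intro!: tendsto_eq_intros)
  qed
  then show ?thesis by (simp add: has_field_derivative_iff)
qed

lemma rescaled_imp_cp_solution:
  assumes "rescaled_solution a b (exp (\<alpha>1 + \<alpha>2)) (exp \<alpha>2) (exp \<alpha>1) U V P Q"
  shows "cp_solution a b \<alpha>1 \<alpha>2 (\<lambda>r. U r + \<alpha>1) (\<lambda>r. V r + \<alpha>2)"
proof -
  note D = rescaled_solutionD[OF assms]
  have at0: "(U has_real_derivative 0) (at 0 within {0..})" "(V has_real_derivative 0) (at 0 within {0..})"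
    by - (rule radial_flux_derivative_at_0[OF D(5,7) _ D(1,3,9,11)], (intro continuous_intros D(5,6))[],
        assumption, assumption,
        rule radial_flux_derivative_at_0[OF D(6,8) _ D(2,4,10,12)], (intro continuous_intros D(5,6))[],
        assumption, assumption)
  have at_pos: "(U has_real_derivative - (P r / r)) (at r within {0..})"
    "(V has_real_derivative - (Q r / r)) (at r within {0..})" if "0 \<le> r" for r
    using at0 has_field_derivative_at_within[OF D(9)] has_field_derivative_at_within[OF D(10)] that
    by (cases "r = 0"; simp)+
  have within: "((\<lambda>r. U r + \<alpha>1) has_real_derivative - (P r / r)) (at r within {0..})"
    "((\<lambda>r. V r + \<alpha>2) has_real_derivative - (Q r / r)) (at r within {0..})" if "0 \<le> r" for r
    using DERIV_add[OF at_pos(1)[OF that] DERIV_const] DERIV_add[OF at_pos(2)[OF that] DERIV_const] by simp_all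
  have P: "((\<lambda>t. t * - (P t / t)) has_real_derivative - dens1 a b (\<lambda>r. U r + \<alpha>1) (\<lambda>r. V r + \<alpha>2) r) (at r)" if "0 < r" for r
  proof (rule has_field_derivative_transform_within_open[of "\<lambda>t. - P t" _ _ "{0<..}"])
    show "((\<lambda>t. - P t) has_real_derivative - dens1 a b (\<lambda>r. U r + \<alpha>1) (\<lambda>r. V r + \<alpha>2) r) (at r)"
      using DERIV_minus[OF D(11)[OF that]] by (simp add: dens_shift[of _ _ _ _ _ \<alpha>1 \<alpha>2])
  qed (use that in auto)
  have Q: "((\<lambda>t. t * - (Q t / t)) has_real_derivative - dens2 a b (\<lambda>r. U r + \<alpha>1) (\<lambda>r. V r + \<alpha>2) r) (at r)" if "0 < r" for r
  proof (rule has_field_derivative_transform_within_open[of "\<lambda>t. - Q t" _ _ "{0<..}"])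
    show "((\<lambda>t. - Q t) has_real_derivative - dens2 a b (\<lambda>r. U r + \<alpha>1) (\<lambda>r. V r + \<alpha>2) r) (at r)"
      using DERIV_minus[OF D(12)[OF that]] by (simp add: dens_shift[of _ _ _ _ _ \<alpha>1 \<alpha>2])
  qed (use that in auto)
  show ?thesis
    unfolding cp_solution_def
    by (intro conjI exI[of _ "\<lambda>r. - (P r / r)"] exI[of _ "\<lambda>r. - (Q r / r)"])
       (use D(1,2) within P Q in auto)
qed

text \<open>Existence and uniqueness are transferred from the rescaled system: every Cauchy solution
  with the same data becomes, after subtraction of the data, a rescaled solution with the same
  coefficients.\<close>

lemma unique_cp_solution_exists:
  obtains U V where "unique_cp_solution a b \<alpha>1 \<alpha>2 U V"
proof -
  obtain U V P Q where "rescaled_solution a b (exp (\<alpha>1 + \<alpha>2)) (exp \<alpha>2) (exp \<alpha>1) U V P Q"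
    using rescaled_solution_exists[OF exp_ge_zero exp_ge_zero exp_ge_zero] by blast
  then have sol: "cp_solution a b \<alpha>1 \<alpha>2 (\<lambda>r. U r + \<alpha>1) (\<lambda>r. V r + \<alpha>2)" (is "cp_solution _ _ _ _ ?U ?V")
    by (rule rescaled_imp_cp_solution)
  have "S r = ?U r \<and> T r = ?V r" if S: "cp_solution a b \<alpha>1 \<alpha>2 S T" and r: "0 \<le> r" for S T r
    using rescaled_solution_unique[OF exp_ge_zero exp_ge_zero exp_ge_zero r
        cp_solution_imp_rescaled[OF S] cp_solution_imp_rescaled[OF sol]] by simp
  then have "unique_cp_solution a b \<alpha>1 \<alpha>2 ?U ?V"
    using sol by (auto simp: unique_cp_solution_def)
  then show thesis by (rule that)
qed

lemma cp_solution_trajectory: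
  assumes "0 < a" "0 < b" and sol: "cp_solution a b \<alpha>1 \<alpha>2 U V"
  shows "trajectory (real a) (real b) (\<lambda>r. r ^ (2 * a + 2) * exp (U r)) (\<lambda>r. r ^ (2 * b + 2) * exp (V r))
    (mass a U) (mass b V) (mass (a + b) (\<lambda>t. U t + V t))"
proof -
  note c = cp_solution_continuous[OF sol]
  have cUV: "continuous_on {0..} (\<lambda>t. U t + V t)" by (intro continuous_intros c)
  note D = rescaled_solutionD[OF cp_solution_imp_rescaled[OF sol]]
  have dU: "(U has_real_derivative - (F1 a b U V r / r)) (at r)"
    and dV: "(V has_real_derivative - (F2 a b U V r / r)) (at r)" if "0 < r" for r
    using DERIV_add[OF D(9)[OF that] DERIV_const[of \<alpha>1]] DERIV_add[OF D(10)[OF that] DERIV_const[of \<alpha>2]] by auto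
  have lim: "((\<lambda>r. r ^ Suc n * exp (f r)) \<longlongrightarrow> 0) (at_right 0)" if "continuous_on {0..} f" for n and f :: "real \<Rightarrow> real"
  proof -
    have "continuous_on {0..} (\<lambda>r. r ^ Suc n * exp (f r))" by (intro continuous_intros that)
    from continuous_halfline_tendsto_right[OF this] show ?thesis by simp
  qed
  show ?thesis
  proof
    show "(mass a U has_real_derivative r ^ (2 * a + 2) * exp (U r) / r) (at r)" if "0 < r" for r
      using mass_deriv[OF c(1) that, of a] that by (simp add: mult.assoc)
    show "(mass b V has_real_derivative r ^ (2 * b + 2) * exp (V r) / r) (at r)" if "0 < r" for r
      using mass_deriv[OF c(2) that, of b] that by (simp add: mult.assoc)
    show "(mass (a + b) (\<lambda>t. U t + V t) has_real_derivative
        r ^ (2 * a + 2) * exp (U r) * (r ^ (2 * b + 2) * exp (V r)) / r ^ 3) (at r)" if "0 < r" for r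
      using mass_deriv[OF cUV that, of "a + b"] that
      by (simp add: exp_add power_add power3_eq_cube power2_eq_square field_simps)
    show "((\<lambda>r. r ^ (2 * a + 2) * exp (U r)) has_real_derivative r ^ (2 * a + 2) * exp (U r) *
        (2 * real a + 2 - (mass (a + b) (\<lambda>t. U t + V t) r + mass b V r)) / r) (at r)" if "0 < r" for r
      by (rule derivative_eq_intros dU[OF that] refl)+
         (use that in \<open>simp add: flux_eq_mass[OF c] field_simps\<close>)
    show "((\<lambda>r. r ^ (2 * b + 2) * exp (V r)) has_real_derivative r ^ (2 * b + 2) * exp (V r) *
        (2 * real b + 2 - (mass (a + b) (\<lambda>t. U t + V t) r - mass a U r)) / r) (at r)" if "0 < r" for r
      by (rule derivative_eq_intros dV[OF that] refl)+
         (use that in \<open>simp add: flux_eq_mass[OF c] field_simps\<close>)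
    show "(mass a U \<longlongrightarrow> 0) (at_right 0)" "(mass b V \<longlongrightarrow> 0) (at_right 0)"
      "(mass (a + b) (\<lambda>t. U t + V t) \<longlongrightarrow> 0) (at_right 0)"
      using continuous_halfline_tendsto_right[OF continuous_mass[OF c(1)], of a]
        continuous_halfline_tendsto_right[OF continuous_mass[OF c(2)], of b]
        continuous_halfline_tendsto_right[OF continuous_mass[OF cUV], of "a + b"] by simp_all
    show "((\<lambda>r. r ^ (2 * a + 2) * exp (U r)) \<longlongrightarrow> 0) (at_right 0)"
      "((\<lambda>r. r ^ (2 * b + 2) * exp (V r)) \<longlongrightarrow> 0) (at_right 0)"
      using lim[OF c(1), of "2 * a + 1"] lim[OF c(2), of "2 * b + 1"] by simp_all
    have "\<forall>\<^sub>F r in at_right 0. r ^ Suc (2 * a + 2 * b + 1) * exp (U r + V r) =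
        r ^ (2 * a + 2) * exp (U r) * (r ^ (2 * b + 2) * exp (V r)) / r\<^sup>2"
      unfolding eventually_at_right_field
      by (intro exI[of _ 1]) (auto simp: exp_add power_add power2_eq_square field_simps)
    then show "((\<lambda>r. r ^ (2 * a + 2) * exp (U r) * (r ^ (2 * b + 2) * exp (V r)) / r\<^sup>2) \<longlongrightarrow> 0) (at_right 0)"
      using lim[OF cUV] by (rule Lim_transform_eventually[rotated])
  qed (use assms in auto)
qed

section \<open>Values at infinity and the bounds on beta\<close>

lemma mass_has_integral:
  assumes "continuous_on {0..} f" "(mass n f \<longlongrightarrow> l) at_top"
  shows "((\<lambda>t. t ^ (2 * n + 1) * exp (f t)) has_integral l) {0..}"
  by (rule has_integral_to_inf)
     (use mass_integrable[OF assms(1)] assms(2) in \<open>auto simp: mass_def[abs_def]\<close>)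

lemma beta_bounds:
  fixes a b X Y W :: real
  assumes "0 < a" "0 < b" "0 < X" "0 < Y" "0 < W" and f1: "2 * a + 2 < W + Y" and f2: "2 * b + 2 < W - X"
    and poh: "(W + Y) * (W - X) = (2 * a + 2 * b + 2) * W + (2 * b + 2) * Y - (2 * a + 2) * X"
  defines "\<beta>1 \<equiv> (W + Y) / 2 - a" and "\<beta>2 \<equiv> (W - X) / 2 - b"
  shows "b + 1 < \<beta>1" "1 < \<beta>2" "\<beta>2 < a + 1"
    "0 < (\<beta>1 - 1) * (\<beta>2 - 1)" "(\<beta>1 - 1) * (\<beta>2 - 1) < (a + 1) * (b + 1)"
    "b * (a + 1) < \<beta>2 * (\<beta>1 - 1)" "0 < \<beta>1 * (\<beta>2 - 1)" "\<beta>1 * (\<beta>2 - 1) < a * (b + 1)"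
proof -
  \<comment> \<open>The Pohozaev identity solved for each mass in terms of \<open>\<beta>1\<close>
    and \<open>\<beta>2\<close>. The upper or lower bound on each product is then the positivity of
    \<open>W\<close>, \<open>Y\<close> or \<open>X\<close>.\<close>
  have p1: "(\<beta>1 - 1) * (\<beta>2 - 1) = (a + 1) * (b + 1) - W / 2"
    and p2: "\<beta>2 * (\<beta>1 - 1) = b * (a + 1) + Y / 2"
    and p3: "\<beta>1 * (\<beta>2 - 1) = a * (b + 1) - X / 2"
    using poh by (simp_all add: \<beta>1_def \<beta>2_def field_simps)
  have g: "1 < \<beta>1" "1 < \<beta>2" 
    using f1 f2 by (simp_all add: \<beta>1_def \<beta>2_def add_divide_distrib diff_divide_distrib)
  then show "1 < \<beta>2" "0 < (\<beta>1 - 1) * (\<beta>2 - 1)" "0 < \<beta>1 * (\<beta>2 - 1)" by auto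
  show "(\<beta>1 - 1) * (\<beta>2 - 1) < (a + 1) * (b + 1)" using p1 \<open>0 < W\<close> by simp
  show b2: "b * (a + 1) < \<beta>2 * (\<beta>1 - 1)" using p2 \<open>0 < Y\<close> by simp
  show b3: "\<beta>1 * (\<beta>2 - 1) < a * (b + 1)" using p3 \<open>0 < X\<close> by simp
  \<comment> \<open>Eliminating \<open>\<beta>2\<close> between the bounds that come from
    \<open>Y > 0\<close> and \<open>X > 0\<close> leaves a quadratic in \<open>\<beta>1\<close> with
    roots \<open>b + 1\<close> and \<open>- a\<close>.\<close>
  have "\<beta>1 * (b * (a + 1)) < \<beta>1 * (\<beta>2 * (\<beta>1 - 1))"
    using b2 g by (intro mult_strict_left_mono) auto
  moreover have "(\<beta>1 * (\<beta>2 - 1)) * (\<beta>1 - 1) < (a * (b + 1)) * (\<beta>1 - 1)"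
    using b3 g by (intro mult_strict_right_mono) auto
  ultimately have "0 < (\<beta>1 - (b + 1)) * (\<beta>1 + a)" by (simp add: algebra_simps)
  moreover have "0 < \<beta>1 + a" using g \<open>0 < a\<close> by simp
  ultimately show b1: "b + 1 < \<beta>1" by (simp add: zero_less_mult_iff)
  show "\<beta>2 < a + 1"
  proof (rule ccontr)
    assume "\<not> \<beta>2 < a + 1"
    then have "(b + 1) * a \<le> \<beta>1 * (\<beta>2 - 1)"
      using b1 g \<open>0 < a\<close> \<open>0 < b\<close> by (intro mult_mono) auto
    then show False using b3 by (simp add: mult.commute)
  qed
qed

lemma bounded_flux_limits:
  assumes ab: "0 < a" "0 < b" and sol: "cp_solution a b \<alpha>1 \<alpha>2 U V"
    and bdd: "\<And>r. 0 < r \<Longrightarrow> F1 a b U V r \<le> M"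
  obtains X Y W where
    "(mass a U \<longlongrightarrow> X) at_top" "(mass b V \<longlongrightarrow> Y) at_top" "(mass (a + b) (\<lambda>t. U t + V t) \<longlongrightarrow> W) at_top"
    "((\<lambda>r. r ^ (2 * a + 2) * exp (U r)) \<longlongrightarrow> 0) at_top" "((\<lambda>r. r ^ (2 * b + 2) * exp (V r)) \<longlongrightarrow> 0) at_top"
    "\<And>r. 0 < r \<Longrightarrow> mass a U r < X" "\<And>r. 0 < r \<Longrightarrow> mass b V r < Y"
    "\<And>r. 0 < r \<Longrightarrow> mass (a + b) (\<lambda>t. U t + V t) r < W"
    "2 * real a + 2 < W + Y" "2 * real b + 2 < W - X"
    "(W + Y) * (W - X) = (2 * real a + 2 * real b + 2) * W + (2 * real b + 2) * Y - (2 * real a + 2) * X"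
    "0 < X" "0 < Y" "0 < W"
proof -
  interpret trajectory "real a" "real b" "\<lambda>r. r ^ (2 * a + 2) * exp (U r)" "\<lambda>r. r ^ (2 * b + 2) * exp (V r)"
    "mass a U" "mass b V" "mass (a + b) (\<lambda>t. U t + V t)"
    by (rule cp_solution_trajectory[OF ab sol])
  show thesis
  proof (rule limits)
    show "mass (a + b) (\<lambda>t. U t + V t) r + mass b V r \<le> M" if "0 < r" for r
      using bdd[OF that] by (simp add: flux_eq_mass[OF cp_solution_continuous[OF sol]])
  qed (rule that)
qed

lemma at_infinity_of_masses:
  assumes c: "continuous_on {0..} U" "continuous_on {0..} V"
    and X: "(mass a U \<longlongrightarrow> X) at_top" and Y: "(mass b V \<longlongrightarrow> Y) at_top"
    and W: "(mass (a + b) (\<lambda>t. U t + V t) \<longlongrightarrow> W) at_top"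
  shows "F1_at_infinity a b U V (W + Y)" "F2_at_infinity a b U V (W - X)"
    "((\<lambda>t. t ^ (2 * a + 1) * exp (U t) + t ^ (2 * b + 1) * exp (V t)) has_integral X + Y) {0..}"
proof -
  have cUV: "continuous_on {0..} (\<lambda>t. U t + V t)" by (intro continuous_intros c)
  note int = mass_has_integral[OF cUV W] mass_has_integral[OF c(1) X] mass_has_integral[OF c(2) Y]
  have dens: "dens1 a b U V = (\<lambda>t. t ^ (2 * (a + b) + 1) * exp (U t + V t) + t ^ (2 * b + 1) * exp (V t))"
    "dens2 a b U V = (\<lambda>t. t ^ (2 * (a + b) + 1) * exp (U t + V t) - t ^ (2 * a + 1) * exp (U t))"
    by (rule ext, rule dens1_eq) (rule ext, rule dens2_eq)
  have F: "F1 a b U V = (\<lambda>r. mass (a + b) (\<lambda>t. U t + V t) r + mass b V r)"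
    "F2 a b U V = (\<lambda>r. mass (a + b) (\<lambda>t. U t + V t) r - mass a U r)"
    by (rule ext, rule flux_eq_mass[OF c])+
  show "F1_at_infinity a b U V (W + Y)"
    unfolding F1_at_infinity_def F dens by (intro conjI tendsto_add W Y has_integral_add int)
  show "F2_at_infinity a b U V (W - X)"
    unfolding F2_at_infinity_def F dens by (intro conjI tendsto_diff W X has_integral_diff int)
  show "((\<lambda>t. t ^ (2 * a + 1) * exp (U t) + t ^ (2 * b + 1) * exp (V t)) has_integral X + Y) {0..}"
    by (intro has_integral_add int)
qed

text \<open>Each of the three prescriptions bounds \<open>F1\<close>, so the analysis of bounded
  fluxes covers every solution in question. A limit of \<open>F1\<close> bounds it by monotonicity;
  the other two cases are the dichotomies for trajectories.\<close>

lemma F1_bounded_of_hypothesis: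
  assumes ab: "0 < a" "0 < b" and sol: "cp_solution a b \<alpha>1 \<alpha>2 U V"
    and hyp: "(\<exists>\<gamma>. 2 * real b + 2 < \<gamma> \<and> (F2 a b U V \<longlongrightarrow> \<gamma>) at_top) \<or>
      (\<exists>\<gamma>. (F1 a b U V \<longlongrightarrow> \<gamma>) at_top) \<or>
      (\<lambda>t. t ^ (2 * a + 1) * exp (U t) + t ^ (2 * b + 1) * exp (V t)) integrable_on {0..}"
  obtains M where "\<And>r. 0 < r \<Longrightarrow> F1 a b U V r \<le> M"
proof -
  note c = cp_solution_continuous[OF sol]
  note F = flux_eq_mass[OF c]
  interpret trajectory "real a" "real b" "\<lambda>r. r ^ (2 * a + 2) * exp (U r)" "\<lambda>r. r ^ (2 * b + 2) * exp (V r)"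
    "mass a U" "mass b V" "mass (a + b) (\<lambda>t. U t + V t)"
    by (rule cp_solution_trajectory[OF ab sol])
  let ?e = "\<lambda>t. t ^ (2 * a + 1) * exp (U t) + t ^ (2 * b + 1) * exp (V t)"
  from hyp consider \<gamma> where "2 * real b + 2 < \<gamma>" "(F2 a b U V \<longlongrightarrow> \<gamma>) at_top"
    | \<gamma> where "(F1 a b U V \<longlongrightarrow> \<gamma>) at_top"
    | "?e integrable_on {0..}"
    by blast
  then show thesis
  proof cases
    case (1 \<gamma>)
    have "((\<lambda>r. mass (a + b) (\<lambda>t. U t + V t) r - mass a U r) \<longlongrightarrow> \<gamma>) at_top"
      using 1(2) by (simp add: F flip: F(2))
    then show thesis using bounded_if_F2_limit[OF _ 1(1)] that by (auto simp: F)
  next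
    case (2 \<gamma>)
    show thesis
    proof (rule that)
      fix r :: real assume r: "0 < r"
      show "F1 a b U V r \<le> \<gamma>"
      proof (rule tendsto_lowerbound[OF 2])
        show "\<forall>\<^sub>F s in at_top. F1 a b U V r \<le> F1 a b U V s"
          using eventually_ge_at_top[of r]
          by eventually_elim (use r in \<open>auto simp: F intro!: add_mono w_mono y_mono\<close>)
      qed simp
    qed
  next
    case 3
    have "mass a U r + mass b V r \<le> integral {0..} ?e" if "0 < r" for r
    proof -
      have "mass a U r + mass b V r = integral {0..r} ?e"
        unfolding mass_def
        by (intro Henstock_Kurzweil_Integration.integral_add[symmetric] mass_integrable c)
      also have "\<dots> \<le> integral {0..} ?e"
      proof (rule integral_subset_le)
        show "?e integrable_on {0..r}" by (intro integrable_add mass_integrable c)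
      qed (use 3 in auto)
      finally show ?thesis .
    qed
    then show thesis using bounded_if_energy_bounded that by (auto simp: F)
  qed
qed

section \<open>Scaling and the Liouville equation\<close>

lemma rescaled_solution_scale:
  assumes sol: "rescaled_solution a b A B C U V P Q" and l: "0 < l"
  shows "rescaled_solution a b (l ^ (2 * (a + b) + 2) * A) (l ^ (2 * b + 2) * B) (l ^ (2 * a + 2) * C)
    (\<lambda>s. U (l * s)) (\<lambda>s. V (l * s)) (\<lambda>s. P (l * s)) (\<lambda>s. Q (l * s))"
proof -
  note D = rescaled_solutionD[OF sol]
  have cont: "continuous_on {0..} (\<lambda>s. f (l * s))" if "continuous_on {0..} f" for f :: "real \<Rightarrow> real"
    by (rule continuous_on_compose2[OF that]) (use l in \<open>auto intro!: continuous_intros\<close>)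
  have chain: "((\<lambda>s. f (l * s)) has_real_derivative l * f') (at s)"
    if "(f has_real_derivative f') (at (l * s))" for f :: "real \<Rightarrow> real" and f' s
  proof -
    have "((\<lambda>s. l * s) has_real_derivative l) (at s)" by (auto intro!: derivative_eq_intros)
    from DERIV_chain2[OF that this] show ?thesis by (simp only: mult.commute[of l f'])
  qed
  have ls: "0 < l * s" if "0 < s" for s using that l by simp
  show ?thesis
    unfolding rescaled_solution_def
  proof (intro conjI allI impI cont D)
    fix s :: real assume s: "0 < s"
    show "((\<lambda>s. U (l * s)) has_real_derivative - (P (l * s) / s)) (at s)"
      using chain[OF D(9)[OF ls[OF s]]] l by simp
    show "((\<lambda>s. V (l * s)) has_real_derivative - (Q (l * s) / s)) (at s)"
      using chain[OF D(10)[OF ls[OF s]]] l by simp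
    show "((\<lambda>s. P (l * s)) has_real_derivative
      s * (l ^ (2 * (a + b) + 2) * A * s ^ (2 * (a + b)) * exp (U (l * s)) * exp (V (l * s)) +
        l ^ (2 * b + 2) * B * s ^ (2 * b) * exp (V (l * s)))) (at s)"
      using chain[OF D(11)[OF ls[OF s]]]
      by (rule DERIV_cong) (simp add: power_mult_distrib power_add power2_eq_square algebra_simps)
    show "((\<lambda>s. Q (l * s)) has_real_derivative
      s * (l ^ (2 * (a + b) + 2) * A * s ^ (2 * (a + b)) * exp (U (l * s)) * exp (V (l * s)) -
        l ^ (2 * a + 2) * C * s ^ (2 * a) * exp (U (l * s)))) (at s)"
      using chain[OF D(12)[OF ls[OF s]]]
      by (rule DERIV_cong) (simp add: power_mult_distrib power_add power2_eq_square algebra_simps)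
  qed (use D in auto)
qed

text \<open>Without the terms in \<open>B\<close> and \<open>C\<close> the system reduces to the Liouville equation, whose radial
  solution is explicit and has total flux \<open>2 (a + b) + 2\<close>.\<close>

lemma liouville_solution:
  fixes a b :: nat
  defines "m \<equiv> 2 * (a + b) + 2"
  defines "u \<equiv> \<lambda>s::real. - ln (1 + s ^ m / (real m)\<^sup>2)"
    and "P \<equiv> \<lambda>s::real. real m * s ^ m / ((real m)\<^sup>2 + s ^ m)"
  shows "rescaled_solution a b 1 0 0 u u P P" and "real m - 1 \<le> P (real m ^ 3)"
proof -
  have m: "0 < real m" by (simp add: m_def)
  have pos: "0 < (real m)\<^sup>2 + s ^ m" if "0 \<le> s" for s :: real
    using m that by (simp add: add_pos_nonneg)
  have pos1: "0 < 1 + s ^ m / (real m)\<^sup>2" if "0 \<le> s" for s :: real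
    using m that by (simp add: add_pos_nonneg)
  have sm: "s ^ m = s * s * s ^ (2 * (a + b))" for s :: real
    by (simp add: m_def)
  have sm1: "s ^ (m - Suc 0) = s * s ^ (2 * (a + b))" for s :: real
    by (simp add: m_def)
  have eu: "exp (u s) = (real m)\<^sup>2 / ((real m)\<^sup>2 + s ^ m)" if "0 \<le> s" for s
    using pos1[OF that] pos[OF that] m by (simp add: u_def exp_minus field_simps)
  have du: "(u has_real_derivative - (P s / s)) (at s)" if s: "0 < s" for s
  proof -
    have "((\<lambda>s. 1 + s ^ m / (real m)\<^sup>2) has_real_derivative 0 + real m * s ^ (m - Suc 0) / (real m)\<^sup>2) (at s)"
      by (intro DERIV_add DERIV_const DERIV_cdivide DERIV_pow)
    from DERIV_minus[OF DERIV_chain2[OF DERIV_ln[OF pos1] this]]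
    have "(u has_real_derivative - (inverse (1 + s ^ m / (real m)\<^sup>2) * (real m * s ^ (m - Suc 0) / (real m)\<^sup>2))) (at s)"
      using s by (simp add: u_def)
    moreover have "inverse (1 + s ^ m / (real m)\<^sup>2) * (real m * s ^ (m - Suc 0) / (real m)\<^sup>2) = P s / s"
    proof -
      have "1 + s ^ m / (real m)\<^sup>2 = ((real m)\<^sup>2 + s ^ m) / (real m)\<^sup>2" using m by (simp add: add_divide_distrib)
      moreover have "inverse (D / M\<^sup>2) * (M * (s * z) / M\<^sup>2) = M * (s * s * z) / D / s"
        if "M \<noteq> 0" "D \<noteq> 0" for M D z :: real
        using s that by (simp add: field_simps)
      ultimately show ?thesis
        using pos[of s] s m unfolding P_def sm1 by (simp add: sm)
    qed
    ultimately show ?thesis by simp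
  qed
  have dP: "(P has_real_derivative s * (1 * s ^ (2 * (a + b)) * exp (u s) * exp (u s) + 0 * s ^ (2 * k) * exp (u s))) (at s)"
    if s: "0 < s" for s k
  proof -
    have "(P has_real_derivative
      (real m * (real m * s ^ (m - Suc 0)) * ((real m)\<^sup>2 + s ^ m) - real m * s ^ m * (real m * s ^ (m - Suc 0))) /
        (((real m)\<^sup>2 + s ^ m) * ((real m)\<^sup>2 + s ^ m))) (at s)"
      unfolding P_def using pos[of s] s by (auto intro!: derivative_eq_intros)
    moreover have "(real m * (real m * s ^ (m - Suc 0)) * ((real m)\<^sup>2 + s ^ m) - real m * s ^ m * (real m * s ^ (m - Suc 0))) /
        (((real m)\<^sup>2 + s ^ m) * ((real m)\<^sup>2 + s ^ m)) =
      s * (1 * s ^ (2 * (a + b)) * exp (u s) * exp (u s) + 0 * s ^ (2 * k) * exp (u s))"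
      using s pos[of s] unfolding eu[OF less_imp_le[OF s]] sm1
      by (simp add: divide_simps) (simp add: algebra_simps power2_eq_square)
    ultimately show ?thesis by simp
  qed
  have cont: "continuous_on {0..} u" "continuous_on {0..} P"
    unfolding u_def P_def using pos pos1 m
    by (auto intro!: continuous_intros simp: less_imp_neq[symmetric])
  show "rescaled_solution a b 1 0 0 u u P P"
    unfolding rescaled_solution_def
    using du dP[where k = b] dP[where k = a] cont m by (simp add: u_def P_def m_def)
  \<comment> \<open>The value of \<open>P\<close> at \<open>m^3\<close> is
    \<open>m * T / (m^2 + T)\<close>, which is at least \<open>m - 1\<close> as soon as
    \<open>T \<ge> m^2 * (m - 1)\<close>. The radius \<open>m^3\<close> is a generous
    choice.\<close>
  define T where "T = (real m ^ 3) ^ m"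
  have m1: "1 \<le> real m" by (simp add: m_def)
  have "real m ^ 3 \<le> T"
    unfolding T_def using m1 by (intro self_le_power) (auto simp: m_def)
  then have T: "(real m)\<^sup>2 * real m \<le> T" by (simp add: power2_eq_square power3_eq_cube mult.assoc)
  have "(real m - 1) * ((real m)\<^sup>2 + T) = (real m)\<^sup>2 * real m - (real m)\<^sup>2 + real m * T - T"
    by (simp add: algebra_simps)
  also have "\<dots> \<le> real m * T" using T by (smt (verit) zero_le_power2)
  finally have "(real m - 1) * ((real m)\<^sup>2 + T) \<le> real m * T" .
  moreover have "0 < (real m)\<^sup>2 + T" using pos[of "real m ^ 3"] m by (simp add: T_def)
  ultimately show "real m - 1 \<le> P (real m ^ 3)"
    by (simp add: P_def T_def[symmetric] pos_le_divide_eq)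
qed

lemma mass_le:
  assumes "continuous_on {0..} f" "0 \<le> r" "\<And>t. 0 < t \<Longrightarrow> t < r \<Longrightarrow> f t \<le> M"
  shows "mass n f r \<le> r ^ (2 * n + 2) * exp M"
proof -
  have "0 ^ (2 * n + 2) * exp M - mass n f 0 \<le> r ^ (2 * n + 2) * exp M - mass n f r"
  proof (rule nondecreasing_by_deriv[OF assms(2)])
    show "continuous_on {0..r} (\<lambda>r. r ^ (2 * n + 2) * exp M - mass n f r)"
      by (intro continuous_intros continuous_on_subset[OF continuous_mass[OF assms(1)]]) auto
    fix t :: real assume t: "0 < t" "t < r"
    show "((\<lambda>r. r ^ (2 * n + 2) * exp M - mass n f r) has_real_derivative
      real (2 * n + 2) * t ^ (2 * n + 1) * exp M - t ^ (2 * n + 1) * exp (f t)) (at t)"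
      by (rule derivative_eq_intros mass_deriv assms t refl)+ simp
    have "t ^ (2 * n + 1) * exp (f t) \<le> t ^ (2 * n + 1) * exp M"
      using assms(3)[OF t] t by (intro mult_left_mono) auto
    also have "\<dots> \<le> real (2 * n + 2) * (t ^ (2 * n + 1) * exp M)"
      using t mult_right_mono[of 1 "real (2 * n + 2)" "t ^ (2 * n + 1) * exp M"] by simp
    finally show "0 \<le> real (2 * n + 2) * t ^ (2 * n + 1) * exp M - t ^ (2 * n + 1) * exp (f t)"
      by (simp add: mult.assoc)
  qed
  then show ?thesis by simp
qed

section \<open>One-parameter families of solutions\<close>

lemma tendsto_of_bound:
  fixes f g :: "real \<Rightarrow> real"
  assumes "\<And>\<alpha>. \<alpha> \<in> {\<alpha>0 - 1..\<alpha>0 + 1} \<Longrightarrow> \<bar>f \<alpha> - f \<alpha>0\<bar> \<le> g \<alpha>" "(g \<longlongrightarrow> 0) (at \<alpha>0)"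
  shows "(f \<longlongrightarrow> f \<alpha>0) (at \<alpha>0)"
proof -
  have "((\<lambda>\<alpha>. f \<alpha> - f \<alpha>0) \<longlongrightarrow> 0) (at \<alpha>0)"
  proof (rule Lim_null_comparison[OF _ assms(2)])
    have "norm (f \<alpha> - f \<alpha>0) \<le> g \<alpha>" if "dist \<alpha> \<alpha>0 < 1" for \<alpha>
      using assms(1)[of \<alpha>] that by (simp add: dist_real_def abs_less_iff)
    then show "\<forall>\<^sub>F \<alpha> in at \<alpha>0. norm (f \<alpha> - f \<alpha>0) \<le> g \<alpha>"
      unfolding eventually_at by (intro exI[of _ 1]) auto
  qed
  then show ?thesis by (simp add: LIM_zero_iff)
qed

locale cp_family =
  fixes a b :: nat and L :: real and U V :: "real \<Rightarrow> real \<Rightarrow> real"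
  assumes a_pos: "0 < a" and b_pos: "0 < b"
    and sol: "\<And>\<alpha>. cp_solution a b \<alpha> (V_init a b L \<alpha>) (U \<alpha>) (V \<alpha>)"
begin

abbreviation "p \<alpha> r \<equiv> r ^ (2 * a + 2) * exp (U \<alpha> r)"
abbreviation "q \<alpha> r \<equiv> r ^ (2 * b + 2) * exp (V \<alpha> r)"
abbreviation "x \<alpha> \<equiv> mass a (U \<alpha>)"
abbreviation "y \<alpha> \<equiv> mass b (V \<alpha>)"
abbreviation "w \<alpha> \<equiv> mass (a + b) (\<lambda>t. U \<alpha> t + V \<alpha> t)"
abbreviation "G1 \<alpha> r \<equiv> F1 a b (U \<alpha>) (V \<alpha>) r"
abbreviation "G2 \<alpha> r \<equiv> F2 a b (U \<alpha>) (V \<alpha>) r"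

lemma trajectory: "trajectory (real a) (real b) (p \<alpha>) (q \<alpha>) (x \<alpha>) (y \<alpha>) (w \<alpha>)"
  by (rule cp_solution_trajectory[OF a_pos b_pos sol])

lemma G_eq: "G1 \<alpha> r = w \<alpha> r + y \<alpha> r" "G2 \<alpha> r = w \<alpha> r - x \<alpha> r"
  by (rule flux_eq_mass[OF cp_solution_continuous[OF sol]])+

lemma rescaled: "rescaled_solution a b (exp (\<alpha> + V_init a b L \<alpha>)) (exp (V_init a b L \<alpha>)) (exp \<alpha>)
    (\<lambda>r. U \<alpha> r - \<alpha>) (\<lambda>r. V \<alpha> r - V_init a b L \<alpha>) (F1 a b (U \<alpha>) (V \<alpha>)) (F2 a b (U \<alpha>) (V \<alpha>))"
  by (rule cp_solution_imp_rescaled[OF sol])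

lemma continuous_V_init: "continuous_on S (V_init a b L)"
  unfolding V_init_def[abs_def] by (intro continuous_intros) auto

lemma solution_tendsto:
  assumes r: "0 \<le> r"
  shows "((\<lambda>\<alpha>. U \<alpha> r) \<longlongrightarrow> U \<alpha>0 r) (at \<alpha>0)" "((\<lambda>\<alpha>. V \<alpha> r) \<longlongrightarrow> V \<alpha>0 r) (at \<alpha>0)"
    "((\<lambda>\<alpha>. G1 \<alpha> r) \<longlongrightarrow> G1 \<alpha>0 r) (at \<alpha>0)" "((\<lambda>\<alpha>. G2 \<alpha> r) \<longlongrightarrow> G2 \<alpha>0 r) (at \<alpha>0)"
proof -
  let ?A = "\<lambda>\<alpha>. exp (\<alpha> + V_init a b L \<alpha>)" and ?B = "\<lambda>\<alpha>. exp (V_init a b L \<alpha>)" and ?C = "\<lambda>\<alpha>. exp \<alpha>"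
  have V0: "(V_init a b L \<longlongrightarrow> V_init a b L \<alpha>0) (at \<alpha>0)"
    using continuous_V_init[of UNIV] by (simp add: continuous_on_def)
  \<comment> \<open>The Lipschitz constant needs one bound \<open>K\<close> for all coefficients
    involved; the window of radius 1 around \<open>\<alpha>0\<close> provides it.\<close>
  have "compact ((\<lambda>\<alpha>. ?A \<alpha> + ?B \<alpha> + ?C \<alpha>) ` {\<alpha>0 - 1..\<alpha>0 + 1})"
    by (intro compact_continuous_image continuous_intros continuous_V_init) auto
  then obtain K where K: "\<And>\<alpha>. \<alpha> \<in> {\<alpha>0 - 1..\<alpha>0 + 1} \<Longrightarrow> norm (?A \<alpha> + ?B \<alpha> + ?C \<alpha>) \<le> K"
    by (meson bounded_iff compact_imp_bounded imageI)
  have in_K: "?A \<alpha> \<in> {0..K}" "?B \<alpha> \<in> {0..K}" "?C \<alpha> \<in> {0..K}" if "\<alpha> \<in> {\<alpha>0 - 1..\<alpha>0 + 1}" for \<alpha>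
    using K[OF that] exp_ge_zero[of "\<alpha> + V_init a b L \<alpha>"] exp_ge_zero[of "V_init a b L \<alpha>"] exp_ge_zero[of \<alpha>]
    unfolding atLeastAtMost_iff real_norm_def by linarith+
  have \<alpha>0: "\<alpha>0 \<in> {\<alpha>0 - 1..\<alpha>0 + 1}" by simp
  have "0 \<le> K" using order_trans[OF exp_ge_zero] in_K(1)[OF \<alpha>0] by (simp only: atLeastAtMost_iff) blast
  then obtain c where c: "lipschitz_in_data a b K r c"
    using lipschitz_dependence r by blast
  define \<Delta> where "\<Delta> \<alpha> = c * (\<bar>?A \<alpha> - ?A \<alpha>0\<bar> + \<bar>?B \<alpha> - ?B \<alpha>0\<bar> + \<bar>?C \<alpha> - ?C \<alpha>0\<bar>)" for \<alpha>
  have "(\<Delta> \<longlongrightarrow> c * (\<bar>?A \<alpha>0 - ?A \<alpha>0\<bar> + \<bar>?B \<alpha>0 - ?B \<alpha>0\<bar> + \<bar>?C \<alpha>0 - ?C \<alpha>0\<bar>)) (at \<alpha>0)"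
    unfolding \<Delta>_def by (intro tendsto_intros V0)
  then have \<Delta>: "(\<Delta> \<longlongrightarrow> 0) (at \<alpha>0)" by simp
  have "r \<in> {0..r}" using r by simp
  note lip = lipschitz_in_dataD[OF c in_K in_K rescaled rescaled this, OF _ _ _ \<alpha>0 \<alpha>0 \<alpha>0]
  have "((\<lambda>\<alpha>. U \<alpha> r - \<alpha>) \<longlongrightarrow> U \<alpha>0 r - \<alpha>0) (at \<alpha>0)"
    by (rule tendsto_of_bound[OF _ \<Delta>]) (use lip(1) in \<open>simp add: \<Delta>_def\<close>)
  from tendsto_add[OF this tendsto_ident_at] show "((\<lambda>\<alpha>. U \<alpha> r) \<longlongrightarrow> U \<alpha>0 r) (at \<alpha>0)" by simp
  have "((\<lambda>\<alpha>. V \<alpha> r - V_init a b L \<alpha>) \<longlongrightarrow> V \<alpha>0 r - V_init a b L \<alpha>0) (at \<alpha>0)"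
    by (rule tendsto_of_bound[OF _ \<Delta>]) (use lip(2) in \<open>simp add: \<Delta>_def\<close>)
  from tendsto_add[OF this V0] have "((\<lambda>\<alpha>. V \<alpha> r - V_init a b L \<alpha> + V_init a b L \<alpha>) \<longlongrightarrow>
    V \<alpha>0 r - V_init a b L \<alpha>0 + V_init a b L \<alpha>0) (at \<alpha>0)" .
  then show "((\<lambda>\<alpha>. V \<alpha> r) \<longlongrightarrow> V \<alpha>0 r) (at \<alpha>0)" by simp
  show "((\<lambda>\<alpha>. G1 \<alpha> r) \<longlongrightarrow> G1 \<alpha>0 r) (at \<alpha>0)"
    by (rule tendsto_of_bound[OF _ \<Delta>]) (use lip(3) in \<open>simp add: \<Delta>_def\<close>)
  show "((\<lambda>\<alpha>. G2 \<alpha> r) \<longlongrightarrow> G2 \<alpha>0 r) (at \<alpha>0)"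
    by (rule tendsto_of_bound[OF _ \<Delta>]) (use lip(4) in \<open>simp add: \<Delta>_def\<close>)
qed

section \<open>Good parameters and their limits\<close>

definition good :: "real \<Rightarrow> bool" where
  "good \<alpha> \<longleftrightarrow> (\<exists>M. \<forall>r>0. G1 \<alpha> r \<le> M)"

text \<open>Total functions that are meaningful at good parameters; elsewhere \<open>Lim\<close>
  need not be a limit.\<close>

definition x_inf :: "real \<Rightarrow> real" where "x_inf \<alpha> = Lim at_top (x \<alpha>)"
definition y_inf :: "real \<Rightarrow> real" where "y_inf \<alpha> = Lim at_top (y \<alpha>)"
definition w_inf :: "real \<Rightarrow> real" where "w_inf \<alpha> = Lim at_top (w \<alpha>)"
definition f1 :: "real \<Rightarrow> real" where "f1 \<alpha> = w_inf \<alpha> + y_inf \<alpha>"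
definition f2 :: "real \<Rightarrow> real" where "f2 \<alpha> = w_inf \<alpha> - x_inf \<alpha>"

lemma good_limits:
  assumes "good \<alpha>"
  shows "(x \<alpha> \<longlongrightarrow> x_inf \<alpha>) at_top" "(y \<alpha> \<longlongrightarrow> y_inf \<alpha>) at_top" "(w \<alpha> \<longlongrightarrow> w_inf \<alpha>) at_top"
    "(p \<alpha> \<longlongrightarrow> 0) at_top" "(q \<alpha> \<longlongrightarrow> 0) at_top"
    "\<And>r. 0 < r \<Longrightarrow> x \<alpha> r < x_inf \<alpha>" "\<And>r. 0 < r \<Longrightarrow> y \<alpha> r < y_inf \<alpha>" "\<And>r. 0 < r \<Longrightarrow> w \<alpha> r < w_inf \<alpha>"
    "2 * real a + 2 < f1 \<alpha>" "2 * real b + 2 < f2 \<alpha>"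
    "f1 \<alpha> * f2 \<alpha> = (2 * real a + 2 * real b + 2) * w_inf \<alpha> + (2 * real b + 2) * y_inf \<alpha> - (2 * real a + 2) * x_inf \<alpha>"
    "0 < x_inf \<alpha>" "0 < y_inf \<alpha>" "0 < w_inf \<alpha>"
proof -
  obtain M where M: "\<And>r. 0 < r \<Longrightarrow> F1 a b (U \<alpha>) (V \<alpha>) r \<le> M"
    using assms unfolding good_def by blast
  have "((x \<alpha> \<longlongrightarrow> x_inf \<alpha>) at_top \<and> (y \<alpha> \<longlongrightarrow> y_inf \<alpha>) at_top \<and> (w \<alpha> \<longlongrightarrow> w_inf \<alpha>) at_top \<and>
    (p \<alpha> \<longlongrightarrow> 0) at_top \<and> (q \<alpha> \<longlongrightarrow> 0) at_top) \<and>
    (\<forall>r>0. x \<alpha> r < x_inf \<alpha>) \<and> (\<forall>r>0. y \<alpha> r < y_inf \<alpha>) \<and> (\<forall>r>0. w \<alpha> r < w_inf \<alpha>) \<and>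
    2 * real a + 2 < f1 \<alpha> \<and> 2 * real b + 2 < f2 \<alpha> \<and>
    f1 \<alpha> * f2 \<alpha> = (2 * real a + 2 * real b + 2) * w_inf \<alpha> + (2 * real b + 2) * y_inf \<alpha> - (2 * real a + 2) * x_inf \<alpha> \<and>
    0 < x_inf \<alpha> \<and> 0 < y_inf \<alpha> \<and> 0 < w_inf \<alpha>" (is ?limits)
  proof (rule bounded_flux_limits[OF a_pos b_pos sol M])
    fix X Y W
    assume lims: "(x \<alpha> \<longlongrightarrow> X) at_top" "(y \<alpha> \<longlongrightarrow> Y) at_top" "(w \<alpha> \<longlongrightarrow> W) at_top"
      and rest: "(p \<alpha> \<longlongrightarrow> 0) at_top" "(q \<alpha> \<longlongrightarrow> 0) at_top"
        "\<And>r. 0 < r \<Longrightarrow> x \<alpha> r < X" "\<And>r. 0 < r \<Longrightarrow> y \<alpha> r < Y" "\<And>r. 0 < r \<Longrightarrow> w \<alpha> r < W"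
        "2 * real a + 2 < W + Y" "2 * real b + 2 < W - X"
        "(W + Y) * (W - X) = (2 * real a + 2 * real b + 2) * W + (2 * real b + 2) * Y - (2 * real a + 2) * X"
        "0 < X" "0 < Y" "0 < W"
    have eq: "x_inf \<alpha> = X" "y_inf \<alpha> = Y" "w_inf \<alpha> = W"
      unfolding x_inf_def y_inf_def w_inf_def by (auto intro!: tendsto_Lim lims)
    show ?limits unfolding f1_def f2_def eq using lims rest by (intro conjI allI impI)
  qed
  then show "(x \<alpha> \<longlongrightarrow> x_inf \<alpha>) at_top" "(y \<alpha> \<longlongrightarrow> y_inf \<alpha>) at_top" "(w \<alpha> \<longlongrightarrow> w_inf \<alpha>) at_top"
    "(p \<alpha> \<longlongrightarrow> 0) at_top" "(q \<alpha> \<longlongrightarrow> 0) at_top"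
    "\<And>r. 0 < r \<Longrightarrow> x \<alpha> r < x_inf \<alpha>" "\<And>r. 0 < r \<Longrightarrow> y \<alpha> r < y_inf \<alpha>" "\<And>r. 0 < r \<Longrightarrow> w \<alpha> r < w_inf \<alpha>"
    "2 * real a + 2 < f1 \<alpha>" "2 * real b + 2 < f2 \<alpha>"
    "f1 \<alpha> * f2 \<alpha> = (2 * real a + 2 * real b + 2) * w_inf \<alpha> + (2 * real b + 2) * y_inf \<alpha> - (2 * real a + 2) * x_inf \<alpha>"
    "0 < x_inf \<alpha>" "0 < y_inf \<alpha>" "0 < w_inf \<alpha>"
    by (elim conjE, simp)+
qed

text \<open>The Pohozaev identity with \<open>w_inf\<close> eliminated. Continuity of the masses
  thus reduces to that of the fluxes, and positivity of \<open>x_inf\<close> ties \<open>f1\<close>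
  and \<open>f2\<close> together.\<close>

lemma masses_of_fluxes:
  assumes "good \<alpha>"
  shows "x_inf \<alpha> = (4 * real a * (real b + 1) - (f1 \<alpha> - 2 * real a) * (f2 \<alpha> - 2 * real b - 2)) / 2"
    "y_inf \<alpha> = ((f1 \<alpha> - 2 * real a - 2) * (f2 \<alpha> - 2 * real b) - 4 * (real a + 1) * real b) / 2"
  using good_limits(11)[OF assms] by (simp_all add: f1_def f2_def field_simps)

lemma good_facts:
  assumes "good \<alpha>"
  shows "(G1 \<alpha> \<longlongrightarrow> f1 \<alpha>) at_top" "(G2 \<alpha> \<longlongrightarrow> f2 \<alpha>) at_top"
    "0 < r \<Longrightarrow> G1 \<alpha> r \<le> f1 \<alpha>"
    "F1_at_infinity a b (U \<alpha>) (V \<alpha>) (f1 \<alpha>)" "F2_at_infinity a b (U \<alpha>) (V \<alpha>) (f2 \<alpha>)"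
proof -
  note l = good_limits[OF assms]
  show "G1 \<alpha> r \<le> f1 \<alpha>" if "0 < r" using l(7,8)[OF that] by (simp add: f1_def G_eq)
  show F: "F1_at_infinity a b (U \<alpha>) (V \<alpha>) (f1 \<alpha>)" "F2_at_infinity a b (U \<alpha>) (V \<alpha>) (f2 \<alpha>)"
    unfolding f1_def f2_def by (rule at_infinity_of_masses[OF cp_solution_continuous[OF sol] l(1-3)])+
  show "(G1 \<alpha> \<longlongrightarrow> f1 \<alpha>) at_top" "(G2 \<alpha> \<longlongrightarrow> f2 \<alpha>) at_top"
    using F by (simp_all add: F1_at_infinity_def F2_at_infinity_def)
qed

text \<open>The tail bounds of the trap read as errors of the limits: replacing a flux at infinity
  by its value at \<open>r0\<close> costs only terms in \<open>p\<close> and \<open>q\<close> at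
  \<open>r0\<close>.\<close>

lemma trapped:
  assumes r0: "0 < r0" and \<eta>: "0 < \<eta>" "2 * real a + 2 + \<eta> \<le> G1 \<alpha> r0"
    and \<theta>: "0 < \<theta>" "2 * real b + 2 + \<theta> \<le> G2 \<alpha> r0 - p \<alpha> r0 / \<eta>"
  shows "good \<alpha>"
    and "\<bar>f1 \<alpha> - G1 \<alpha> r0\<bar> \<le> p \<alpha> r0 * q \<alpha> r0 / (2 * r0\<^sup>2) + q \<alpha> r0 / \<theta>"
    and "\<bar>f2 \<alpha> - G2 \<alpha> r0\<bar> \<le> p \<alpha> r0 * q \<alpha> r0 / (2 * r0\<^sup>2) + p \<alpha> r0 / \<eta>"
    and "r0 \<le> r \<Longrightarrow> x \<alpha> r \<le> x \<alpha> r0 + p \<alpha> r0 / \<eta>"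
    and "r0 \<le> r \<Longrightarrow> y \<alpha> r \<le> y \<alpha> r0 + q \<alpha> r0 / \<theta>"
proof -
  interpret T: trajectory "real a" "real b" "p \<alpha>" "q \<alpha>" "x \<alpha>" "y \<alpha>" "w \<alpha>"
    by (rule trajectory)
  note T = T.trap_x[OF r0 \<eta>[unfolded G_eq] \<theta>[unfolded G_eq]] T.trap_y[OF r0 \<eta>[unfolded G_eq] \<theta>[unfolded G_eq]]
    T.trap_w[OF r0 \<eta>[unfolded G_eq] \<theta>[unfolded G_eq]]
  show "r0 \<le> r \<Longrightarrow> x \<alpha> r \<le> x \<alpha> r0 + p \<alpha> r0 / \<eta>" "r0 \<le> r \<Longrightarrow> y \<alpha> r \<le> y \<alpha> r0 + q \<alpha> r0 / \<theta>"
    using T by auto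
  define B1 where "B1 = p \<alpha> r0 * q \<alpha> r0 / (2 * r0\<^sup>2) + q \<alpha> r0 / \<theta>"
  define B2 where "B2 = p \<alpha> r0 * q \<alpha> r0 / (2 * r0\<^sup>2) + p \<alpha> r0 / \<eta>"
  have nn: "0 \<le> p \<alpha> r0 / \<eta>" "0 \<le> q \<alpha> r0 / \<theta>" "0 \<le> p \<alpha> r0 * q \<alpha> r0 / (2 * r0\<^sup>2)"
    using r0 \<eta> \<theta> by auto
  have b: "G1 \<alpha> r0 \<le> G1 \<alpha> r" "G1 \<alpha> r \<le> G1 \<alpha> r0 + B1" "G2 \<alpha> r0 - B2 \<le> G2 \<alpha> r" "G2 \<alpha> r \<le> G2 \<alpha> r0 + B2"
    if "r0 \<le> r" for r
    using T[OF that] T.x_mono[OF r0 that] T.y_mono[OF r0 that] T.w_mono[OF r0 that] nn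
    unfolding G_eq B1_def B2_def by linarith+
  have "G1 \<alpha> r \<le> G1 \<alpha> r0 + B1" if "0 < r" for r
  proof -
    have "G1 \<alpha> r \<le> G1 \<alpha> (max r r0)"
      unfolding G_eq using that by (intro add_mono T.w_mono T.y_mono) auto
    also have "\<dots> \<le> G1 \<alpha> r0 + B1" by (rule b) simp
    finally show ?thesis .
  qed
  then show good: "good \<alpha>" unfolding good_def by blast
  have ev: "\<forall>\<^sub>F r in at_top. r0 \<le> r" by (rule eventually_ge_at_top)
  have "f1 \<alpha> \<le> G1 \<alpha> r0 + B1" "G1 \<alpha> r0 \<le> f1 \<alpha>"
    by (rule tendsto_upperbound[OF good_facts(1)[OF good] eventually_mono[OF ev b(2)]], auto)
       (rule tendsto_lowerbound[OF good_facts(1)[OF good] eventually_mono[OF ev b(1)]], auto)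
  then show "\<bar>f1 \<alpha> - G1 \<alpha> r0\<bar> \<le> p \<alpha> r0 * q \<alpha> r0 / (2 * r0\<^sup>2) + q \<alpha> r0 / \<theta>"
    unfolding B1_def[symmetric] by linarith
  have "f2 \<alpha> \<le> G2 \<alpha> r0 + B2" "G2 \<alpha> r0 - B2 \<le> f2 \<alpha>"
    by (rule tendsto_upperbound[OF good_facts(2)[OF good] eventually_mono[OF ev b(4)]], auto)
       (rule tendsto_lowerbound[OF good_facts(2)[OF good] eventually_mono[OF ev b(3)]], auto)
  then show "\<bar>f2 \<alpha> - G2 \<alpha> r0\<bar> \<le> p \<alpha> r0 * q \<alpha> r0 / (2 * r0\<^sup>2) + p \<alpha> r0 / \<eta>"
    unfolding B2_def[symmetric] by linarith
qed

text \<open>The trap conditions hold strictly at one large radius for \<open>\<alpha>0\<close>,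
  hence at the same radius for all nearby \<open>\<alpha>\<close>. The three errors of size
  \<open>e\<close> are the tail at \<open>\<alpha>\<close>, the tail at \<open>\<alpha>0\<close> and
  the change of the flux at that radius.\<close>

lemma good_neighbourhood:
  assumes good: "good \<alpha>0" and e: "0 < e"
  shows "\<forall>\<^sub>F \<alpha> in at \<alpha>0. good \<alpha> \<and> \<bar>f1 \<alpha> - f1 \<alpha>0\<bar> < 3 * e \<and> \<bar>f2 \<alpha> - f2 \<alpha>0\<bar> < 3 * e"
proof -
  note g = good_facts(1,2)[OF good] good_limits(9,10,4,5)[OF good]
  \<comment> \<open>Half of each margin, so that the trap conditions are strict in the limit of
    large radii.\<close>
  define \<eta> where "\<eta> = (f1 \<alpha>0 - (2 * real a + 2)) / 2"
  define \<theta> where "\<theta> = (f2 \<alpha>0 - (2 * real b + 2)) / 2"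
  have \<eta>: "0 < \<eta>" "2 * real a + 2 + \<eta> < f1 \<alpha>0" and \<theta>: "0 < \<theta>" "2 * real b + 2 + \<theta> < f2 \<alpha>0 - 0 / \<eta>"
    using g(3,4) by (simp_all add: \<eta>_def \<theta>_def field_simps)
  let ?B1 = "\<lambda>\<alpha> r. p \<alpha> r * q \<alpha> r / (2 * r\<^sup>2) + q \<alpha> r / \<theta>"
  let ?B2 = "\<lambda>\<alpha> r. p \<alpha> r * q \<alpha> r / (2 * r\<^sup>2) + p \<alpha> r / \<eta>"
  have pq: "((\<lambda>r. p \<alpha>0 r * q \<alpha>0 r / (2 * r\<^sup>2)) \<longlongrightarrow> 0) at_top"
  proof (rule real_tendsto_divide_at_top)
    show "((\<lambda>r. p \<alpha>0 r * q \<alpha>0 r) \<longlongrightarrow> 0 * 0) at_top" by (rule tendsto_mult[OF g(5,6)])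
    show "filterlim (\<lambda>r. 2 * r\<^sup>2 :: real) at_top at_top"
      by (rule filterlim_tendsto_pos_mult_at_top[OF tendsto_const _ filterlim_pow_at_top[OF _ filterlim_ident]]) auto
  qed
  have lim: "(?B1 \<alpha>0 \<longlongrightarrow> 0 + 0 / \<theta>) at_top" "(?B2 \<alpha>0 \<longlongrightarrow> 0 + 0 / \<eta>) at_top"
    "((\<lambda>r. G2 \<alpha>0 r - p \<alpha>0 r / \<eta>) \<longlongrightarrow> f2 \<alpha>0 - 0 / \<eta>) at_top"
    using \<eta>(1) \<theta>(1) by (intro tendsto_intros pq g; simp)+
  have "\<forall>\<^sub>F r in at_top. 0 < r \<and> 2 * real a + 2 + \<eta> < G1 \<alpha>0 r \<and> 2 * real b + 2 + \<theta> < G2 \<alpha>0 r - p \<alpha>0 r / \<eta> \<and>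
    ?B1 \<alpha>0 r < e \<and> ?B2 \<alpha>0 r < e"
    using eventually_gt_at_top[of 0] order_tendstoD(1)[OF g(1) \<eta>(2)] order_tendstoD(1)[OF lim(3) \<theta>(2)]
      order_tendstoD(2)[OF lim(1), of e] order_tendstoD(2)[OF lim(2), of e] e
    by (simp add: eventually_conj_iff)
  then obtain r where r: "0 < r" and r1: "2 * real a + 2 + \<eta> < G1 \<alpha>0 r"
    and r2: "2 * real b + 2 + \<theta> < G2 \<alpha>0 r - p \<alpha>0 r / \<eta>" and r3: "?B1 \<alpha>0 r < e" "?B2 \<alpha>0 r < e"
    by (metis (no_types, lifting) eventually_happens trivial_limit_at_top_linorder)
  note st = solution_tendsto[OF less_imp_le[OF r]]
  have tend: "((\<lambda>\<alpha>. G2 \<alpha> r - p \<alpha> r / \<eta>) \<longlongrightarrow> G2 \<alpha>0 r - p \<alpha>0 r / \<eta>) (at \<alpha>0)"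
    "((\<lambda>\<alpha>. ?B1 \<alpha> r) \<longlongrightarrow> ?B1 \<alpha>0 r) (at \<alpha>0)" "((\<lambda>\<alpha>. ?B2 \<alpha> r) \<longlongrightarrow> ?B2 \<alpha>0 r) (at \<alpha>0)"
    "((\<lambda>\<alpha>. \<bar>G1 \<alpha> r - G1 \<alpha>0 r\<bar>) \<longlongrightarrow> \<bar>G1 \<alpha>0 r - G1 \<alpha>0 r\<bar>) (at \<alpha>0)"
    "((\<lambda>\<alpha>. \<bar>G2 \<alpha> r - G2 \<alpha>0 r\<bar>) \<longlongrightarrow> \<bar>G2 \<alpha>0 r - G2 \<alpha>0 r\<bar>) (at \<alpha>0)"
    using \<eta>(1) \<theta>(1) r by (intro tendsto_intros st; simp)+
  have self: "\<bar>f1 \<alpha>0 - G1 \<alpha>0 r\<bar> < e" "\<bar>f2 \<alpha>0 - G2 \<alpha>0 r\<bar> < e"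
    using trapped(2,3)[OF r \<eta>(1) less_imp_le[OF r1] \<theta>(1) less_imp_le[OF r2]] r3 by auto
  have ev: "\<forall>\<^sub>F \<alpha> in at \<alpha>0. 2 * real a + 2 + \<eta> < G1 \<alpha> r" "\<forall>\<^sub>F \<alpha> in at \<alpha>0. 2 * real b + 2 + \<theta> < G2 \<alpha> r - p \<alpha> r / \<eta>"
    "\<forall>\<^sub>F \<alpha> in at \<alpha>0. ?B1 \<alpha> r < e" "\<forall>\<^sub>F \<alpha> in at \<alpha>0. ?B2 \<alpha> r < e"
    "\<forall>\<^sub>F \<alpha> in at \<alpha>0. \<bar>G1 \<alpha> r - G1 \<alpha>0 r\<bar> < e" "\<forall>\<^sub>F \<alpha> in at \<alpha>0. \<bar>G2 \<alpha> r - G2 \<alpha>0 r\<bar> < e"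
    by (rule order_tendstoD(1)[OF st(3) r1], rule order_tendstoD(1)[OF tend(1) r2],
        rule order_tendstoD(2)[OF tend(2) r3(1)], rule order_tendstoD(2)[OF tend(3) r3(2)],
        rule order_tendstoD(2)[OF tend(4)], simp add: e, rule order_tendstoD(2)[OF tend(5)], simp add: e)
  show ?thesis
    using ev
  proof eventually_elim
    case (elim \<alpha>)
    note t = trapped(1-3)[OF r \<eta>(1) less_imp_le[OF elim(1)] \<theta>(1) less_imp_le[OF elim(2)]]
    show ?case
    proof (intro conjI)
      show "\<bar>f1 \<alpha> - f1 \<alpha>0\<bar> < 3 * e" using t(2) elim(3,5) self(1) by linarith
      show "\<bar>f2 \<alpha> - f2 \<alpha>0\<bar> < 3 * e" using t(3) elim(4,6) self(2) by linarith
    qed (rule t(1))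
  qed
qed

lemma good_open:
  assumes "good \<alpha>0"
  obtains d where "0 < d" "\<forall>\<alpha>. \<bar>\<alpha> - \<alpha>0\<bar> < d \<longrightarrow> good \<alpha>"
proof -
  have "\<forall>\<^sub>F \<alpha> in at \<alpha>0. good \<alpha>"
    using good_neighbourhood[OF assms zero_less_one] by (rule eventually_mono) simp
  then obtain d where "0 < d" "\<And>\<alpha>. \<alpha> \<noteq> \<alpha>0 \<Longrightarrow> dist \<alpha> \<alpha>0 < d \<Longrightarrow> good \<alpha>"
    by (auto simp: eventually_at)
  then show thesis using that[of d] assms by (metis dist_real_def)
qed

lemma f_tendsto:
  assumes "good \<alpha>0"
  shows "(f1 \<longlongrightarrow> f1 \<alpha>0) (at \<alpha>0)" "(f2 \<longlongrightarrow> f2 \<alpha>0) (at \<alpha>0)"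
proof -
  have "\<forall>\<^sub>F \<alpha> in at \<alpha>0. dist (f1 \<alpha>) (f1 \<alpha>0) < e" "\<forall>\<^sub>F \<alpha> in at \<alpha>0. dist (f2 \<alpha>) (f2 \<alpha>0) < e" if "0 < e" for e
    using good_neighbourhood[OF assms, of "e / 3"] that
    by (auto simp: dist_real_def elim: eventually_mono)
  then show "(f1 \<longlongrightarrow> f1 \<alpha>0) (at \<alpha>0)" "(f2 \<longlongrightarrow> f2 \<alpha>0) (at \<alpha>0)"
    by (auto simp: tendsto_iff)
qed

lemma f_continuous:
  assumes "\<And>\<alpha>. \<alpha> \<in> S \<Longrightarrow> good \<alpha>"
  shows "continuous_on S f1" "continuous_on S f2"
  unfolding continuous_on_def using f_tendsto assms by (auto intro: tendsto_within_subset)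

text \<open>A bound on \<open>f1\<close> bounds \<open>p\<close> and \<open>q\<close> uniformly in
  \<open>\<alpha>\<close>. Then \<open>w\<close> gains at most 1/2 beyond a fixed radius
  \<open>R\<close>, and at most 1/2 before it, because \<open>U \<le> \<alpha>\<close> makes
  \<open>p\<close> tiny there; but a good parameter has \<open>w_inf > 2b + 2\<close>.\<close>

lemma far_left:
  obtains \<alpha>1 where "\<forall>\<alpha>\<le>\<alpha>1. good \<alpha> \<longrightarrow> M < f1 \<alpha>"
proof -
  \<comment> \<open>\<open>K\<close> bounds \<open>x_inf\<close> by the Pohozaev identity,
    \<open>P0\<close> and \<open>Q0\<close> are the resulting bounds on \<open>p\<close> and
    \<open>q\<close> when \<open>f1 \<le> M\<close>, and \<open>R\<close> makes
    \<open>P0 * Q0 / (2 * R^2)\<close> at most 1/2.\<close>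
  define K where "K = 2 * real a * (real b + 1)"
  define P0 where "P0 = (2 * real a + 2) * K"
  define Q0 where "Q0 = (2 * real b + 2 + K) * \<bar>M\<bar>"
  define R where "R = 1 + P0 * Q0"
  have nn: "0 \<le> K" "0 \<le> P0" "0 \<le> Q0" by (auto simp: K_def P0_def Q0_def)
  have R: "1 \<le> R" using nn by (simp add: R_def)
  \<comment> \<open>Makes \<open>Q0 * R^(2a) * exp \<alpha>1\<close> at most 1/2;
    \<open>Q0 + 1\<close> keeps the argument of \<open>ln\<close> positive even if
    \<open>Q0 = 0\<close>.\<close>
  define \<alpha>1 where "\<alpha>1 = - ln (2 * (Q0 + 1) * R ^ (2 * a))"
  show thesis
  proof (rule that, intro allI impI, rule ccontr)
    fix \<alpha> assume le: "\<alpha> \<le> \<alpha>1" and good: "good \<alpha>" and "\<not> M < f1 \<alpha>"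
    then have M: "f1 \<alpha> \<le> M" by simp
    interpret T: trajectory "real a" "real b" "p \<alpha>" "q \<alpha>" "x \<alpha>" "y \<alpha>" "w \<alpha>"
      by (rule trajectory)
    note l = good_limits[OF good]
    have "0 \<le> (f1 \<alpha> - 2 * real a) * (f2 \<alpha> - 2 * real b - 2)" using l(9,10) by (intro mult_nonneg_nonneg) auto
    then have XK: "x_inf \<alpha> \<le> K" by (simp add: masses_of_fluxes(1)[OF good] K_def)
    have YM: "y_inf \<alpha> \<le> \<bar>M\<bar>" using M l(14) unfolding f1_def by linarith
    have p: "p \<alpha> r \<le> P0" if "0 < r" for r
    proof -
      have "p \<alpha> r \<le> (2 * real a + 2) * x \<alpha> r" by (rule T.p_le_x[OF that])
      also have "\<dots> \<le> P0" unfolding P0_def using l(6)[OF that] XK by (intro mult_left_mono) auto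
      finally show ?thesis .
    qed
    have q: "q \<alpha> r \<le> Q0" if "0 < r" for r
    proof -
      have "q \<alpha> r \<le> (2 * real b + 2 + K) * y \<alpha> r"
      proof (rule T.q_le_y[OF that])
        show "x \<alpha> t \<le> K" if "0 < t" for t using l(6)[OF that] XK by simp
      qed
      also have "\<dots> \<le> Q0" unfolding Q0_def using l(7)[OF that] YM nn by (intro mult_left_mono) auto
      finally show ?thesis .
    qed
    have "w \<alpha> s \<le> 1" if "R \<le> s" for s
    proof -
      have "w \<alpha> s \<le> w \<alpha> R + P0 * Q0 / (2 * R\<^sup>2)"
        using R that p q nn T.p_pos T.q_pos by (intro T.w_tail mult_mono) (auto intro: less_imp_le)
      moreover have "P0 * Q0 / (2 * R\<^sup>2) \<le> 1 / 2"
      proof -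
        have "P0 * Q0 \<le> R" by (simp add: R_def)
        also have "R \<le> R\<^sup>2" using R by (simp add: power2_eq_square)
        finally show ?thesis using R by (simp add: field_simps)
      qed
      moreover have "w \<alpha> R \<le> 1 / 2"
      proof -
        have grow: "Q0 * exp \<alpha> * 0 ^ (2 * a) - w \<alpha> 0 \<le> Q0 * exp \<alpha> * R ^ (2 * a) - w \<alpha> R"
        proof (rule nondecreasing_by_deriv[of 0 R "\<lambda>r. Q0 * exp \<alpha> * r ^ (2 * a) - w \<alpha> r"
              "\<lambda>t. Q0 * exp \<alpha> * (real (2 * a) * t ^ (2 * a - Suc 0)) - p \<alpha> t * q \<alpha> t / t ^ 3"])
          show "0 \<le> R" using R by simp
          show "continuous_on {0..R} (\<lambda>r. Q0 * exp \<alpha> * r ^ (2 * a) - w \<alpha> r)"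
            by (intro continuous_intros continuous_on_subset[OF continuous_mass] cp_solution_continuous[OF sol]) auto
          fix t :: real assume t: "0 < t"
          show "((\<lambda>r. Q0 * exp \<alpha> * r ^ (2 * a) - w \<alpha> r) has_real_derivative
            Q0 * exp \<alpha> * (real (2 * a) * t ^ (2 * a - Suc 0)) - p \<alpha> t * q \<alpha> t / t ^ 3) (at t)"
            by (intro DERIV_diff DERIV_cmult DERIV_pow T.dw t)
          have "U \<alpha> t \<le> \<alpha>" using rescaled_solution_bounds(1)[OF exp_ge_zero exp_ge_zero exp_ge_zero rescaled[of \<alpha>], of t] t by simp
          then have "p \<alpha> t * q \<alpha> t \<le> (t ^ (2 * a + 2) * exp \<alpha>) * Q0"
            using q[OF t] nn t by (intro mult_mono) auto
          then have "p \<alpha> t * q \<alpha> t / t ^ 3 \<le> (t ^ (2 * a + 2) * exp \<alpha>) * Q0 / t ^ 3"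
            using t by (intro divide_right_mono) auto
          also have "\<dots> = Q0 * exp \<alpha> * t ^ (2 * a - Suc 0)"
          proof -
            \<comment> \<open>The subtraction of natural numbers is exact because \<open>a\<close>
              is positive.\<close>
            have "2 * a + 2 = (2 * a - Suc 0) + 3" using a_pos by simp
            then have "t ^ (2 * a + 2) = t ^ (2 * a - Suc 0) * t ^ 3" by (metis power_add)
            then show ?thesis using t by simp
          qed
          also have "\<dots> \<le> Q0 * exp \<alpha> * (real (2 * a) * t ^ (2 * a - Suc 0))"
            using a_pos nn t mult_right_mono[of 1 "real (2 * a)" "t ^ (2 * a - Suc 0)"]
            by (intro mult_left_mono) auto
          finally show "0 \<le> Q0 * exp \<alpha> * (real (2 * a) * t ^ (2 * a - Suc 0)) - p \<alpha> t * q \<alpha> t / t ^ 3"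
            by simp
        qed
        have zero: "(0::real) ^ (2 * a) = 0" using a_pos by simp
        have "w \<alpha> R \<le> Q0 * R ^ (2 * a) * exp \<alpha>"
          using grow unfolding zero by (simp add: mult.commute mult.left_commute)
        also have "\<dots> \<le> Q0 * R ^ (2 * a) * exp \<alpha>1" using le nn R by (intro mult_left_mono) auto
        also have "\<dots> = Q0 * R ^ (2 * a) / (2 * (Q0 + 1) * R ^ (2 * a))"
          using nn R by (simp add: \<alpha>1_def exp_minus divide_inverse)
        also have "\<dots> = Q0 / (2 * (Q0 + 1))" using R by simp
        also have "\<dots> \<le> 1 / 2" using nn by (simp add: divide_simps)
        finally show ?thesis .
      qed
      ultimately show ?thesis by linarith
    qed
    then have "w_inf \<alpha> \<le> 1"
      by (intro tendsto_upperbound[OF l(3)]) (auto simp: eventually_at_top_linorder)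
    then show False using l(10,12) by (simp add: f2_def)
  qed
qed

lemma f1_unbounded:
  assumes "good A"
  obtains \<alpha>0 where "\<alpha>0 \<le> A" "\<forall>\<alpha>\<in>{\<alpha>0..A}. good \<alpha>" "M \<le> f1 \<alpha>0"
proof (rule ccontr)
  note witness = that
  assume neg: "\<not> thesis"
  define T where "T = {\<alpha>0. \<alpha>0 \<le> A \<and> (\<forall>\<alpha>\<in>{\<alpha>0..A}. good \<alpha>)}"
  have M: "f1 \<alpha> < M" if "\<alpha> \<in> T" for \<alpha>
  proof (rule ccontr)
    assume "\<not> f1 \<alpha> < M"
    then have thesis by (intro witness[of \<alpha>]) (use that in \<open>auto simp: T_def\<close>)
    then show False using neg by simp
  qed
  have T_up: "\<beta> \<in> T" if "\<alpha> \<in> T" "\<alpha> \<le> \<beta>" "\<beta> \<le> A" for \<alpha> \<beta>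
    using that by (auto simp: T_def)
  have AT: "A \<in> T" using assms by (simp add: T_def)
  show False
  proof (cases "bdd_below T")
    case True
    define c where "c = Inf T"
    have cA: "c \<le> A" unfolding c_def using AT True by (rule cInf_lower)
    have above: "\<alpha> \<in> T" if c\<alpha>: "c < \<alpha>" "\<alpha> \<le> A" for \<alpha>
    proof -
      obtain t where "t \<in> T" "t < \<alpha>"
        using cInf_less_iff[of T \<alpha>] AT True c\<alpha>(1) unfolding c_def by blast
      then show ?thesis using T_up c\<alpha> by auto
    qed
    have "good c"
    proof (cases "c = A")
      case False
      \<comment> \<open>Goodness of \<open>c\<close> is not yet known, but the flux at a fixed
        radius is continuous in \<open>\<alpha>\<close> everywhere. Just to the right of
        \<open>c\<close> it is at most \<open>f1 \<alpha> < M\<close>, and this bound survives in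
        the limit.\<close>
      have "G1 c r \<le> M" if r: "0 < r" for r
      proof (rule tendsto_upperbound)
        show "((\<lambda>\<alpha>. G1 \<alpha> r) \<longlongrightarrow> G1 c r) (at_right c)"
          using solution_tendsto(3)[of r c] r by (auto intro: tendsto_within_subset)
        show "\<forall>\<^sub>F \<alpha> in at_right c. G1 \<alpha> r \<le> M"
          unfolding eventually_at_right_field
        proof (intro exI[of _ A] conjI allI impI)
          fix \<alpha> assume "c < \<alpha>" "\<alpha> < A"
          then have "\<alpha> \<in> T" using above by simp
          then have "good \<alpha>" by (simp add: T_def)
          then show "G1 \<alpha> r \<le> M" using good_facts(3)[of \<alpha> r] r M[OF \<open>\<alpha> \<in> T\<close>] by simp
        qed (use cA False in auto)
      qed simp
      then show ?thesis unfolding good_def by blast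
    qed (use assms in auto)
    then obtain d where d: "0 < d" "\<forall>\<alpha>. \<bar>\<alpha> - c\<bar> < d \<longrightarrow> good \<alpha>" by (rule good_open)
    have "c - d / 2 \<in> T"
      unfolding T_def
    proof (intro CollectI conjI ballI)
      show "c - d / 2 \<le> A" using cA d by simp
      fix \<alpha> assume \<alpha>: "\<alpha> \<in> {c - d / 2..A}"
      show "good \<alpha>"
      proof (cases "c < \<alpha>")
        case True
        then show ?thesis using above[of \<alpha>] \<alpha> by (simp add: T_def)
      next
        case False
        then show ?thesis using \<alpha> d by auto
      qed
    qed
    then have "c \<le> c - d / 2" unfolding c_def using True by (intro cInf_lower)
    then show False using d by simp
  next
    case False
    obtain \<alpha>1 where \<alpha>1: "\<forall>\<alpha>\<le>\<alpha>1. good \<alpha> \<longrightarrow> M < f1 \<alpha>" by (rule far_left)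
    obtain t where t: "t \<in> T" "t < \<alpha>1"
      using False by (meson bdd_belowI not_le)
    have "good t" using t(1) by (simp add: T_def)
    then have "M < f1 t" using \<alpha>1 t(2) by simp
    then show False using M[OF t(1)] by simp
  qed
qed

text \<open>In the rescaled variables the solution is close to the Liouville solution up to the
  fixed radius \<open>S\<close>. There both fluxes are within about 1 of
  \<open>2 (a + b) + 2\<close> and so beyond their critical values, as \<open>a\<close> and
  \<open>b\<close> are at least 1. The trap takes over from there, with \<open>p\<close>,
  \<open>q\<close>, \<open>x\<close>, \<open>y\<close> all of order
  \<open>\<epsilon>\<close>.\<close>

lemma far_right:
  assumes \<delta>: "0 < \<delta>"
  obtains \<alpha> where "good \<alpha>" "x_inf \<alpha> + y_inf \<alpha> < \<delta>"
proof -
  define m where "m = 2 * (a + b) + 2"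
  define S where "S = real m ^ 3"
  define u where "u = (\<lambda>s::real. - ln (1 + s ^ m / (real m)\<^sup>2))"
  define P where "P = (\<lambda>s::real. real m * s ^ m / ((real m)\<^sup>2 + s ^ m))"
  have m: "0 < real m" and S: "0 < S" by (simp_all add: m_def S_def)
  have liouville: "rescaled_solution a b 1 0 0 u u P P" and PS: "real m - 1 \<le> P S"
    using liouville_solution[of a b] by (simp_all add: u_def P_def m_def S_def)
  obtain c where c: "0 \<le> c" "lipschitz_in_data a b 1 S c"
    using lipschitz_dependence[of 1 S a b] S by (metis less_imp_le zero_le_one)
  define H where "H = S ^ (2 * a + 2) + S ^ (2 * b + 2) * exp (S ^ (2 * a + 2))"
  have H: "0 < H" using S by (simp add: H_def add_pos_pos)
  \<comment> \<open>Allows for the distance of the fluxes from the Liouville flux, at most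
    \<open>2 * \<epsilon> * c\<close>, and for \<open>p\<close>, \<open>q\<close>, \<open>x\<close>,
    \<open>y\<close> at \<open>r0\<close>, each at most \<open>\<epsilon> * H\<close>; these add up
    to at most \<open>8 * \<epsilon> * H\<close> in the final estimate of
    \<open>x_inf + y_inf\<close>.\<close>
  define \<epsilon> where "\<epsilon> = min 1 \<delta> / (16 * (c + H + 1))"
  have pos: "0 < 16 * (c + H + 1)" using c H by simp
  have \<epsilon>0: "0 < \<epsilon>" using \<delta> pos by (simp add: \<epsilon>_def)
  have \<epsilon>_eq: "\<epsilon> * (16 * (c + H + 1)) = min 1 \<delta>" using pos by (simp add: \<epsilon>_def)
  have \<epsilon>: "16 * (\<epsilon> * c) + 16 * (\<epsilon> * H) + 16 * \<epsilon> \<le> 1" "16 * (\<epsilon> * c) + 16 * (\<epsilon> * H) + 16 * \<epsilon> \<le> \<delta>"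
    using \<epsilon>_eq by (simp_all add: algebra_simps)
  have \<epsilon>nn: "0 \<le> \<epsilon> * c" "0 \<le> \<epsilon> * H" using \<epsilon>0 c H by auto
  \<comment> \<open>The constants left in the exponents: after rescaling, \<open>C\<close> and
    \<open>B\<close> become \<open>exp (k1 - \<alpha> / (2a + 1))\<close> and
    \<open>exp (k2 - \<alpha> / (2a + 1))\<close>. The next definition takes \<open>\<alpha>\<close>
    large enough to push both below \<open>\<epsilon>\<close>.\<close>
  define k1 where "k1 = (real a + 1) * L / ((real a + real b + 1) * (2 * real a + 1))"
  define k2 where "k2 = - (real a * L / ((real a + real b + 1) * (2 * real a + 1)))"
  define \<alpha> where "\<alpha> = (2 * real a + 1) * (\<bar>k1\<bar> + \<bar>k2\<bar> - ln \<epsilon>)"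
  define v where "v = V_init a b L \<alpha>"
  \<comment> \<open>The scale at which the coefficient of \<open>e^(U+V)\<close> becomes 1.\<close>
  define l where "l = exp (- (\<alpha> + v) / real m)"
  have l: "0 < l" by (simp add: l_def)
  have \<alpha>_div: "\<alpha> / (2 * real a + 1) = \<bar>k1\<bar> + \<bar>k2\<bar> - ln \<epsilon>" by (simp add: \<alpha>_def)
  have lpow: "l ^ k = exp (real k * (- (\<alpha> + v) / real m))" for k
    unfolding l_def by (rule exp_of_nat_mult[symmetric])
  have coefA: "l ^ (2 * (a + b) + 2) * exp (\<alpha> + v) = 1"
    unfolding lpow m_def[symmetric] using m by (simp flip: exp_add)
  define C where "C = l ^ (2 * a + 2) * exp \<alpha>"
  define B where "B = l ^ (2 * b + 2) * exp v"
  have nz: "real a + real b + 1 \<noteq> 0" "2 * real a + 1 \<noteq> 0" by linarith+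
  have mr: "real m = 2 * (real a + real b + 1)" by (simp add: m_def)
  have "real (2 * a + 2) * (- (\<alpha> + v) / real m) + \<alpha> = k1 - \<alpha> / (2 * real a + 1)"
    unfolding v_def V_init_def k1_def mr using nz by (simp add: divide_simps) (simp add: algebra_simps)
  then have "C = exp (k1 - \<alpha> / (2 * real a + 1))"
    unfolding C_def lpow by (simp flip: exp_add)
  also have "\<dots> \<le> exp (ln \<epsilon>)" unfolding \<alpha>_div exp_le_cancel_iff by linarith
  finally have C: "C \<le> \<epsilon>" "0 \<le> C" using \<epsilon>0 l by (auto simp: C_def)
  have "real (2 * b + 2) * (- (\<alpha> + v) / real m) + v = k2 - \<alpha> / (2 * real a + 1)"
    unfolding v_def V_init_def k2_def mr using nz by (simp add: divide_simps) (simp add: algebra_simps)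
  then have "B = exp (k2 - \<alpha> / (2 * real a + 1))"
    unfolding B_def lpow by (simp flip: exp_add)
  also have "\<dots> \<le> exp (ln \<epsilon>)" unfolding \<alpha>_div exp_le_cancel_iff by linarith
  finally have B: "B \<le> \<epsilon>" "0 \<le> B" using \<epsilon>0 l by (auto simp: B_def)
  have \<epsilon>1: "\<epsilon> \<le> 1" using \<epsilon> \<epsilon>nn by linarith
  have scaled: "rescaled_solution a b 1 B C (\<lambda>s. U \<alpha> (l * s) - \<alpha>) (\<lambda>s. V \<alpha> (l * s) - v)
    (\<lambda>s. G1 \<alpha> (l * s)) (\<lambda>s. G2 \<alpha> (l * s))"
    using rescaled_solution_scale[OF rescaled l, of \<alpha>] unfolding v_def[symmetric] coefA B_def C_def .
  define r0 where "r0 = l * S"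
  have r0: "0 < r0" using l S by (simp add: r0_def)
  have "c * (\<bar>1 - 1\<bar> + \<bar>B - 0\<bar> + \<bar>C - 0\<bar>) \<le> c * (2 * \<epsilon>)"
    using B C c by (intro mult_left_mono) auto
  then have le: "c * (\<bar>1 - 1\<bar> + \<bar>B - 0\<bar> + \<bar>C - 0\<bar>) \<le> 2 * (\<epsilon> * c)"
    by (simp only: mult.commute[of c] mult.assoc)
  have par: "(1::real) \<in> {0..1}" "(0::real) \<in> {0..1}" "B \<in> {0..1}" "C \<in> {0..1}" "S \<in> {0..S}"
    using B C \<epsilon>1 S by auto
  note lip = lipschitz_in_dataD(3,4)[OF c(2) par(1,3,4,1,2,2) scaled liouville par(5)]
  have close: "\<bar>G1 \<alpha> r0 - P S\<bar> \<le> 2 * (\<epsilon> * c)" "\<bar>G2 \<alpha> r0 - P S\<bar> \<le> 2 * (\<epsilon> * c)"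
    unfolding r0_def by (rule order_trans[OF lip(1) le], rule order_trans[OF lip(2) le])
  have H1: "S ^ (2 * a + 2) \<le> H" "S ^ (2 * b + 2) * exp (S ^ (2 * a + 2)) \<le> H"
    using S by (simp_all add: H_def)
  have Cr: "r0 ^ (2 * a + 2) * exp \<alpha> = C * S ^ (2 * a + 2)"
    by (simp add: r0_def C_def power_mult_distrib)
  have Br: "r0 ^ (2 * b + 2) * exp v = B * S ^ (2 * b + 2)"
    by (simp add: r0_def B_def power_mult_distrib)
  have CS: "C * S ^ (2 * a + 2) \<le> \<epsilon> * H"
    using C H1 S \<epsilon>0 by (intro mult_mono) auto
  have BS: "B * S ^ (2 * b + 2) * exp (S ^ (2 * a + 2)) \<le> \<epsilon> * H"
    unfolding mult.assoc using B H1 S \<epsilon>0 by (intro mult_mono) auto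
  \<comment> \<open>Up to \<open>r0\<close> the growth term \<open>e^\<alpha> * t^(2a+2)\<close> of
    the a priori bound on \<open>V\<close> is at most \<open>C * S^(2a+2)\<close>, and
    \<open>C \<le> 1\<close>.\<close>
  have U\<alpha>: "U \<alpha> t \<le> \<alpha>" and Vv: "V \<alpha> t \<le> v + S ^ (2 * a + 2)" if "0 \<le> t" "t \<le> r0" for t
  proof -
    note bd = rescaled_solution_bounds[OF exp_ge_zero exp_ge_zero exp_ge_zero rescaled[of \<alpha>] that(1)]
    show "U \<alpha> t \<le> \<alpha>" using bd(1) by simp
    have "exp \<alpha> * t ^ (2 * a + 2) \<le> exp \<alpha> * r0 ^ (2 * a + 2)"
      using that by (intro mult_left_mono power_mono) auto
    also have "\<dots> = C * S ^ (2 * a + 2)" using Cr by (simp add: mult.commute)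
    also have "\<dots> \<le> 1 * S ^ (2 * a + 2)" using C \<epsilon>1 S by (intro mult_right_mono) auto
    finally show "V \<alpha> t \<le> v + S ^ (2 * a + 2)" using bd(2) by (simp add: v_def)
  qed
  have qb: "r0 ^ (2 * b + 2) * exp (v + S ^ (2 * a + 2)) \<le> \<epsilon> * H"
    using BS Br by (simp add: exp_add mult.assoc[symmetric])
  have p: "p \<alpha> r0 \<le> \<epsilon> * H"
  proof -
    have "p \<alpha> r0 \<le> r0 ^ (2 * a + 2) * exp \<alpha>"
      using U\<alpha>[of r0] r0 by (intro mult_left_mono) auto
    then show ?thesis using Cr CS by simp
  qed
  have q: "q \<alpha> r0 \<le> \<epsilon> * H"
  proof -
    have "q \<alpha> r0 \<le> r0 ^ (2 * b + 2) * exp (v + S ^ (2 * a + 2))"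
      using Vv[of r0] r0 by (intro mult_left_mono) auto
    then show ?thesis using qb by simp
  qed
  have x: "x \<alpha> r0 \<le> \<epsilon> * H"
    using mass_le[OF cp_solution_continuous(1)[OF sol], of r0 \<alpha> \<alpha> a] r0 U\<alpha> Cr CS by simp
  have y: "y \<alpha> r0 \<le> \<epsilon> * H"
    using mass_le[OF cp_solution_continuous(2)[OF sol], of r0 \<alpha> "v + S ^ (2 * a + 2)" b] r0 Vv qb by simp
  have a1: "1 \<le> real a" "1 \<le> real b" using a_pos b_pos by simp_all
  have low: "2 * real a + 2 * real b + 7 / 8 \<le> G1 \<alpha> r0" "2 * real a + 2 * real b + 7 / 8 \<le> G2 \<alpha> r0"
  proof -
    have "P S - G1 \<alpha> r0 \<le> 2 * (\<epsilon> * c)" "P S - G2 \<alpha> r0 \<le> 2 * (\<epsilon> * c)"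
      using close by (simp_all add: abs_le_iff)
    moreover have "2 * (\<epsilon> * c) \<le> 1 / 8" using \<epsilon>(1) \<epsilon>nn \<epsilon>0 by simp
    moreover have "2 * real a + 2 * real b + 1 \<le> P S" using PS mr by simp
    ultimately show "2 * real a + 2 * real b + 7 / 8 \<le> G1 \<alpha> r0" "2 * real a + 2 * real b + 7 / 8 \<le> G2 \<alpha> r0"
      by linarith+
  qed
  \<comment> \<open>With \<open>\<eta> = 1/2\<close> the mass that \<open>x\<close> can still gain
    is at most \<open>2 * p \<le> 1/8\<close>, which leaves room for
    \<open>\<theta> = 1/4\<close>.\<close>
  have p8: "p \<alpha> r0 \<le> 1 / 16" using p \<epsilon>(1) \<epsilon>nn \<epsilon>0 by linarith
  have h2: "z / (1 / 2) = 2 * z" and h4: "z / (1 / 4) = 4 * z" for z :: real by simp_all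
  have t1: "2 * real a + 2 + 1 / 2 \<le> G1 \<alpha> r0"
    using low(1) a1 by linarith
  have t2: "2 * real b + 2 + 1 / 4 \<le> G2 \<alpha> r0 - p \<alpha> r0 / (1 / 2)"
    unfolding h2 using low(2) a1 p8 by linarith
  have half: "(0::real) < 1 / 2" "(0::real) < 1 / 4" by simp_all
  note tr = trapped[OF r0 half(1) t1 half(2) t2]
  have "x_inf \<alpha> \<le> x \<alpha> r0 + 2 * p \<alpha> r0"
    unfolding h2[symmetric]
    by (rule tendsto_upperbound[OF good_limits(1)[OF tr(1)] eventually_mono[OF eventually_ge_at_top[of r0] tr(4)]]) auto
  moreover have "y_inf \<alpha> \<le> y \<alpha> r0 + 4 * q \<alpha> r0"
    unfolding h4[symmetric]
    by (rule tendsto_upperbound[OF good_limits(2)[OF tr(1)] eventually_mono[OF eventually_ge_at_top[of r0] tr(5)]]) auto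
  ultimately have "x_inf \<alpha> + y_inf \<alpha> < \<delta>"
    using x y p q \<epsilon>(2) \<epsilon>nn \<epsilon>0 by linarith
  then show thesis using that tr(1) by blast
qed

text \<open>In terms of \<open>D\<close> the Pohozaev identity for the limits reads
  \<open>w D = x y + (2b + 2) y - (2a + 2) x\<close>. The right side is small and
  \<open>w \<ge> 2\<close>, so \<open>D\<close> is small, and \<open>f1\<close>, \<open>f2\<close>
  differ from \<open>2 (a + b + 1)\<close> by \<open>D + x\<close> and \<open>D - y\<close>.\<close>

lemma close_to_critical:
  assumes good: "good \<alpha>" and small: "x_inf \<alpha> + y_inf \<alpha> < \<delta>" and \<delta>: "\<delta> \<le> 1"
  shows "f1 \<alpha> \<le> 2 * (real a + real b + 1) + (real a + real b + 4) * \<delta>"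
    "2 * (real a + real b + 1) - (real a + real b + 4) * \<delta> \<le> f2 \<alpha>"
proof -
  note l = good_limits[OF good]
  define D where "D = w_inf \<alpha> + y_inf \<alpha> - x_inf \<alpha> - 2 * (real a + real b + 1)"
  define n where "n = real a + real b"
  have n: "2 \<le> n" using a_pos b_pos by (simp add: n_def)
  have w: "2 \<le> w_inf \<alpha>" using l(10,12) by (simp add: f2_def)
  have x: "0 < x_inf \<alpha>" "x_inf \<alpha> \<le> \<delta>" and y: "0 < y_inf \<alpha>" "y_inf \<alpha> \<le> \<delta>"
    using l(12,13) small by auto
  have \<delta>0: "0 < \<delta>" using x by linarith
  have eq: "w_inf \<alpha> * D = x_inf \<alpha> * y_inf \<alpha> + (2 * real b + 2) * y_inf \<alpha> - (2 * real a + 2) * x_inf \<alpha>"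
    using l(11) by (simp add: D_def f1_def f2_def algebra_simps)
  have xy: "0 \<le> x_inf \<alpha> * y_inf \<alpha>" "x_inf \<alpha> * y_inf \<alpha> \<le> \<delta>"
    using x y \<delta> mult_mono[of "x_inf \<alpha>" 1 "y_inf \<alpha>" \<delta>] by auto
  have by_: "(2 * real b + 2) * y_inf \<alpha> \<le> (2 * n + 2) * \<delta>" "0 \<le> (2 * real b + 2) * y_inf \<alpha>"
    and ax: "(2 * real a + 2) * x_inf \<alpha> \<le> (2 * n + 2) * \<delta>" "0 \<le> (2 * real a + 2) * x_inf \<alpha>"
    using x y \<delta>0 by (auto intro!: mult_mono simp: n_def)
  have D: "\<bar>D\<bar> \<le> (n + 3) * \<delta>"
  proof -
    have "2 * \<bar>D\<bar> \<le> w_inf \<alpha> * \<bar>D\<bar>" using w by (intro mult_right_mono) auto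
    also have "\<dots> = \<bar>w_inf \<alpha> * D\<bar>" using w by (simp add: abs_mult)
    also have "\<dots> \<le> \<delta> + (2 * n + 2) * \<delta>" unfolding eq using xy by_ ax by linarith
    also have "\<dots> \<le> 2 * ((n + 3) * \<delta>)" using \<delta>0 by (simp add: algebra_simps)
    finally show ?thesis by simp
  qed
  have "(n + 3) * \<delta> + \<delta> = (real a + real b + 4) * \<delta>" by (simp add: n_def algebra_simps)
  then show "f1 \<alpha> \<le> 2 * (real a + real b + 1) + (real a + real b + 4) * \<delta>"
    "2 * (real a + real b + 1) - (real a + real b + 4) * \<delta> \<le> f2 \<alpha>"
    using D x y unfolding D_def f1_def f2_def by linarith+
qed

lemma good_interval:
  assumes "0 < \<delta>"
  obtains \<alpha>0 \<alpha>1 where "\<alpha>0 \<le> \<alpha>1" "\<forall>\<alpha>\<in>{\<alpha>0..\<alpha>1}. good \<alpha>" "M \<le> f1 \<alpha>0" "x_inf \<alpha>1 + y_inf \<alpha>1 < \<delta>"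
  using far_right[OF assms] f1_unbounded by metis

section \<open>Intermediate values\<close>

lemma F2_attained:
  assumes "2 * (real b + 1) < \<gamma>" "\<gamma> < 2 * (real a + real b + 1)"
  obtains \<alpha> where "good \<alpha>" "f2 \<alpha> = \<gamma>"
proof -
  define e where "e = \<gamma> - 2 * real b - 2"
  define g where "g = 2 * (real a + real b + 1) - \<gamma>"
  \<comment> \<open>Small enough for \<open>f2\<close> at the right end to fall short of
    \<open>2 (a + b + 1)\<close> by at most \<open>g\<close>, that is, to be at least
    \<open>\<gamma>\<close>.\<close>
  define \<delta> where "\<delta> = min 1 (g / (real a + real b + 4))"
  have e: "0 < e" and g: "0 < g" using assms by (simp_all add: e_def g_def)
  have \<delta>: "0 < \<delta>" "\<delta> \<le> 1" using g by (simp_all add: \<delta>_def add_nonneg_pos)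
  have "(real a + real b + 4) * \<delta> \<le> (real a + real b + 4) * (g / (real a + real b + 4))"
    unfolding \<delta>_def by (intro mult_left_mono) auto
  also have "\<dots> = g" by (simp add: add_nonneg_pos less_imp_neq[symmetric])
  finally have \<delta>g: "(real a + real b + 4) * \<delta> \<le> g" .
  \<comment> \<open>If \<open>f2\<close> exceeded \<open>\<gamma>\<close> where
    \<open>f1 \<ge> M\<close>, then \<open>(f1 - 2a) (f2 - 2b - 2)\<close> would reach
    \<open>4a (b + 1)\<close> and \<open>x_inf\<close> could not be positive.\<close>
  define M where "M = 2 * real a + 4 * real a * (real b + 1) / e"
  obtain \<alpha>0 \<alpha>1 where I: "\<alpha>0 \<le> \<alpha>1" "\<forall>\<alpha>\<in>{\<alpha>0..\<alpha>1}. good \<alpha>" "M \<le> f1 \<alpha>0" "x_inf \<alpha>1 + y_inf \<alpha>1 < \<delta>"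
    using good_interval[OF \<delta>(1)] by metis
  have good: "good \<alpha>0" "good \<alpha>1" using I by auto
  have right: "\<gamma> \<le> f2 \<alpha>1"
    using close_to_critical(2)[OF good(2) I(4) \<delta>(2)] \<delta>g by (simp add: g_def)
  have left: "f2 \<alpha>0 \<le> \<gamma>"
  proof (rule ccontr)
    assume "\<not> f2 \<alpha>0 \<le> \<gamma>"
    then have "(4 * real a * (real b + 1) / e) * e \<le> (f1 \<alpha>0 - 2 * real a) * (f2 \<alpha>0 - 2 * real b - 2)"
      using I(3) e good_limits(9)[OF good(1)] by (intro mult_mono) (auto simp: M_def e_def)
    then have "x_inf \<alpha>0 \<le> 0" using e by (simp add: masses_of_fluxes(1)[OF good(1)])
    then show False using good_limits(12)[OF good(1)] by simp
  qed
  have "continuous_on {\<alpha>0..\<alpha>1} f2" by (rule f_continuous(2)) (use I in blast)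
  from IVT'[OF left right I(1) this] obtain \<alpha> where "\<alpha>0 \<le> \<alpha>" "\<alpha> \<le> \<alpha>1" "f2 \<alpha> = \<gamma>" by blast
  then show thesis by (intro that[of \<alpha>]) (use I(2) in auto)
qed

lemma F1_attained:
  assumes "2 * (real a + real b + 1) < \<gamma>"
  obtains \<alpha> where "good \<alpha>" "f1 \<alpha> = \<gamma>"
proof -
  define g where "g = \<gamma> - 2 * (real a + real b + 1)"
  define \<delta> where "\<delta> = min 1 (g / (real a + real b + 4))"
  have g: "0 < g" using assms by (simp add: g_def)
  have \<delta>: "0 < \<delta>" "\<delta> \<le> 1" using g by (simp_all add: \<delta>_def add_nonneg_pos)
  have "(real a + real b + 4) * \<delta> \<le> (real a + real b + 4) * (g / (real a + real b + 4))"
    unfolding \<delta>_def by (intro mult_left_mono) auto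
  also have "\<dots> = g" by (simp add: add_nonneg_pos less_imp_neq[symmetric])
  finally have \<delta>g: "(real a + real b + 4) * \<delta> \<le> g" .
  obtain \<alpha>0 \<alpha>1 where I: "\<alpha>0 \<le> \<alpha>1" "\<forall>\<alpha>\<in>{\<alpha>0..\<alpha>1}. good \<alpha>" "\<gamma> \<le> f1 \<alpha>0" "x_inf \<alpha>1 + y_inf \<alpha>1 < \<delta>"
    using good_interval[OF \<delta>(1)] by metis
  have "good \<alpha>1" using I by auto
  then have right: "f1 \<alpha>1 \<le> \<gamma>"
    using close_to_critical(1)[OF _ I(4) \<delta>(2)] \<delta>g by (simp add: g_def)
  have "continuous_on {\<alpha>0..\<alpha>1} f1" by (rule f_continuous(1)) (use I in blast)
  from IVT2'[OF right I(3) I(1) this] obtain \<alpha> where "\<alpha>0 \<le> \<alpha>" "\<alpha> \<le> \<alpha>1" "f1 \<alpha> = \<gamma>" by blast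
  then show thesis by (intro that[of \<alpha>]) (use I(2) in auto)
qed

lemma energy_attained:
  assumes "0 < E"
  obtains \<alpha> where "good \<alpha>" "x_inf \<alpha> + y_inf \<alpha> = E"
proof -
  \<comment> \<open>As \<open>f2 - 2b > 2\<close>, the condition \<open>f1 \<ge> M\<close> forces
    \<open>y_inf \<ge> E\<close>.\<close>
  define M where "M = 2 * real a + 2 + (E + 2 * (real a + 1) * real b)"
  obtain \<alpha>0 \<alpha>1 where I: "\<alpha>0 \<le> \<alpha>1" "\<forall>\<alpha>\<in>{\<alpha>0..\<alpha>1}. good \<alpha>" "M \<le> f1 \<alpha>0" "x_inf \<alpha>1 + y_inf \<alpha>1 < E"
    using good_interval[OF assms] by metis
  have good: "good \<alpha>0" using I by auto
  note l = good_limits[OF good]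
  have "(E + 2 * (real a + 1) * real b) * 2 \<le> (f1 \<alpha>0 - 2 * real a - 2) * (f2 \<alpha>0 - 2 * real b)"
    using I(3) l(9,10) assms by (intro mult_mono) (auto simp: M_def)
  moreover have "(E + 2 * (real a + 1) * real b) * 2 = 2 * E + 4 * (real a + 1) * real b" by simp
  moreover have "2 * y_inf \<alpha>0 = (f1 \<alpha>0 - 2 * real a - 2) * (f2 \<alpha>0 - 2 * real b) - 4 * (real a + 1) * real b"
    by (simp add: masses_of_fluxes(2)[OF good])
  ultimately have "E \<le> y_inf \<alpha>0" by linarith
  then have left: "E \<le> x_inf \<alpha>0 + y_inf \<alpha>0" using l(12) by simp
  \<comment> \<open>The masses written as polynomials in the fluxes, whose continuity on good
    parameters is known.\<close>
  have "continuous_on {\<alpha>0..\<alpha>1} (\<lambda>\<alpha>.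
    (4 * real a * (real b + 1) - (f1 \<alpha> - 2 * real a) * (f2 \<alpha> - 2 * real b - 2)) / 2 +
    ((f1 \<alpha> - 2 * real a - 2) * (f2 \<alpha> - 2 * real b) - 4 * (real a + 1) * real b) / 2)"
    by (intro continuous_intros f_continuous) (use I in auto)
  then have "continuous_on {\<alpha>0..\<alpha>1} (\<lambda>\<alpha>. x_inf \<alpha> + y_inf \<alpha>)"
    by (rule continuous_on_eq) (use I in \<open>simp add: masses_of_fluxes\<close>)
  from IVT2'[OF less_imp_le[OF I(4)] left I(1) this]
  obtain \<alpha> where "\<alpha>0 \<le> \<alpha>" "\<alpha> \<le> \<alpha>1" "x_inf \<alpha> + y_inf \<alpha> = E" by blast
  then show thesis by (intro that[of \<alpha>]) (use I(2) in auto)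
qed

lemma energy_has_integral:
  assumes "good \<alpha>"
  shows "((\<lambda>t. t ^ (2 * a + 1) * exp (U \<alpha> t) + t ^ (2 * b + 1) * exp (V \<alpha> t)) has_integral x_inf \<alpha> + y_inf \<alpha>) {0..}"
  by (rule at_infinity_of_masses(3)[OF cp_solution_continuous[OF sol] good_limits(1-3)[OF assms]])

end

section \<open>Assembling the statements\<close>

lemma beta_bounds_of_solution:
  assumes ab: "0 < a" "0 < b" and sol: "cp_solution a b \<alpha>1 \<alpha>2 U V"
    and hyp: "(\<exists>\<gamma>. 2 * real b + 2 < \<gamma> \<and> (F2 a b U V \<longlongrightarrow> \<gamma>) at_top) \<or>
      (\<exists>\<gamma>. (F1 a b U V \<longlongrightarrow> \<gamma>) at_top) \<or>
      (\<lambda>t. t ^ (2 * a + 1) * exp (U t) + t ^ (2 * b + 1) * exp (V t)) integrable_on {0..}"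
  shows "\<exists>f1 f2 \<beta>1 \<beta>2.
           F1_at_infinity a b U V f1 \<and> F2_at_infinity a b U V f2 \<and>
           \<beta>1 = f1 / 2 - real a \<and> \<beta>2 = f2 / 2 - real b \<and>
           \<beta>1 > real b + 1 \<and> 1 < \<beta>2 \<and> \<beta>2 < real a + 1 \<and>
           0 < (\<beta>1 - 1) * (\<beta>2 - 1) \<and>
           (\<beta>1 - 1) * (\<beta>2 - 1) < (real a + 1) * (real b + 1) \<and>
           \<beta>2 * (\<beta>1 - 1) > real b * (real a + 1) \<and>
           0 < \<beta>1 * (\<beta>2 - 1) \<and>
           \<beta>1 * (\<beta>2 - 1) < real a * (real b + 1)"
proof -
  show ?thesis
  proof (rule F1_bounded_of_hypothesis[OF ab sol hyp], rule bounded_flux_limits[OF ab sol])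
    show "F1 a b U V r \<le> M" if "\<And>r. 0 < r \<Longrightarrow> F1 a b U V r \<le> M" "0 < r" for M r
      using that by blast
    fix X Y W
    assume l: "(mass a U \<longlongrightarrow> X) at_top" "(mass b V \<longlongrightarrow> Y) at_top"
        "(mass (a + b) (\<lambda>t. U t + V t) \<longlongrightarrow> W) at_top"
      and f: "2 * real a + 2 < W + Y" "2 * real b + 2 < W - X"
        "(W + Y) * (W - X) = (2 * real a + 2 * real b + 2) * W + (2 * real b + 2) * Y - (2 * real a + 2) * X"
      and pos: "0 < X" "0 < Y" "0 < W"
    have "0 < real a" "0 < real b" using ab by simp_all
    note bb = beta_bounds[OF this pos f]
    show ?thesis
      by (rule exI[of _ "W + Y"], rule exI[of _ "W - X"], intro exI conjI, rule at_infinity_of_masses(1)[OF cp_solution_continuous[OF sol] l],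
          rule at_infinity_of_masses(2)[OF cp_solution_continuous[OF sol] l], rule refl, rule refl)
         (rule bb)+
  qed
qed

theorem theorem1:
  fixes N N1 N2 :: nat and \<sigma> k :: real
  assumes "N \<ge> 2" and "\<sigma> > 0" and "k > 0" and "N1 > 0" and "N2 > 0"
  shows
    "(\<forall>L. \<forall>\<gamma>\<in>{2 * (real N2 + 1) <..< 2 * (real N1 + real N2 + 1)}. \<exists>\<alpha> U V.
        unique_cp_solution N1 N2 \<alpha> (V_init N1 N2 L \<alpha>) U V \<and> F2_at_infinity N1 N2 U V \<gamma>) \<and>
     (\<forall>L. \<forall>\<gamma>\<in>{2 * (real N1 + real N2 + 1) <..}. \<exists>\<alpha> U V.
        unique_cp_solution N1 N2 \<alpha> (V_init N1 N2 L \<alpha>) U V \<and> F1_at_infinity N1 N2 U V \<gamma>) \<and>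
     (\<forall>L. \<forall>E>0. \<exists>\<alpha> U V.
        unique_cp_solution N1 N2 \<alpha> (V_init N1 N2 L \<alpha>) U V \<and> energy_eq N \<sigma> k N1 N2 U V E) \<and>
     (\<forall>L \<alpha> U V.
        cp_solution N1 N2 \<alpha> (V_init N1 N2 L \<alpha>) U V \<and>
        ((\<exists>\<gamma>\<in>{2 * (real N2 + 1) <..< 2 * (real N1 + real N2 + 1)}. F2_at_infinity N1 N2 U V \<gamma>) \<or>
         (\<exists>\<gamma>\<in>{2 * (real N1 + real N2 + 1) <..}. F1_at_infinity N1 N2 U V \<gamma>) \<or>
         (\<exists>E>0. energy_eq N \<sigma> k N1 N2 U V E)) \<longrightarrow>
        (\<exists>f1 f2 \<beta>1 \<beta>2.
           F1_at_infinity N1 N2 U V f1 \<and> F2_at_infinity N1 N2 U V f2 \<and>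
           \<beta>1 = f1 / 2 - real N1 \<and> \<beta>2 = f2 / 2 - real N2 \<and>
           \<beta>1 > real N2 + 1 \<and> 1 < \<beta>2 \<and> \<beta>2 < real N1 + 1 \<and>
           0 < (\<beta>1 - 1) * (\<beta>2 - 1) \<and>
           (\<beta>1 - 1) * (\<beta>2 - 1) < (real N1 + 1) * (real N2 + 1) \<and>
           \<beta>2 * (\<beta>1 - 1) > real N2 * (real N1 + 1) \<and>
           0 < \<beta>1 * (\<beta>2 - 1) \<and>
           \<beta>1 * (\<beta>2 - 1) < real N1 * (real N2 + 1)))"
proof -
  \<comment> \<open>A positive factor: prescribing the energy \<open>E\<close> means prescribing
    \<open>x_inf + y_inf = E / c\<close>.\<close>
  define c where "c = real N * (real N - 1) * \<sigma> ^ 3 * k"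
  have c: "0 < c" using assms by (simp add: c_def)
  have attained: "(\<forall>\<gamma>\<in>{2 * (real N2 + 1) <..< 2 * (real N1 + real N2 + 1)}. \<exists>\<alpha> U V.
        unique_cp_solution N1 N2 \<alpha> (V_init N1 N2 L \<alpha>) U V \<and> F2_at_infinity N1 N2 U V \<gamma>) \<and>
     (\<forall>\<gamma>\<in>{2 * (real N1 + real N2 + 1) <..}. \<exists>\<alpha> U V.
        unique_cp_solution N1 N2 \<alpha> (V_init N1 N2 L \<alpha>) U V \<and> F1_at_infinity N1 N2 U V \<gamma>) \<and>
     (\<forall>E>0. \<exists>\<alpha> U V.
        unique_cp_solution N1 N2 \<alpha> (V_init N1 N2 L \<alpha>) U V \<and> energy_eq N \<sigma> k N1 N2 U V E)" for L
  proof -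
    have "\<forall>\<alpha>. \<exists>UV. unique_cp_solution N1 N2 \<alpha> (V_init N1 N2 L \<alpha>) (fst UV) (snd UV)"
    proof
      fix \<alpha>
      obtain U V where "unique_cp_solution N1 N2 \<alpha> (V_init N1 N2 L \<alpha>) U V"
        by (rule unique_cp_solution_exists)
      then show "\<exists>UV. unique_cp_solution N1 N2 \<alpha> (V_init N1 N2 L \<alpha>) (fst UV) (snd UV)"
        by (intro exI[of _ "(U, V)"]) simp
    qed
    then obtain UV where UV: "\<And>\<alpha>. unique_cp_solution N1 N2 \<alpha> (V_init N1 N2 L \<alpha>) (fst (UV \<alpha>)) (snd (UV \<alpha>))"
      using choice[of "\<lambda>\<alpha> UV. unique_cp_solution N1 N2 \<alpha> (V_init N1 N2 L \<alpha>) (fst UV) (snd UV)"] by blast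
    interpret cp_family N1 N2 L "\<lambda>\<alpha>. fst (UV \<alpha>)" "\<lambda>\<alpha>. snd (UV \<alpha>)"
      by unfold_locales (use assms UV in \<open>auto simp: unique_cp_solution_def\<close>)
    show ?thesis
    proof (intro conjI ballI allI impI)
      fix \<gamma> assume "\<gamma> \<in> {2 * (real N2 + 1) <..< 2 * (real N1 + real N2 + 1)}"
      then obtain \<alpha> where "good \<alpha>" "f2 \<alpha> = \<gamma>" using F2_attained by auto
      then show "\<exists>\<alpha> U V. unique_cp_solution N1 N2 \<alpha> (V_init N1 N2 L \<alpha>) U V \<and> F2_at_infinity N1 N2 U V \<gamma>"
        using UV good_facts(5) by blast
    next
      fix \<gamma> assume "\<gamma> \<in> {2 * (real N1 + real N2 + 1) <..}"
      then obtain \<alpha> where "good \<alpha>" "f1 \<alpha> = \<gamma>" using F1_attained by auto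
      then show "\<exists>\<alpha> U V. unique_cp_solution N1 N2 \<alpha> (V_init N1 N2 L \<alpha>) U V \<and> F1_at_infinity N1 N2 U V \<gamma>"
        using UV good_facts(4) by blast
    next
      fix E :: real assume "0 < E"
      then obtain \<alpha> where "good \<alpha>" and E: "x_inf \<alpha> + y_inf \<alpha> = E / c"
        using energy_attained[of "E / c"] c by auto
      have "energy_eq N \<sigma> k N1 N2 (fst (UV \<alpha>)) (snd (UV \<alpha>)) E"
        using energy_has_integral[OF \<open>good \<alpha>\<close>] c unfolding energy_eq_def c_def[symmetric] E
        by (auto simp: has_integral_iff)
      then show "\<exists>\<alpha> U V. unique_cp_solution N1 N2 \<alpha> (V_init N1 N2 L \<alpha>) U V \<and> energy_eq N \<sigma> k N1 N2 U V E"
        using UV by blast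
    qed
  qed
  show ?thesis
  proof (intro conjI)
    show "\<forall>L \<alpha> U V.
        cp_solution N1 N2 \<alpha> (V_init N1 N2 L \<alpha>) U V \<and>
        ((\<exists>\<gamma>\<in>{2 * (real N2 + 1) <..< 2 * (real N1 + real N2 + 1)}. F2_at_infinity N1 N2 U V \<gamma>) \<or>
         (\<exists>\<gamma>\<in>{2 * (real N1 + real N2 + 1) <..}. F1_at_infinity N1 N2 U V \<gamma>) \<or>
         (\<exists>E>0. energy_eq N \<sigma> k N1 N2 U V E)) \<longrightarrow>
        (\<exists>f1 f2 \<beta>1 \<beta>2.
           F1_at_infinity N1 N2 U V f1 \<and> F2_at_infinity N1 N2 U V f2 \<and>
           \<beta>1 = f1 / 2 - real N1 \<and> \<beta>2 = f2 / 2 - real N2 \<and>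
           \<beta>1 > real N2 + 1 \<and> 1 < \<beta>2 \<and> \<beta>2 < real N1 + 1 \<and>
           0 < (\<beta>1 - 1) * (\<beta>2 - 1) \<and>
           (\<beta>1 - 1) * (\<beta>2 - 1) < (real N1 + 1) * (real N2 + 1) \<and>
           \<beta>2 * (\<beta>1 - 1) > real N2 * (real N1 + 1) \<and>
           0 < \<beta>1 * (\<beta>2 - 1) \<and>
           \<beta>1 * (\<beta>2 - 1) < real N1 * (real N2 + 1))"
    proof (intro allI impI, elim conjE)
      fix L \<alpha> U V
      assume sol: "cp_solution N1 N2 \<alpha> (V_init N1 N2 L \<alpha>) U V"
        and hyp: "(\<exists>\<gamma>\<in>{2 * (real N2 + 1) <..< 2 * (real N1 + real N2 + 1)}. F2_at_infinity N1 N2 U V \<gamma>) \<or>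
         (\<exists>\<gamma>\<in>{2 * (real N1 + real N2 + 1) <..}. F1_at_infinity N1 N2 U V \<gamma>) \<or>
         (\<exists>E>0. energy_eq N \<sigma> k N1 N2 U V E)"
      from hyp have "(\<exists>\<gamma>. 2 * real N2 + 2 < \<gamma> \<and> (F2 N1 N2 U V \<longlongrightarrow> \<gamma>) at_top) \<or>
        (\<exists>\<gamma>. (F1 N1 N2 U V \<longlongrightarrow> \<gamma>) at_top) \<or>
        (\<lambda>t. t ^ (2 * N1 + 1) * exp (U t) + t ^ (2 * N2 + 1) * exp (V t)) integrable_on {0..}"
        by (elim disjE bexE exE conjE)
           (auto simp: F1_at_infinity_def F2_at_infinity_def energy_eq_def)
      then show "\<exists>f1 f2 \<beta>1 \<beta>2.
           F1_at_infinity N1 N2 U V f1 \<and> F2_at_infinity N1 N2 U V f2 \<and>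
           \<beta>1 = f1 / 2 - real N1 \<and> \<beta>2 = f2 / 2 - real N2 \<and>
           \<beta>1 > real N2 + 1 \<and> 1 < \<beta>2 \<and> \<beta>2 < real N1 + 1 \<and>
           0 < (\<beta>1 - 1) * (\<beta>2 - 1) \<and>
           (\<beta>1 - 1) * (\<beta>2 - 1) < (real N1 + 1) * (real N2 + 1) \<and>
           \<beta>2 * (\<beta>1 - 1) > real N2 * (real N1 + 1) \<and>
           0 < \<beta>1 * (\<beta>2 - 1) \<and>
           \<beta>1 * (\<beta>2 - 1) < real N1 * (real N2 + 1)"
        by (rule beta_bounds_of_solution[OF assms(4,5) sol])
    qed
  qed (use attained in blast)+
qed

end
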